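(* There exist absolute constants $C, c, \varepsilon_0 > 0$ such that the following holds. Let $\varepsilon \in (0, \varepsilon_0]$ and let $x_1, \dots, x_n$ be i.i.d. samples from a centered elliptical distribution on $\mathbb{R}^p$ with shape matrix $\Sigma$, where $n \geq C p^2 / \varepsilon^2$. Then with probability at least $1 - \exp(-c\, n \varepsilon^2 / p^2)$, Tyler's M-estimator $\widehat{\Sigma}$ of $x_1,\dots,x_n$ exists and satisfies $$\|I_p - \Sigma^{1/2} \widehat{\Sigma}^{-1} \Sigma^{1/2}\|_{F} \leq \varepsilon.$$
   Context: A centered elliptical distribution on $\mathbb{R}^p$ with shape matrix $\Sigma$ is the law of $X = u\, \Sigma^{1/2} V$, where $\Sigma$ is a fixed $p \times p$ positive-definite matrix normalized so that $\operatorname{tr}\Sigma = p$, $V$ is uniformly distributed on the unit sphere $\mathbb{S}^{p-1}$, and $u$ is a real random scalar independent of $V$ with $u \neq 0$ almost surely. Given $x_1, \dots, x_n \in \mathbb{R}^p$, Tyler's M-estimator $\widehat{\Sigma}$ is the unique positive-definite $p\times p$ matrix satisfying $$\frac{p}{n}\sum_{i=1}^n \frac{x_i x_i^\top}{x_i^\top \widehat{\Sigma}^{-1} x_i} = \widehat{\Sigma}, \qquad \operatorname{tr}\widehat{\Sigma} = p,$$ when such a solution exists and is unique. $\|\cdot\|_F$ is the Frobenius norm. *)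

theory Defs
  imports
    "HOL-Probability.Probability"
    "Jordan_Normal_Form.Matrix"
    "Jordan_Normal_Form.Gauss_Jordan_Elimination"
begin

text \<open>
  The constants of the theorem are uniform in the dimension, which therefore has to be quantified
  inside the formula; vectors and matrices are those of Jordan Normal Form, whose dimensions are
  natural numbers. HOL-Analysis also declares a type and a function called \<open>vec\<close>, hence
  the qualified names.
\<close>

no_notation inner (infix \<open>\<bullet>\<close> 70)
no_notation vec_nth (infixl \<open>$\<close> 90)

type_synonym rvec = "real Matrix.vec"
type_synonym rmat = "real Matrix.mat"

definition mat_trace :: "rmat \<Rightarrow> real" where
  "mat_trace A = (\<Sum>i<dim_row A. A $$ (i, i))"

definition frobenius_norm :: "rmat \<Rightarrow> real" where
  "frobenius_norm A = sqrt (\<Sum>i<dim_row A. \<Sum>j<dim_col A. (A $$ (i, j))\<^sup>2)"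

definition pos_def :: "nat \<Rightarrow> rmat \<Rightarrow> bool" where
  "pos_def p A \<longleftrightarrow> A \<in> carrier_mat p p \<and> transpose_mat A = A \<and>
     (\<forall>v \<in> carrier_vec p. v \<noteq> 0\<^sub>v p \<longrightarrow> v \<bullet> (A *\<^sub>v v) > 0)"

definition mat_inv :: "rmat \<Rightarrow> rmat" where
  "mat_inv A = the (mat_inverse A)"

definition mat_sqrt :: "rmat \<Rightarrow> rmat" where
  "mat_sqrt A = (THE R. pos_def (dim_row A) R \<and> R * R = A)"

definition euclid_norm :: "rvec \<Rightarrow> real" where
  "euclid_norm v = sqrt (v \<bullet> v)"

text \<open>The Borel sigma-algebra of \<open>p\<close>-dimensional space, generated by the coordinates.\<close>

definition vec_borel :: "nat \<Rightarrow> rvec measure" where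
  "vec_borel p = vimage_algebra (carrier_vec p) (\<lambda>v. \<lambda>i\<in>{..<p}. v $ i) (\<Pi>\<^sub>M i\<in>{..<p}. borel)"

definition vec_lborel :: "nat \<Rightarrow> rvec measure" where
  "vec_lborel p = distr (\<Pi>\<^sub>M i\<in>{..<p}. lborel) (vec_borel p) (Matrix.vec p)"

text \<open>
  Normalized surface measure of the unit sphere, by the usual cone construction: the measure of
  a set \<open>A\<close> of unit vectors is the proportion of the volume of the unit ball taken up by the
  cone \<open>{r v | 0 < r \<le> 1, v \<in> A}\<close>. For \<open>p = 1\<close> this is the uniform distribution
  on the two points \<open>1\<close> and \<open>-1\<close>.
\<close>

definition sphere_uniform :: "nat \<Rightarrow> rvec measure" where
  "sphere_uniform p =
     distr (uniform_measure (vec_lborel p) {v \<in> carrier_vec p. euclid_norm v \<le> 1})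
       (vec_borel p) (\<lambda>v. (1 / euclid_norm v) \<cdot>\<^sub>v v)"

text \<open>
  In the following definition, \<open>\<mu>\<close> is the law of the scalar \<open>u\<close>; as \<open>u\<close> and \<open>V\<close> are
  independent, the law of the pair is a product measure.
\<close>

definition elliptical :: "nat \<Rightarrow> rmat \<Rightarrow> rvec measure \<Rightarrow> bool" where
  "elliptical p \<Sigma> D \<longleftrightarrow> pos_def p \<Sigma> \<and> mat_trace \<Sigma> = real p \<and>
     (\<exists>\<mu> :: real measure. prob_space \<mu> \<and> sets \<mu> = sets borel \<and> (AE u in \<mu>. u \<noteq> 0) \<and>
        D = distr (\<mu> \<Otimes>\<^sub>M sphere_uniform p) (vec_borel p)
              (\<lambda>(u, v). u \<cdot>\<^sub>v (mat_sqrt \<Sigma> *\<^sub>v v)))"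

text \<open>
  Since \<open>z / 0 = 0\<close>, a zero sample contributes a zero summand to the equation below. This admits
  no spurious solutions: multiplying the equation by the inverse of \<open>S\<close> and taking traces shows
  that it is solvable only if all samples are nonzero.
\<close>

definition tyler_solution :: "nat \<Rightarrow> nat \<Rightarrow> (nat \<Rightarrow> rvec) \<Rightarrow> rmat \<Rightarrow> bool" where
  "tyler_solution p n x S \<longleftrightarrow> pos_def p S \<and>
     Matrix.mat p p (\<lambda>(a, b). real p / real n *
       (\<Sum>i<n. (x i $ a * x i $ b) / (x i \<bullet> (mat_inv S *\<^sub>v x i)))) = S \<and>
     mat_trace S = real p"

definition tyler_exists :: "nat \<Rightarrow> nat \<Rightarrow> (nat \<Rightarrow> rvec) \<Rightarrow> bool" where
  "tyler_exists p n x \<longleftrightarrow> (\<exists>!S. tyler_solution p n x S)"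

definition tyler :: "nat \<Rightarrow> nat \<Rightarrow> (nat \<Rightarrow> rvec) \<Rightarrow> rmat" where
  "tyler p n x = (THE S. tyler_solution p n x S)"

end

theory Submission
  imports Defs "Jordan_Normal_Form.Determinant" "HOL-Real_Asymp.Real_Asymp"
begin

text \<open>
  Whitening and normalizing the samples reduces the claim to unit vectors \<open>v\<^sub>1, \<dots>, v\<^sub>n\<close>
  uniformly distributed on the sphere, with \<open>T(S) = (p/n) \<Sum> v\<^sub>i v\<^sub>i\<^sup>T / (v\<^sub>i\<^sup>T S\<^sup>-\<^sup>1 v\<^sub>i)\<close>. Two properties of
  the sample are used: \<open>M = (p/n) \<Sum> v\<^sub>i v\<^sub>i\<^sup>T\<close> is within \<open>t\<close> of the identity in operator norm, with \<open>t\<close> of the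
  order of \<open>\<epsilon> / sqrt p\<close>, and \<open>(p/n) \<Sum> \<langle>v\<^sub>i, e\<rangle>\<^sup>2 \<langle>v\<^sub>i, f\<rangle>\<^sup>2 \<ge> c / p\<close> for all unit vectors \<open>e\<close>, \<open>f\<close>.

  The derivative of \<open>T\<close> at the identity is the positive map \<open>E \<mapsto> (p/n) \<Sum> (v\<^sub>i\<^sup>T E v\<^sub>i) v\<^sub>i v\<^sub>i\<^sup>T\<close>. If \<open>E \<le> \<eta> I\<close> has
  trace zero, the second property applied to \<open>\<eta> I - E \<ge> 0\<close>, which has trace \<open>\<eta> p\<close>, shows that the image of
  \<open>E\<close> is at most \<open>(1 + t - c) \<eta> I\<close>. So a recentred version of \<open>T\<close> contracts a small operator norm ball
  around the identity, and its fixed point is within \<open>O(t)\<close> of the identity; this also absorbs the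
  change of the trace normalization when going back to the samples, and the Frobenius norm
  costs a factor \<open>sqrt p\<close>. The second property also gives global uniqueness.

  For the probability, the direction of a Gaussian vector and Jensen's inequality give
  \<open>E exp (l p \<langle>e, v\<rangle>\<^sup>2) \<le> (1 - 2 l) powr (- 1/2)\<close> for all \<open>l < 1/2\<close>. Positive and negative small \<open>l\<close> yield the
  first property on a net with \<open>exp (O(p))\<close> points; very negative \<open>l\<close> shows that for each direction at most a third
  of the samples is nearly orthogonal to it, uniformly over a net with \<open>exp (O(p\<^sup>2))\<close> points, which
  gives the second property by pigeonhole.
\<close>

section \<open>Positive definite matrices\<close>

text \<open>\<open>T\<close> is homogeneous of degree one, so its derivative does not shrink the
  identity direction; contraction is possible only between matrices of equal trace, and since
  \<open>T\<close> does not preserve the trace, a multiple of the identity is subtracted. The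
  operator norm dictates the sample size: exp (O(p)) net directions against deviation probabilities
  exp (- const n t^2), with t of order \<epsilon> / sqrt p, call for n of order p^2 / \<epsilon>^2.
  The other net must resolve distances below 1 / sqrt p, the typical cosine of a sample with a fixed
  direction; its points fail with probability exp (- n / 2), so n of order p^2 pays for exp (O(p^2))
  of them. The law of the radial factor is arbitrary, which is why only functions of the samples
  that ignore this factor are ever integrated. The probability in the theorem is the measure of a
  set defined by unique existence of a matrix, and a nonmeasurable set would count as having measure
  zero; hence measurability is a separate argument, which makes quantifiers over matrices countable
  by compactness.\<close>

lemma smult_mat_mult_vec:
  fixes A :: rmat
  assumes "A \<in> carrier_mat n m" "v \<in> carrier_vec m"
  shows "(k \<cdot>\<^sub>m A) *\<^sub>v v = k \<cdot>\<^sub>v (A *\<^sub>v v)"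
  using assms by (intro eq_vecI) auto

lemma mat_minus_mult_vec:
  fixes A B :: rmat
  assumes "A \<in> carrier_mat n m" "B \<in> carrier_mat n m" "v \<in> carrier_vec m"
  shows "(A - B) *\<^sub>v v = A *\<^sub>v v - B *\<^sub>v v"
  using assms by (intro eq_vecI) (auto simp: scalar_prod_def sum_subtractf algebra_simps)

lemma mat_plus_mult_vec:
  fixes A B :: rmat
  assumes "A \<in> carrier_mat n m" "B \<in> carrier_mat n m" "v \<in> carrier_vec m"
  shows "(A + B) *\<^sub>v v = A *\<^sub>v v + B *\<^sub>v v"
  using assms by (intro eq_vecI) (auto simp: add_scalar_prod_distrib[where n = m])

lemma mat_mult_vec_minus:
  fixes A :: rmat
  assumes "A \<in> carrier_mat n m" "v \<in> carrier_vec m" "w \<in> carrier_vec m"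
  shows "A *\<^sub>v (v - w) = A *\<^sub>v v - A *\<^sub>v w"
  using assms by (intro eq_vecI) (auto simp: scalar_prod_minus_distrib[where n = m])

lemma mat_mult_vec_plus:
  fixes A :: rmat
  assumes "A \<in> carrier_mat n m" "v \<in> carrier_vec m" "w \<in> carrier_vec m"
  shows "A *\<^sub>v (v + w) = A *\<^sub>v v + A *\<^sub>v w"
  using assms by (intro eq_vecI) (auto simp: scalar_prod_add_distrib[where n = m])

lemma mat_mult_zero_vec: "A \<in> carrier_mat n m \<Longrightarrow> (A :: rmat) *\<^sub>v 0\<^sub>v m = 0\<^sub>v n"
  by (intro eq_vecI) auto

definition symmetric :: "nat \<Rightarrow> rmat \<Rightarrow> bool" where
  "symmetric p A \<longleftrightarrow> A \<in> carrier_mat p p \<and> transpose_mat A = A"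

definition psd :: "nat \<Rightarrow> rmat \<Rightarrow> bool" where
  "psd p A \<longleftrightarrow> symmetric p A \<and> (\<forall>x \<in> carrier_vec p. 0 \<le> x \<bullet> (A *\<^sub>v x))"

text \<open>For symmetric matrices, this says that the operator norm is at most \<open>d\<close>.\<close>

definition form_bound :: "nat \<Rightarrow> rmat \<Rightarrow> real \<Rightarrow> bool" where
  "form_bound p A d \<longleftrightarrow> (\<forall>x \<in> carrier_vec p. \<bar>x \<bullet> (A *\<^sub>v x)\<bar> \<le> d * (x \<bullet> x))"

lemma symmetric_carrier [dest]: "symmetric p A \<Longrightarrow> A \<in> carrier_mat p p"
  by (simp add: symmetric_def)

lemma symmetric_index: "symmetric p A \<Longrightarrow> i < p \<Longrightarrow> j < p \<Longrightarrow> A $$ (i, j) = A $$ (j, i)"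
  unfolding symmetric_def by (metis carrier_matD index_transpose_mat(1))

lemma symmetricI:
  "A \<in> carrier_mat p p \<Longrightarrow> (\<And>i j. i < p \<Longrightarrow> j < p \<Longrightarrow> A $$ (i, j) = A $$ (j, i)) \<Longrightarrow> symmetric p A"
  unfolding symmetric_def by (auto intro!: eq_matI)

lemma symmetric_one: "symmetric p (1\<^sub>m p)"
  by (simp add: symmetric_def)

lemma symmetric_minus:
  assumes A: "symmetric p A" and B: "symmetric p B"
  shows "symmetric p (A - B)"
proof (rule symmetricI)
  fix i j assume "i < p" "j < p"
  then show "(A - B) $$ (i, j) = (A - B) $$ (j, i)"
    using symmetric_index[OF A, of i j] symmetric_index[OF B, of i j]
      symmetric_carrier[OF A] symmetric_carrier[OF B] by auto
qed (use A B in \<open>auto dest!: symmetric_carrier\<close>)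

lemma symmetric_plus:
  assumes A: "symmetric p A" and B: "symmetric p B"
  shows "symmetric p (A + B)"
proof (rule symmetricI)
  fix i j assume "i < p" "j < p"
  then show "(A + B) $$ (i, j) = (A + B) $$ (j, i)"
    using symmetric_index[OF A, of i j] symmetric_index[OF B, of i j]
      symmetric_carrier[OF A] symmetric_carrier[OF B] by auto
qed (use A B in \<open>auto dest!: symmetric_carrier\<close>)

lemma symmetric_smult:
  assumes A: "symmetric p A"
  shows "symmetric p (c \<cdot>\<^sub>m A)"
proof (rule symmetricI)
  fix i j assume "i < p" "j < p"
  then show "(c \<cdot>\<^sub>m A) $$ (i, j) = (c \<cdot>\<^sub>m A) $$ (j, i)"
    using symmetric_index[OF A, of i j] symmetric_carrier[OF A] by auto
qed (use A in \<open>auto dest!: symmetric_carrier\<close>)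

lemma pos_def_symmetric [dest]: "pos_def p A \<Longrightarrow> symmetric p A"
  by (simp add: pos_def_def symmetric_def)

lemma pos_def_gt: "pos_def p A \<Longrightarrow> x \<in> carrier_vec p \<Longrightarrow> x \<noteq> 0\<^sub>v p \<Longrightarrow> 0 < x \<bullet> (A *\<^sub>v x)"
  by (simp add: pos_def_def)

lemma pos_def_psd: "pos_def p A \<Longrightarrow> psd p A"
  unfolding psd_def
proof (intro conjI ballI)
  fix x :: rvec assume "pos_def p A" and x: "x \<in> carrier_vec p"
  then show "0 \<le> x \<bullet> (A *\<^sub>v x)"
    using pos_def_gt[of p A x] by (cases "x = 0\<^sub>v p") (auto simp: pos_def_def)
qed auto

section \<open>Quadratic forms, Cauchy-Schwarz and operator bounds\<close>

lemma form_symmetric: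
  assumes "symmetric p A" "x \<in> carrier_vec p" "y \<in> carrier_vec p"
  shows "x \<bullet> (A *\<^sub>v y) = (A *\<^sub>v x) \<bullet> y"
  using assms transpose_vec_mult_scalar[of A p p y x] by (auto simp: symmetric_def)

lemma form_commute:
  assumes "symmetric p A" "x \<in> carrier_vec p" "y \<in> carrier_vec p"
  shows "x \<bullet> (A *\<^sub>v y) = y \<bullet> (A *\<^sub>v x)"
  using form_symmetric[OF assms] assms by (metis comm_scalar_prod mult_mat_vec_carrier symmetric_carrier)

lemma form_entries:
  assumes "A \<in> carrier_mat p p" "x \<in> carrier_vec p" "y \<in> carrier_vec p"
  shows "x \<bullet> (A *\<^sub>v y) = (\<Sum>i<p. \<Sum>j<p. x $ i * A $$ (i, j) * y $ j)"
  using assms by (auto simp: scalar_prod_def atLeast0LessThan sum_distrib_left mult_ac intro!: sum.cong)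

text \<open>No sign is assumed for \<open>a\<close> or \<open>c\<close>: the polarization bound for
  \<open>form_bound\<close> applies it to coefficients that carry a factor of yet unknown sign.
  Hence \<open>c = 0\<close> and \<open>c < 0\<close> are settled by explicit points at which the
  quadratic would be negative.\<close>

lemma quadratic_nonneg_discriminant:
  fixes a b c :: real
  assumes "\<And>s. 0 \<le> a + 2 * s * b + s\<^sup>2 * c"
  shows "b\<^sup>2 \<le> a * c"
proof (cases "c = 0")
  case True
  have "b = 0"
  proof (rule ccontr)
    assume "b \<noteq> 0"
    \<comment> \<open>At this point the affine function takes the value -1.\<close>
    with assms[of "- (a + 1) / (2 * b)"] True show False by (simp add: field_simps)
  qed
  with True show ?thesis by simp
next
  case False
  have "c > 0"
  proof (rule ccontr)
    assume "\<not> c > 0"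
    with False have c: "c < 0" by simp
    \<comment> \<open>Large enough that \<open>s * (- c)\<close> exceeds
      \<open>\<bar>a\<bar> + 2 * \<bar>b\<bar>\<close>; as \<open>s \<ge> 1\<close>, the quadratic
      term then outweighs the other two.\<close>
    define s where "s = (\<bar>a\<bar> + 2 * \<bar>b\<bar> + 1) / (- c) + 1"
    have s: "s \<ge> 1" using c by (simp add: s_def field_simps)
    have "s * (- c) = (\<bar>a\<bar> + 2 * \<bar>b\<bar> + 1) + (- c)" using c by (simp add: s_def field_simps)
    then have "s * c < - (\<bar>a\<bar> + 2 * \<bar>b\<bar>)" using c by linarith
    then have "s * (s * c) < s * (- (\<bar>a\<bar> + 2 * \<bar>b\<bar>))" using s by (intro mult_strict_left_mono) auto
    moreover have "s * b \<le> s * \<bar>b\<bar>" "a \<le> s * \<bar>a\<bar>"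
      using s by (auto intro: mult_left_mono order_trans[OF abs_ge_self] mult_right_mono[of 1 s "\<bar>a\<bar>", simplified])
    ultimately show False using assms[of s] by (simp add: power2_eq_square algebra_simps)
  qed
  with assms[of "- b / c"] show ?thesis by (simp add: power2_eq_square field_simps)
qed

lemma form_plus_smult:
  assumes A: "symmetric p A" and x: "x \<in> carrier_vec p" and y: "y \<in> carrier_vec p"
  shows "(x + s \<cdot>\<^sub>v y) \<bullet> (A *\<^sub>v (x + s \<cdot>\<^sub>v y)) =
    x \<bullet> (A *\<^sub>v x) + 2 * s * (x \<bullet> (A *\<^sub>v y)) + s\<^sup>2 * (y \<bullet> (A *\<^sub>v y))"
proof -
  note Ac = symmetric_carrier[OF A]
  have "A *\<^sub>v (x + s \<cdot>\<^sub>v y) = A *\<^sub>v x + s \<cdot>\<^sub>v (A *\<^sub>v y)"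
    using mat_mult_vec_plus[OF Ac x, of "s \<cdot>\<^sub>v y"] mult_mat_vec[OF Ac y] y by simp
  then show ?thesis
    using x y Ac form_commute[OF A x y]
    by (simp add: scalar_prod_add_distrib[where n = p] add_scalar_prod_distrib[where n = p]
        power2_eq_square algebra_simps)
qed

lemma psd_Cauchy_Schwarz:
  assumes A: "psd p A" and x: "x \<in> carrier_vec p" and y: "y \<in> carrier_vec p"
  shows "(x \<bullet> (A *\<^sub>v y))\<^sup>2 \<le> (x \<bullet> (A *\<^sub>v x)) * (y \<bullet> (A *\<^sub>v y))"
proof (rule quadratic_nonneg_discriminant)
  fix s
  have "0 \<le> (x + s \<cdot>\<^sub>v y) \<bullet> (A *\<^sub>v (x + s \<cdot>\<^sub>v y))"
    using A x y by (auto simp: psd_def)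
  then show "0 \<le> x \<bullet> (A *\<^sub>v x) + 2 * s * (x \<bullet> (A *\<^sub>v y)) + s\<^sup>2 * (y \<bullet> (A *\<^sub>v y))"
    using form_plus_smult[of p A x y s] A x y by (simp add: psd_def)
qed

lemma scalar_prod_self_sum: "x \<in> carrier_vec p \<Longrightarrow> (x :: rvec) \<bullet> x = (\<Sum>i<p. (x $ i)\<^sup>2)"
  by (auto simp: scalar_prod_def power2_eq_square atLeast0LessThan)

lemma scalar_prod_self_nonneg: "0 \<le> (x :: rvec) \<bullet> x"
  by (auto simp: scalar_prod_def intro: sum_nonneg)

lemma scalar_prod_self_pos: "x \<in> carrier_vec p \<Longrightarrow> x \<noteq> 0\<^sub>v p \<Longrightarrow> 0 < (x :: rvec) \<bullet> x"
proof -
  assume x: "x \<in> carrier_vec p" "x \<noteq> 0\<^sub>v p"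
  then obtain i where i: "i < p" "x $ i \<noteq> 0" by (auto simp: vec_eq_iff)
  then have "0 < (x $ i)\<^sup>2" by simp
  also have "\<dots> \<le> (\<Sum>i<p. (x $ i)\<^sup>2)" using i by (intro member_le_sum) auto
  finally show ?thesis using x by (simp add: scalar_prod_self_sum)
qed

lemma pos_def_one: "pos_def p (1\<^sub>m p)"
  by (simp add: pos_def_def scalar_prod_self_pos)

lemma scalar_prod_Cauchy_Schwarz:
  assumes "x \<in> carrier_vec p" "y \<in> carrier_vec p"
  shows "((x :: rvec) \<bullet> y)\<^sup>2 \<le> (x \<bullet> x) * (y \<bullet> y)"
  using psd_Cauchy_Schwarz[OF pos_def_psd[OF pos_def_one] assms] assms by simp

lemma euclid_norm_square: "(euclid_norm x)\<^sup>2 = x \<bullet> x"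
  by (simp add: euclid_norm_def scalar_prod_self_nonneg)

lemma euclid_norm_nonneg [simp]: "0 \<le> euclid_norm x"
  by (simp add: euclid_norm_def scalar_prod_self_nonneg)

lemma euclid_norm_pos: "x \<in> carrier_vec p \<Longrightarrow> x \<noteq> 0\<^sub>v p \<Longrightarrow> 0 < euclid_norm x"
  by (simp add: euclid_norm_def scalar_prod_self_pos)

lemma abs_scalar_prod_le:
  assumes "x \<in> carrier_vec p" "y \<in> carrier_vec p"
  shows "\<bar>x \<bullet> y\<bar> \<le> euclid_norm x * euclid_norm y"
  using scalar_prod_Cauchy_Schwarz[OF assms] abs_le_square_iff[of "x \<bullet> y" "euclid_norm x * euclid_norm y"]
  by (simp add: power_mult_distrib euclid_norm_square)

lemma euclid_norm_L2: "x \<in> carrier_vec p \<Longrightarrow> euclid_norm x = L2_set (\<lambda>i. x $ i) {..<p}"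
  by (simp add: euclid_norm_def L2_set_def scalar_prod_self_sum)

lemma euclid_norm_smult: "euclid_norm (c \<cdot>\<^sub>v x) = \<bar>c\<bar> * euclid_norm x"
proof -
  have "(c \<cdot>\<^sub>v x) \<bullet> (c \<cdot>\<^sub>v x) = c\<^sup>2 * (x \<bullet> x)" by (simp add: power2_eq_square)
  then show ?thesis by (simp add: euclid_norm_def real_sqrt_mult)
qed

lemma euclid_norm_add:
  assumes "x \<in> carrier_vec p" "y \<in> carrier_vec p"
  shows "euclid_norm (x + y) \<le> euclid_norm x + euclid_norm y"
proof -
  have "euclid_norm (x + y) = L2_set (\<lambda>i. x $ i + y $ i) {..<p}"
    using assms by (auto simp: euclid_norm_L2[where p = p] intro!: L2_set_cong)
  with L2_set_triangle_ineq[of "\<lambda>i. x $ i" "\<lambda>i. y $ i" "{..<p}"] show ?thesis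
    using assms by (simp add: euclid_norm_L2[where p = p])
qed

text \<open>Polarization with a free weight: the forms at \<open>x + s y\<close> and
  \<open>x - s y\<close> differ by \<open>4 s\<close> times the bilinear value, and the
  parallelogram law turns the two bounds into a nonnegative quadratic in \<open>s\<close>. Its
  discriminant yields the product of the norms instead of half the sum of their squares.\<close>

lemma form_bound_bilinear:
  assumes A: "symmetric p A" and d: "form_bound p A d"
    and x: "x \<in> carrier_vec p" and y: "y \<in> carrier_vec p"
  shows "\<bar>x \<bullet> (A *\<^sub>v y)\<bar> \<le> d * euclid_norm x * euclid_norm y"
proof -
  note Ac = symmetric_carrier[OF A]
  have pol: "4 * s * (x \<bullet> (A *\<^sub>v y)) \<le> d * (2 * (x \<bullet> x) + 2 * s\<^sup>2 * (y \<bullet> y))" for s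
  proof -
    have "(x + s \<cdot>\<^sub>v y) \<bullet> (A *\<^sub>v (x + s \<cdot>\<^sub>v y)) \<le> d * ((x + s \<cdot>\<^sub>v y) \<bullet> (x + s \<cdot>\<^sub>v y))"
      "- ((x + (- s) \<cdot>\<^sub>v y) \<bullet> (A *\<^sub>v (x + (- s) \<cdot>\<^sub>v y))) \<le> d * ((x + (- s) \<cdot>\<^sub>v y) \<bullet> (x + (- s) \<cdot>\<^sub>v y))"
      using d[unfolded form_bound_def, rule_format, of "x + s \<cdot>\<^sub>v y"]
        d[unfolded form_bound_def, rule_format, of "x + (- s) \<cdot>\<^sub>v y"] x y by auto
    moreover have "(x + s \<cdot>\<^sub>v y) \<bullet> (x + s \<cdot>\<^sub>v y) = x \<bullet> x + 2 * s * (x \<bullet> y) + s\<^sup>2 * (y \<bullet> y)" for s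
      using form_plus_smult[OF symmetric_one x y, of s] x y by simp
    ultimately show ?thesis
      using form_plus_smult[OF A x y, of s] form_plus_smult[OF A x y, of "- s"]
      by (simp add: algebra_simps)
  qed
  have "(- (x \<bullet> (A *\<^sub>v y)))\<^sup>2 \<le> (d * (x \<bullet> x)) * (d * (y \<bullet> y))"
  proof (rule quadratic_nonneg_discriminant)
    fix s show "0 \<le> d * (x \<bullet> x) + 2 * s * (- (x \<bullet> (A *\<^sub>v y))) + s\<^sup>2 * (d * (y \<bullet> y))"
      using pol[of s] by (simp add: algebra_simps)
  qed
  also have "\<dots> = (d * euclid_norm x * euclid_norm y)\<^sup>2"
    by (simp add: power_mult_distrib euclid_norm_square power2_eq_square[of d])
  finally have "\<bar>x \<bullet> (A *\<^sub>v y)\<bar> \<le> \<bar>d * euclid_norm x * euclid_norm y\<bar>"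
    by (simp add: abs_le_square_iff)
  \<comment> \<open>The sign of \<open>d\<close> is not a hypothesis; a nonzero \<open>x\<close>
    forces \<open>0 \<le> d\<close>.\<close>
  also have "\<dots> = d * euclid_norm x * euclid_norm y"
  proof (cases "x = 0\<^sub>v p")
    case True then show ?thesis by (simp add: euclid_norm_def)
  next
    case False
    then have "0 < x \<bullet> x" using x scalar_prod_self_pos by blast
    moreover have "0 \<le> d * (x \<bullet> x)"
      using d x abs_ge_zero order_trans unfolding form_bound_def by blast
    ultimately have "0 \<le> d" by (simp add: zero_le_mult_iff)
    then show ?thesis by simp
  qed
  finally show ?thesis .
qed

lemma form_bound_norm:
  assumes "symmetric p A" "form_bound p A d" "y \<in> carrier_vec p"
  shows "euclid_norm (A *\<^sub>v y) \<le> d * euclid_norm y"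
proof -
  have c: "A *\<^sub>v y \<in> carrier_vec p" using assms by (auto intro!: mult_mat_vec_carrier)
  have "(euclid_norm (A *\<^sub>v y))\<^sup>2 \<le> d * euclid_norm (A *\<^sub>v y) * euclid_norm y"
    using form_bound_bilinear[OF assms(1,2) c assms(3)] by (simp add: euclid_norm_square)
  then have *: "euclid_norm (A *\<^sub>v y) * euclid_norm (A *\<^sub>v y) \<le> euclid_norm (A *\<^sub>v y) * (d * euclid_norm y)"
    by (simp add: power2_eq_square mult_ac)
  show ?thesis
  proof (cases "A *\<^sub>v y = 0\<^sub>v p")
    case True
    have "0 \<le> d * (y \<bullet> y)"
      using assms(2,3) abs_ge_zero order_trans unfolding form_bound_def by blast
    then have "0 \<le> d * euclid_norm y"
      by (simp add: zero_le_mult_iff euclid_norm_def scalar_prod_self_nonneg)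
    with True show ?thesis by (simp add: euclid_norm_def)
  next
    case False
    with * euclid_norm_pos[OF c] show ?thesis by simp
  qed
qed

lemma form_bound_exists:
  assumes A: "A \<in> carrier_mat p p"
  shows "\<exists>d>0. form_bound p A d"
proof -
  define d where "d = (\<Sum>i<p. \<Sum>j<p. \<bar>A $$ (i, j)\<bar>)"
  have "\<bar>x \<bullet> (A *\<^sub>v x)\<bar> \<le> d * (x \<bullet> x)" if x: "x \<in> carrier_vec p" for x
  proof -
    have le: "\<bar>x $ i * x $ j\<bar> \<le> x \<bullet> x" if "i < p" "j < p" for i j
    proof -
      have "(x $ i)\<^sup>2 \<le> x \<bullet> x" "(x $ j)\<^sup>2 \<le> x \<bullet> x"
        using that x by (auto simp: scalar_prod_self_sum intro!: member_le_sum[where f = "\<lambda>i. (x $ i)\<^sup>2"])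
      moreover have "2 * \<bar>x $ i * x $ j\<bar> \<le> (x $ i)\<^sup>2 + (x $ j)\<^sup>2"
        using sum_squares_bound[of "\<bar>x $ i\<bar>" "\<bar>x $ j\<bar>"] by (simp add: abs_mult)
      ultimately show ?thesis by linarith
    qed
    have "\<bar>x \<bullet> (A *\<^sub>v x)\<bar> \<le> (\<Sum>i<p. \<Sum>j<p. \<bar>x $ i * A $$ (i, j) * x $ j\<bar>)"
      unfolding form_entries[OF A x x] by (intro order_trans[OF sum_abs] sum_mono sum_abs)
    also have "\<dots> \<le> (\<Sum>i<p. \<Sum>j<p. \<bar>A $$ (i, j)\<bar> * (x \<bullet> x))"
    proof (intro sum_mono)
      fix i j assume "i \<in> {..<p}" "j \<in> {..<p}"
      then have "\<bar>A $$ (i, j)\<bar> * \<bar>x $ i * x $ j\<bar> \<le> \<bar>A $$ (i, j)\<bar> * (x \<bullet> x)"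
        by (intro mult_left_mono le) auto
      then show "\<bar>x $ i * A $$ (i, j) * x $ j\<bar> \<le> \<bar>A $$ (i, j)\<bar> * (x \<bullet> x)"
        by (simp add: abs_mult mult_ac)
    qed
    also have "\<dots> = d * (x \<bullet> x)" by (simp add: d_def sum_distrib_right)
    finally show ?thesis .
  qed
  \<comment> \<open>Adding one makes the constant strictly positive, also for the zero matrix and in
    dimension zero.\<close>
  then have "\<bar>x \<bullet> (A *\<^sub>v x)\<bar> \<le> (d + 1) * (x \<bullet> x)" if "x \<in> carrier_vec p" for x
    by (rule order_trans[OF _ mult_right_mono]) (use that scalar_prod_self_nonneg[of x] in auto)
  moreover have "0 \<le> d" by (simp add: d_def sum_nonneg)
  ultimately show ?thesis unfolding form_bound_def by (intro exI[of _ "d + 1"]) auto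
qed

section \<open>Inverses of positive definite matrices\<close>

lemma vec_eq_zeroI: "x \<in> carrier_vec p \<Longrightarrow> (x :: rvec) \<bullet> x = 0 \<Longrightarrow> x = 0\<^sub>v p"
  using scalar_prod_self_pos[of x p] by (cases "x = 0\<^sub>v p") auto

lemma mat_eq_vecI:
  fixes A B :: rmat
  assumes A: "A \<in> carrier_mat p p" and B: "B \<in> carrier_mat p p"
    and eq: "\<And>x. x \<in> carrier_vec p \<Longrightarrow> A *\<^sub>v x = B *\<^sub>v x"
  shows "A = B"
proof (rule eq_matI)
  fix i j assume ij: "i < dim_row B" "j < dim_col B"
  have "(A *\<^sub>v unit_vec p j) $ i = (B *\<^sub>v unit_vec p j) $ i"
    by (simp add: eq)
  then show "A $$ (i, j) = B $$ (i, j)"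
    using A B ij by simp
qed (use A B in auto)

text \<open>\<open>mat_inv\<close> is the outcome of an elimination procedure wrapped in an option.
  Having an inverse makes \<open>A\<close> a unit, so the elimination succeeds, and uniqueness of
  inverses identifies its result with \<open>B\<close>.\<close>

lemma mat_inv_eqI:
  assumes A: "A \<in> carrier_mat p p" and B: "B \<in> carrier_mat p p" and AB: "A * B = 1\<^sub>m p"
  shows "mat_inv A = B"
proof -
  have BA: "B * A = 1\<^sub>m p"
    using mat_mult_left_right_inverse[OF A B AB] .
  have "A \<in> Units (ring_mat TYPE(real) p ())"
    using A B AB BA unfolding Units_def ring_mat_def by auto
  then obtain C where C: "mat_inverse A = Some C"
    using mat_inverse(1)[OF A, where b = "()"] by (cases "mat_inverse A") auto
  with mat_inverse(2)[OF A C] have "A * C = 1\<^sub>m p" "C \<in> carrier_mat p p" by auto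
  then have "C = B" using assoc_mult_mat[OF B A, of C p] A B BA by simp
  with C show ?thesis by (simp add: mat_inv_def)
qed

lemma pos_def_inverse:
  assumes pd: "pos_def p A"
  shows "mat_inv A \<in> carrier_mat p p" "A * mat_inv A = 1\<^sub>m p" "mat_inv A * A = 1\<^sub>m p"
proof -
  have A: "A \<in> carrier_mat p p" using pd by (simp add: pos_def_def)
  have "det A \<noteq> 0"
  proof
    assume "det A = 0"
    then obtain v where v: "v \<in> carrier_vec p" "v \<noteq> 0\<^sub>v p" "A *\<^sub>v v = 0\<^sub>v p"
      using det_0_iff_vec_prod_zero_field[OF A] by blast
    with pos_def_gt[OF pd v(1,2)] show False by simp
  qed
  from det_non_zero_imp_unit[OF A this, where b = "()"] obtain C where C: "mat_inverse A = Some C"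
    using mat_inverse(1)[OF A, where b = "()"] by (cases "mat_inverse A") auto
  with mat_inverse(2)[OF A C]
  show "mat_inv A \<in> carrier_mat p p" "A * mat_inv A = 1\<^sub>m p" "mat_inv A * A = 1\<^sub>m p"
    by (auto simp: mat_inv_def)
qed

lemma pos_def_inverse_vec:
  assumes "pos_def p A" "x \<in> carrier_vec p"
  shows "mat_inv A *\<^sub>v x \<in> carrier_vec p" "A *\<^sub>v (mat_inv A *\<^sub>v x) = x" "mat_inv A *\<^sub>v (A *\<^sub>v x) = x"
proof -
  note i = pos_def_inverse[OF assms(1)]
  have A: "A \<in> carrier_mat p p" using assms by (simp add: pos_def_def)
  show "mat_inv A *\<^sub>v x \<in> carrier_vec p" using i assms by simp
  show "A *\<^sub>v (mat_inv A *\<^sub>v x) = x" "mat_inv A *\<^sub>v (A *\<^sub>v x) = x"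
    using assoc_mult_mat_vec[OF A i(1) assms(2)] assoc_mult_mat_vec[OF i(1) A assms(2)] i assms by simp_all
qed

lemma pos_def_mat_inv:
  assumes pd: "pos_def p A"
  shows "pos_def p (mat_inv A)"
proof -
  note i = pos_def_inverse[OF pd] and iv = pos_def_inverse_vec[OF pd]
  have A: "A \<in> carrier_mat p p" "transpose_mat A = A" using pd by (auto simp: pos_def_def)
  have "A * transpose_mat (mat_inv A) = 1\<^sub>m p"
    using arg_cong[OF i(3), of transpose_mat] A transpose_mult[OF i(1) A(1)] by simp
  then have "transpose_mat (mat_inv A) = mat_inv A"
    using mat_inv_eqI[of A p "transpose_mat (mat_inv A)"] i A by simp
  moreover have "0 < v \<bullet> (mat_inv A *\<^sub>v v)" if v: "v \<in> carrier_vec p" "v \<noteq> 0\<^sub>v p" for v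
  proof -
    let ?y = "mat_inv A *\<^sub>v v"
    have "?y \<noteq> 0\<^sub>v p" using iv(2)[OF v(1)] v A mat_mult_zero_vec[of A p p] by auto
    then have "0 < ?y \<bullet> (A *\<^sub>v ?y)" using pos_def_gt[OF pd iv(1)[OF v(1)]] by simp
    then show ?thesis using iv(2)[OF v(1)] comm_scalar_prod[OF v(1) iv(1)[OF v(1)]] by simp
  qed
  ultimately show ?thesis using i by (simp add: pos_def_def)
qed

text \<open>The constant is the reciprocal of an operator bound for the inverse: Cauchy-Schwarz in
  the form of \<open>A\<close>, applied to \<open>x\<close> and its preimage under \<open>A\<close>,
  compares the fourth power of the length of \<open>x\<close> with the product of its forms under
  \<open>A\<close> and \<open>mat_inv A\<close>. This takes the place of minimizing over the unit
  sphere.\<close>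

lemma pos_def_lower_bound:
  assumes pd: "pos_def p A"
  shows "\<exists>c>0. \<forall>x \<in> carrier_vec p. c * (x \<bullet> x) \<le> x \<bullet> (A *\<^sub>v x)"
proof -
  note iv = pos_def_inverse_vec[OF pd]
  obtain d where d: "d > 0" "form_bound p (mat_inv A) d"
    using form_bound_exists[OF pos_def_inverse(1)[OF pd]] by blast
  have "1 / d * (x \<bullet> x) \<le> x \<bullet> (A *\<^sub>v x)" if x: "x \<in> carrier_vec p" for x
  proof -
    let ?y = "mat_inv A *\<^sub>v x"
    have A: "A \<in> carrier_mat p p" using pd by (simp add: pos_def_def)
    have "(x \<bullet> x)\<^sup>2 = (x \<bullet> (A *\<^sub>v ?y))\<^sup>2" using iv[OF x] by simp
    also have "\<dots> \<le> (x \<bullet> (A *\<^sub>v x)) * (?y \<bullet> (A *\<^sub>v ?y))"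
      by (rule psd_Cauchy_Schwarz[OF pos_def_psd[OF pd] x iv(1)[OF x]])
    also have "?y \<bullet> (A *\<^sub>v ?y) = x \<bullet> ?y" using iv[OF x] comm_scalar_prod[OF x iv(1)[OF x]] by simp
    also have "(x \<bullet> (A *\<^sub>v x)) * (x \<bullet> ?y) \<le> (x \<bullet> (A *\<^sub>v x)) * (d * (x \<bullet> x))"
      using d(2) x pos_def_psd[OF pd] by (intro mult_left_mono) (auto simp: form_bound_def psd_def abs_le_iff)
    finally have "(x \<bullet> x) * (x \<bullet> x) \<le> (d * (x \<bullet> (A *\<^sub>v x))) * (x \<bullet> x)"
      by (simp add: power2_eq_square mult_ac)
    moreover have "0 \<le> x \<bullet> (A *\<^sub>v x)" using pos_def_psd[OF pd] x by (simp add: psd_def)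
    ultimately have "x \<bullet> x \<le> d * (x \<bullet> (A *\<^sub>v x))"
      using scalar_prod_self_nonneg[of x] d(1)
      by (cases "x \<bullet> x = 0") (auto intro: mult_right_le_imp_le)
    then show ?thesis using d(1) by (simp add: field_simps)
  qed
  then show ?thesis using d(1) by (intro exI[of _ "1 / d"]) auto
qed

section \<open>Square roots and contractions of symmetric matrices\<close>

declare minus_carrier_mat [simp]

lemma mat_vec_closed [simp]:
  "A \<in> carrier_mat p p \<Longrightarrow> x \<in> carrier_vec p \<Longrightarrow> (A :: rmat) *\<^sub>v x \<in> carrier_vec p"
  by (rule mult_mat_vec_carrier)

lemma form_zero: "x \<in> carrier_vec p \<Longrightarrow> y \<in> carrier_vec p \<Longrightarrow> x \<bullet> (0\<^sub>m p p *\<^sub>v y) = (0 :: real)"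
  by (subst form_entries[where p = p]) auto

lemma form_minus:
  fixes A B :: rmat
  assumes "A \<in> carrier_mat p p" "B \<in> carrier_mat p p" "x \<in> carrier_vec p" "y \<in> carrier_vec p"
  shows "x \<bullet> ((A - B) *\<^sub>v y) = x \<bullet> (A *\<^sub>v y) - x \<bullet> (B *\<^sub>v y)"
  using assms by (simp add: mat_minus_mult_vec[where n = p and m = p] scalar_prod_minus_distrib[where n = p])

lemma form_plus:
  fixes A B :: rmat
  assumes "A \<in> carrier_mat p p" "B \<in> carrier_mat p p" "x \<in> carrier_vec p" "y \<in> carrier_vec p"
  shows "x \<bullet> ((A + B) *\<^sub>v y) = x \<bullet> (A *\<^sub>v y) + x \<bullet> (B *\<^sub>v y)"
  using assms by (simp add: mat_plus_mult_vec[where n = p and m = p] scalar_prod_add_distrib[where n = p])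

lemma form_smult:
  fixes A :: rmat
  assumes "A \<in> carrier_mat p p" "x \<in> carrier_vec p" "y \<in> carrier_vec p"
  shows "x \<bullet> ((c \<cdot>\<^sub>m A) *\<^sub>v y) = c * (x \<bullet> (A *\<^sub>v y))"
  using assms by (simp add: smult_mat_mult_vec[where n = p and m = p])

lemma unit_vec_form:
  fixes A :: rmat
  assumes "A \<in> carrier_mat p p" "i < p" "j < p"
  shows "unit_vec p i \<bullet> (A *\<^sub>v unit_vec p j) = (A :: rmat) $$ (i, j)"
  using assms by simp

lemma euclid_norm_unit_vec: "i < p \<Longrightarrow> euclid_norm (unit_vec p i) = 1"
  by (simp add: euclid_norm_def)

lemma form_bound_entry:
  assumes "symmetric p A" "form_bound p A d" "i < p" "j < p"
  shows "\<bar>A $$ (i, j)\<bar> \<le> d"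
  using form_bound_bilinear[OF assms(1,2), of "unit_vec p i" "unit_vec p j"] assms
  by (simp add: unit_vec_form[OF symmetric_carrier] euclid_norm_unit_vec)

lemma form_bound_triangle:
  assumes "A \<in> carrier_mat p p" "B \<in> carrier_mat p p" "C \<in> carrier_mat p p"
    and "form_bound p (A - B) a" "form_bound p (B - C) b"
  shows "form_bound p (A - C) (a + b)"
  unfolding form_bound_def
proof
  fix x :: rvec assume x: "x \<in> carrier_vec p"
  have "\<bar>x \<bullet> ((A - B) *\<^sub>v x)\<bar> \<le> a * (x \<bullet> x)" "\<bar>x \<bullet> ((B - C) *\<^sub>v x)\<bar> \<le> b * (x \<bullet> x)"
    using assms(4,5) x by (auto simp: form_bound_def)
  then show "\<bar>x \<bullet> ((A - C) *\<^sub>v x)\<bar> \<le> (a + b) * (x \<bullet> x)"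
    using assms(1-3) x by (simp add: form_minus[where p = p] distrib_right)
qed

lemma form_bound_mono: "form_bound p A a \<Longrightarrow> a \<le> b \<Longrightarrow> form_bound p A b"
  unfolding form_bound_def
  by (auto intro: order_trans[OF _ mult_right_mono] scalar_prod_self_nonneg)

lemma form_bound_commute:
  assumes "A \<in> carrier_mat p p" "B \<in> carrier_mat p p" "form_bound p (A - B) a"
  shows "form_bound p (B - A) a"
proof -
  have "x \<bullet> ((B - A) *\<^sub>v x) = - (x \<bullet> ((A - B) *\<^sub>v x))" if "x \<in> carrier_vec p" for x
    using that assms(1,2) by (simp add: form_minus[where p = p])
  with assms(3) show ?thesis by (simp add: form_bound_def)
qed

section \<open>Entrywise limits and fixed points of contractions\<close>

lemma form_tendsto:
  fixes X :: "nat \<Rightarrow> rmat"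
  assumes "\<And>k. X k \<in> carrier_mat p p" "A \<in> carrier_mat p p"
    and "\<And>i j. i < p \<Longrightarrow> j < p \<Longrightarrow> (\<lambda>k :: nat. X k $$ (i, j)) \<longlonglongrightarrow> A $$ (i, j)"
    and "x \<in> carrier_vec p" "y \<in> carrier_vec p"
  shows "(\<lambda>k. x \<bullet> (X k *\<^sub>v y)) \<longlonglongrightarrow> x \<bullet> (A *\<^sub>v y)"
  unfolding form_entries[OF assms(2,4,5)] form_entries[OF assms(1,4,5)]
  by (auto intro!: tendsto_sum tendsto_mult tendsto_const assms(3))

lemma symmetric_limit:
  fixes X :: "nat \<Rightarrow> rmat"
  assumes "\<And>k. symmetric p (X k)" "A \<in> carrier_mat p p"
    and "\<And>i j. i < p \<Longrightarrow> j < p \<Longrightarrow> (\<lambda>k :: nat. X k $$ (i, j)) \<longlonglongrightarrow> A $$ (i, j)"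
  shows "symmetric p A"
proof (rule symmetricI[OF assms(2)])
  fix i j assume ij: "i < p" "j < p"
  have "(\<lambda>k. X k $$ (i, j)) = (\<lambda>k. X k $$ (j, i))"
    using symmetric_index[OF assms(1)] ij by auto
  then show "A $$ (i, j) = A $$ (j, i)"
    using assms(3)[OF ij] assms(3)[OF ij(2,1)] LIMSEQ_unique by auto
qed

lemma form_bound_limit:
  fixes X :: "nat \<Rightarrow> rmat"
  assumes "\<And>k. X k \<in> carrier_mat p p" "A \<in> carrier_mat p p" "B \<in> carrier_mat p p"
    and "\<And>i j. i < p \<Longrightarrow> j < p \<Longrightarrow> (\<lambda>k :: nat. X k $$ (i, j)) \<longlonglongrightarrow> A $$ (i, j)"
    and "\<And>k. k \<ge> N \<Longrightarrow> form_bound p (B - X k) d"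
  shows "form_bound p (B - A) d"
  unfolding form_bound_def
proof
  fix x :: rvec assume x: "x \<in> carrier_vec p"
  have "(\<lambda>k. \<bar>x \<bullet> (B *\<^sub>v x) - x \<bullet> (X k *\<^sub>v x)\<bar>) \<longlonglongrightarrow> \<bar>x \<bullet> (B *\<^sub>v x) - x \<bullet> (A *\<^sub>v x)\<bar>"
    by (intro tendsto_intros form_tendsto[where p = p]) (use assms x in auto)
  moreover have "\<bar>x \<bullet> (B *\<^sub>v x) - x \<bullet> (X k *\<^sub>v x)\<bar> \<le> d * (x \<bullet> x)" if "k \<ge> N" for k
    using assms(5)[OF that] assms(1,3) x by (auto simp: form_bound_def form_minus[where p = p])
  ultimately have "\<bar>x \<bullet> (B *\<^sub>v x) - x \<bullet> (A *\<^sub>v x)\<bar> \<le> d * (x \<bullet> x)"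
    by (intro LIMSEQ_le_const2) auto
  then show "\<bar>x \<bullet> ((B - A) *\<^sub>v x)\<bar> \<le> d * (x \<bullet> x)"
    using assms x by (simp add: form_minus[where p = p])
qed

text \<open>Banach iteration with an implicit metric: distances are expressed by
  \<open>form_bound\<close>, limits are taken entrywise, and completeness enters only as closedness
  of the set under entrywise limits. It serves twice, for square roots and for Tyler's
  equation.\<close>

lemma matrix_contraction_fixpoint:
  fixes f :: "rmat \<Rightarrow> rmat" and \<S> :: "rmat set"
  assumes sym: "\<And>A. A \<in> \<S> \<Longrightarrow> symmetric p A"
    and closed: "\<And>X A. (\<And>k. X k \<in> \<S>) \<Longrightarrow> A \<in> carrier_mat p p \<Longrightarrow>
      (\<And>i j. i < p \<Longrightarrow> j < p \<Longrightarrow> (\<lambda>k :: nat. X k $$ (i, j)) \<longlonglongrightarrow> A $$ (i, j)) \<Longrightarrow> A \<in> \<S>"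
    and maps: "\<And>A. A \<in> \<S> \<Longrightarrow> f A \<in> \<S>"
    and A0: "A0 \<in> \<S>" and \<rho>: "0 < \<rho>" "\<rho> < 1"
    and contr: "\<And>A B \<eta>. A \<in> \<S> \<Longrightarrow> B \<in> \<S> \<Longrightarrow> 0 < \<eta> \<Longrightarrow> form_bound p (A - B) \<eta> \<Longrightarrow>
      form_bound p (f A - f B) (\<rho> * \<eta>)"
  shows "\<exists>A \<in> \<S>. f A = A"
proof -
  define X where "X k = (f ^^ k) A0" for k
  have XS: "X k \<in> \<S>" for k by (induction k) (auto simp: X_def A0 maps)
  note Xsym = sym[OF XS] and Xc = symmetric_carrier[OF sym[OF XS]]
  have XSuc: "X (Suc k) = f (X k)" for k by (simp add: X_def)
  obtain \<eta> where \<eta>: "\<eta> > 0" "form_bound p (X 0 - X 1) \<eta>"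
    using form_bound_exists[of "X 0 - X 1" p] Xc by (metis minus_carrier_mat)
  have step: "form_bound p (X k - X (Suc k)) (\<rho> ^ k * \<eta>)" for k
  proof (induction k)
    case (Suc k)
    then show ?case using contr[OF XS XS _ Suc] \<rho> \<eta> by (simp add: XSuc mult_ac)
  qed (use \<eta> in simp)
  \<comment> \<open>The exact partial sum of the geometric series, so that the induction on
    \<open>m\<close> closes.\<close>
  have far: "form_bound p (X k - X (k + m)) (\<rho> ^ k * \<eta> / (1 - \<rho>) * (1 - \<rho> ^ m))" for k m
  proof (induction m)
    case 0
    show ?case using Xc[of k] by (simp add: form_bound_def form_zero)
  next
    case (Suc m)
    have "form_bound p (X k - X (Suc (k + m)))
        (\<rho> ^ k * \<eta> / (1 - \<rho>) * (1 - \<rho> ^ m) + \<rho> ^ (k + m) * \<eta>)"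
      by (rule form_bound_triangle[OF Xc Xc Xc Suc step])
    also have "\<rho> ^ k * \<eta> / (1 - \<rho>) * (1 - \<rho> ^ m) + \<rho> ^ (k + m) * \<eta> =
        \<rho> ^ k * \<eta> / (1 - \<rho>) * (1 - \<rho> ^ Suc m)"
      using \<rho> by (simp add: field_simps power_add)
    finally show ?case by simp
  qed
  have conv: "convergent (\<lambda>k. X k $$ (i, j))" if ij: "i < p" "j < p" for i j
  proof -
    have le: "\<bar>X (Suc k) $$ (i, j) - X k $$ (i, j)\<bar> \<le> \<rho> ^ k * \<eta>" for k
    proof -
      have "\<bar>(X k - X (Suc k)) $$ (i, j)\<bar> \<le> \<rho> ^ k * \<eta>"
        by (rule form_bound_entry[OF symmetric_minus[OF Xsym Xsym] step ij])
      moreover have "(X k - X (Suc k)) $$ (i, j) = - (X (Suc k) $$ (i, j) - X k $$ (i, j))"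
        using ij Xc[of k] Xc[of "Suc k"] by auto
      ultimately show ?thesis by (metis abs_minus_cancel)
    qed
    have "summable (\<lambda>k. \<rho> ^ k * \<eta>)"
      using \<rho> by (intro summable_mult2 summable_geometric) simp
    then have "summable (\<lambda>k. X (Suc k) $$ (i, j) - X k $$ (i, j))"
      by (rule summable_comparison_test'[where N = 0]) (simp only: real_norm_def le)
    then have "convergent (\<lambda>n. \<Sum>k<n. X (Suc k) $$ (i, j) - X k $$ (i, j))"
      by (simp add: summable_iff_convergent)
    then have "convergent (\<lambda>n. X n $$ (i, j) - X 0 $$ (i, j))"
      using sum_lessThan_telescope[of "\<lambda>k. X k $$ (i, j)"] by simp
    then show ?thesis by (simp add: convergent_diff_const_right_iff)
  qed
  define A where "A = Matrix.mat p p (\<lambda>(i, j). lim (\<lambda>k. X k $$ (i, j)))"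
  have Ac: "A \<in> carrier_mat p p" by (simp add: A_def)
  have lim: "(\<lambda>k. X k $$ (i, j)) \<longlonglongrightarrow> A $$ (i, j)" if "i < p" "j < p" for i j
    using conv[OF that] that by (simp add: A_def convergent_LIMSEQ_iff)
  have AS: "A \<in> \<S>" by (rule closed[OF XS Ac lim])
  define e where "e k = \<rho> ^ k * \<eta> / (1 - \<rho>)" for k
  have e: "e k > 0" for k using \<rho> \<eta> by (simp add: e_def)
  have near: "form_bound p (X k - A) (e k)" for k
  proof (rule form_bound_limit[OF Xc Ac Xc lim])
    fix m assume "k \<le> m"
    then obtain l where "m = k + l" by (metis le_iff_add)
    then show "form_bound p (X k - X m) (e k)"
      using far[of k l] \<rho> \<eta> by (auto simp: e_def field_simps intro!: form_bound_mono[OF far])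
  qed auto
  \<comment> \<open>The detour through \<open>X (Suc k)\<close> bounds the residual of the limit by
    a null sequence; the contraction property plays the part of continuity of
    \<open>f\<close>.\<close>
  have bound: "form_bound p (f A - A) (2 * e k)" for k
  proof -
    have fA: "f A \<in> carrier_mat p p" using sym[OF maps[OF AS]] by auto
    have "form_bound p (X (Suc k) - f A) (\<rho> * e k)"
      using contr[OF XS AS e near] by (simp add: XSuc)
    then have "form_bound p (f A - X (Suc k)) (\<rho> * e k)"
      using form_bound_commute[OF Xc fA] by simp
    from form_bound_triangle[OF fA Xc Ac this near]
    have "form_bound p (f A - A) (\<rho> * e k + e (Suc k))" .
    moreover have "e (Suc k) = \<rho> * e k" by (simp add: e_def)
    moreover have "\<rho> * e k \<le> 1 * e k" using \<rho> e[of k] by (intro mult_right_mono) auto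
    ultimately show ?thesis by (auto intro: form_bound_mono)
  qed
  have e0: "(\<lambda>k. 2 * e k) \<longlonglongrightarrow> 2 * (0 * \<eta> / (1 - \<rho>))"
    unfolding e_def using \<rho> by (intro tendsto_intros LIMSEQ_realpow_zero) auto
  have "f A = A"
  proof (rule eq_matI)
    fix i j assume "i < dim_row A" "j < dim_col A"
    then have ij: "i < p" "j < p" using Ac by auto
    have "\<bar>(f A - A) $$ (i, j)\<bar> \<le> 2 * e k" for k
      by (rule form_bound_entry[OF symmetric_minus[OF sym[OF maps[OF AS]] sym[OF AS]] bound ij])
    then have "\<bar>(f A - A) $$ (i, j)\<bar> \<le> 0"
      using LIMSEQ_le_const[OF e0, of "\<bar>(f A - A) $$ (i, j)\<bar>"] by auto
    then show "f A $$ (i, j) = A $$ (i, j)" using ij Ac by auto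
  qed (use sym[OF maps[OF AS]] Ac in auto)
  with AS show ?thesis by blast
qed

section \<open>Squares of symmetric matrices and existence of square roots\<close>

lemma symmetric_square:
  assumes "symmetric p A"
  shows "symmetric p (A * A)"
  using assms transpose_mult[of A p p A p] by (auto simp: symmetric_def)

lemma form_square:
  assumes A: "symmetric p A" and x: "x \<in> carrier_vec p"
  shows "x \<bullet> ((A * A) *\<^sub>v x) = (A *\<^sub>v x) \<bullet> (A *\<^sub>v x)"
proof -
  have c: "A \<in> carrier_mat p p" "A *\<^sub>v x \<in> carrier_vec p"
    using A x by auto
  have "(A * A) *\<^sub>v x = A *\<^sub>v (A *\<^sub>v x)"
    by (rule assoc_mult_mat_vec[OF c(1) c(1) x])
  then show ?thesis using form_symmetric[OF A x c(2)] by simp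
qed

lemma form_bound_square:
  assumes A: "symmetric p A" and d: "form_bound p A d"
  shows "form_bound p (A * A) (d\<^sup>2)"
  unfolding form_bound_def
proof
  fix x :: rvec assume x: "x \<in> carrier_vec p"
  have "(A *\<^sub>v x) \<bullet> (A *\<^sub>v x) \<le> (d * euclid_norm x)\<^sup>2"
    unfolding euclid_norm_square[symmetric] by (intro power_mono form_bound_norm[OF A d x]) simp
  then show "\<bar>x \<bullet> ((A * A) *\<^sub>v x)\<bar> \<le> d\<^sup>2 * (x \<bullet> x)"
    by (simp add: form_square[OF A x] scalar_prod_self_nonneg power_mult_distrib euclid_norm_square)
qed

text \<open>The form of the square of a symmetric matrix at \<open>x\<close> is the squared length
  of the image of \<open>x\<close>. A difference of squared lengths factors as an inner product,
  although \<open>Y\<close> and \<open>Z\<close> need not commute.\<close>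

lemma form_bound_square_diff:
  assumes Y: "symmetric p Y" "form_bound p Y d" and Z: "symmetric p Z" "form_bound p Z d"
    and \<eta>: "form_bound p (Y - Z) \<eta>"
  shows "form_bound p (Y * Y - Z * Z) (2 * d * \<eta>)"
  unfolding form_bound_def
proof
  fix x :: rvec assume x: "x \<in> carrier_vec p"
  let ?n = "euclid_norm x"
  note Yc = symmetric_carrier[OF Y(1)] and Zc = symmetric_carrier[OF Z(1)]
  have c: "Y *\<^sub>v x \<in> carrier_vec p" "Z *\<^sub>v x \<in> carrier_vec p"
    using Yc Zc x by auto
  have "x \<bullet> ((Y * Y - Z * Z) *\<^sub>v x) = (Y *\<^sub>v x) \<bullet> (Y *\<^sub>v x) - (Z *\<^sub>v x) \<bullet> (Z *\<^sub>v x)"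
    using Yc Zc x form_square[OF Y(1) x] form_square[OF Z(1) x] by (simp add: form_minus[where p = p])
  also have "\<dots> = (Y *\<^sub>v x - Z *\<^sub>v x) \<bullet> (Y *\<^sub>v x + Z *\<^sub>v x)"
    using c comm_scalar_prod[OF c]
    by (simp add: minus_scalar_prod_distrib[where n = p] scalar_prod_add_distrib[where n = p])
  also have "\<bar>\<dots>\<bar> \<le> euclid_norm (Y *\<^sub>v x - Z *\<^sub>v x) * euclid_norm (Y *\<^sub>v x + Z *\<^sub>v x)"
    by (rule abs_scalar_prod_le[where p = p]) (use c in auto)
  also have "\<dots> \<le> (\<eta> * ?n) * (d * ?n + d * ?n)"
  proof (rule mult_mono)
    show a: "euclid_norm (Y *\<^sub>v x - Z *\<^sub>v x) \<le> \<eta> * ?n"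
      using form_bound_norm[OF symmetric_minus[OF Y(1) Z(1)] \<eta> x] mat_minus_mult_vec[OF Yc Zc x] by simp
    show "0 \<le> \<eta> * ?n" using a euclid_norm_nonneg order_trans by blast
    show "euclid_norm (Y *\<^sub>v x + Z *\<^sub>v x) \<le> d * ?n + d * ?n"
      using euclid_norm_add[OF c] form_bound_norm[OF Y x] form_bound_norm[OF Z x] by linarith
  qed simp
  also have "\<dots> = 2 * d * \<eta> * (x \<bullet> x)"
    by (simp add: euclid_norm_square[symmetric] power2_eq_square algebra_simps)
  finally show "\<bar>x \<bullet> ((Y * Y - Z * Z) *\<^sub>v x)\<bar> \<le> 2 * d * \<eta> * (x \<bullet> x)" .
qed

text \<open>The square root of \<open>A \<le> 1\<close> is \<open>1 - Y\<close>, where \<open>Y\<close> is the fixed point of \<open>Y \<mapsto> (1 - A + Y\<^sup>2) / 2\<close>.\<close>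

lemma pos_def_sqrt_exists:
  assumes pd: "pos_def p A"
  shows "\<exists>R. pos_def p R \<and> R * R = A"
proof -
  note As = pos_def_symmetric[OF pd]
  note Ac = symmetric_carrier[OF As]
  obtain m where m: "m > 0" "form_bound p A m" using form_bound_exists[OF Ac] by blast
  obtain c0 where c0: "c0 > 0" "\<And>x. x \<in> carrier_vec p \<Longrightarrow> c0 * (x \<bullet> x) \<le> x \<bullet> (A *\<^sub>v x)"
    using pos_def_lower_bound[OF pd] by blast
  \<comment> \<open>The spectrum of \<open>A\<close> divided by \<open>m\<close> lies in the
    interval from \<open>c\<close> to 1. The minimum gives \<open>c \<le> 1\<close> without
    appealing to a nonzero vector, so dimension zero is covered.\<close>
  define c where "c = min c0 m / m"
  have c: "0 < c" "c \<le> 1" using m c0 by (auto simp: c_def)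
  define B where "B = 1\<^sub>m p - (1 / m) \<cdot>\<^sub>m A"
  have Bs: "symmetric p B" unfolding B_def by (intro symmetric_minus symmetric_one symmetric_smult As)
  note Bc = symmetric_carrier[OF Bs]
  have B: "form_bound p B (1 - c)"
    unfolding form_bound_def
  proof
    fix x :: rvec assume x: "x \<in> carrier_vec p"
    have eq: "x \<bullet> (B *\<^sub>v x) = x \<bullet> x - (x \<bullet> (A *\<^sub>v x)) / m"
      using Ac x by (simp add: B_def form_minus[where p = p] form_smult[where p = p])
    have "(x \<bullet> (A *\<^sub>v x)) / m \<le> x \<bullet> x"
      using m x by (auto simp: form_bound_def field_simps abs_le_iff)
    moreover have "min c0 m * (x \<bullet> x) \<le> c0 * (x \<bullet> x)"
      by (intro mult_right_mono scalar_prod_self_nonneg) simp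
    then have "c * (x \<bullet> x) \<le> (x \<bullet> (A *\<^sub>v x)) / m"
      using c0(2)[OF x] m by (simp add: c_def field_simps)
    ultimately show "\<bar>x \<bullet> (B *\<^sub>v x)\<bar> \<le> (1 - c) * (x \<bullet> x)"
      unfolding eq by (simp add: algebra_simps)
  qed
  \<comment> \<open>The smaller fixed point of the scalar iteration that sends \<open>y\<close> to
    \<open>(1 - c + y\<^sup>2) / 2\<close>, so the ball of this radius is mapped into
    itself.\<close>
  define y where "y = 1 - sqrt c"
  have y: "0 \<le> y" "y < 1" using c by (auto simp: y_def)
  have "y\<^sup>2 = 1 - 2 * sqrt c + c" using c by (simp add: y_def power2_diff)
  then have yy: "(1 - c + y\<^sup>2) / 2 = y" by (simp add: y_def field_simps)
  \<comment> \<open>The bound is put on the difference from the zero matrix because passage to the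
    limit is stated for differences.\<close>
  define \<S> where "\<S> = {Y. symmetric p Y \<and> form_bound p (0\<^sub>m p p - Y) y}"
  have neg: "form_bound p (0\<^sub>m p p - Y) d \<longleftrightarrow> form_bound p Y d" if "Y \<in> carrier_mat p p" for Y d
    using that by (simp add: form_bound_def form_minus[where p = p] form_zero)
  define f where "f Y = (1 / 2) \<cdot>\<^sub>m (B + Y * Y)" for Y
  have "\<exists>Y \<in> \<S>. f Y = Y"
  proof (rule matrix_contraction_fixpoint)
    show "symmetric p Y" if "Y \<in> \<S>" for Y using that by (simp add: \<S>_def)
    show "Y \<in> \<S>" if X: "\<And>k. X k \<in> \<S>" and Y: "Y \<in> carrier_mat p p"
      and lim: "\<And>i j. i < p \<Longrightarrow> j < p \<Longrightarrow> (\<lambda>k :: nat. X k $$ (i, j)) \<longlonglongrightarrow> Y $$ (i, j)" for X Y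
    proof -
      have s: "symmetric p (X k)" "form_bound p (0\<^sub>m p p - X k) y" for k using X by (auto simp: \<S>_def)
      then show ?thesis
        using symmetric_limit[OF s(1) Y lim]
          form_bound_limit[OF symmetric_carrier[OF s(1)] Y _ lim, where B = "0\<^sub>m p p" and d = y and N = 0]
        by (simp add: \<S>_def)
    qed
    show "f Y \<in> \<S>" if "Y \<in> \<S>" for Y
    proof -
      have Y: "symmetric p Y" "form_bound p Y y" using that neg by (auto simp: \<S>_def)
      note sq = symmetric_square[OF Y(1)]
      have s: "symmetric p (f Y)" unfolding f_def by (intro symmetric_smult symmetric_plus Bs sq)
      have "form_bound p (f Y) y"
        unfolding form_bound_def
      proof
        fix x :: rvec assume x: "x \<in> carrier_vec p"
        have "x \<bullet> (f Y *\<^sub>v x) = (x \<bullet> (B *\<^sub>v x) + x \<bullet> ((Y * Y) *\<^sub>v x)) / 2"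
          using x Bc symmetric_carrier[OF sq]
          by (simp add: f_def form_smult[where p = p] form_plus[where p = p])
        moreover have "\<bar>x \<bullet> (B *\<^sub>v x)\<bar> \<le> (1 - c) * (x \<bullet> x)" "\<bar>x \<bullet> ((Y * Y) *\<^sub>v x)\<bar> \<le> y\<^sup>2 * (x \<bullet> x)"
          using B form_bound_square[OF Y] x by (auto simp: form_bound_def)
        ultimately have "\<bar>x \<bullet> (f Y *\<^sub>v x)\<bar> \<le> (1 - c + y\<^sup>2) / 2 * (x \<bullet> x)"
          by (simp add: algebra_simps)
        then show "\<bar>x \<bullet> (f Y *\<^sub>v x)\<bar> \<le> y * (x \<bullet> x)" by (simp add: yy)
      qed
      with s neg[OF symmetric_carrier[OF s]] show ?thesis by (simp add: \<S>_def)
    qed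
    show "0\<^sub>m p p \<in> \<S>"
      using y scalar_prod_self_nonneg
      using neg[of "0\<^sub>m p p"] by (auto simp: \<S>_def form_bound_def form_zero intro!: symmetricI)
    \<comment> \<open>The actual Lipschitz constant is \<open>y = 1 - sqrt c\<close>, which is zero
      for \<open>c = 1\<close>; halving \<open>sqrt c\<close> keeps the factor strictly
      positive.\<close>
    show "0 < 1 - sqrt c / 2" "1 - sqrt c / 2 < 1" using c by (auto simp: field_simps intro: order.strict_trans1[of _ 1])
    show "form_bound p (f Y - f Z) ((1 - sqrt c / 2) * \<eta>)"
      if YZ: "Y \<in> \<S>" "Z \<in> \<S>" and \<eta>: "0 < \<eta>" "form_bound p (Y - Z) \<eta>" for Y Z \<eta>
    proof -
      have Y: "symmetric p Y" "form_bound p Y y" and Z: "symmetric p Z" "form_bound p Z y"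
        using YZ neg by (auto simp: \<S>_def)
      note q = symmetric_carrier[OF symmetric_square[OF Y(1)]] symmetric_carrier[OF symmetric_square[OF Z(1)]]
      have "form_bound p (f Y - f Z) (y * \<eta>)"
        unfolding form_bound_def
      proof
        fix x :: rvec assume x: "x \<in> carrier_vec p"
        have "x \<bullet> ((f Y - f Z) *\<^sub>v x) = (x \<bullet> ((Y * Y - Z * Z) *\<^sub>v x)) / 2"
          using x Bc q by (simp add: f_def form_smult[where p = p] form_plus[where p = p] form_minus[where p = p] field_simps)
        then show "\<bar>x \<bullet> ((f Y - f Z) *\<^sub>v x)\<bar> \<le> y * \<eta> * (x \<bullet> x)"
          using form_bound_square_diff[OF Y Z \<eta>(2)] x by (auto simp: form_bound_def)
      qed
      then show ?thesis
        by (rule form_bound_mono) (use \<eta> c in \<open>auto simp: y_def intro!: mult_right_mono\<close>)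
    qed
  qed
  then obtain Y where Y: "symmetric p Y" "form_bound p Y y" "f Y = Y" using neg by (auto simp: \<S>_def)
  note Yc = symmetric_carrier[OF Y(1)]
  define R where "R = sqrt m \<cdot>\<^sub>m (1\<^sub>m p - Y)"
  have Rc: "R \<in> carrier_mat p p" using Yc by (auto simp: R_def intro!: smult_carrier_mat minus_carrier_mat)
  have "symmetric p R" unfolding R_def by (intro symmetric_smult symmetric_minus symmetric_one Y)
  moreover have "0 < x \<bullet> (R *\<^sub>v x)" if x: "x \<in> carrier_vec p" "x \<noteq> 0\<^sub>v p" for x
  proof -
    have "x \<bullet> (R *\<^sub>v x) = sqrt m * (x \<bullet> x - x \<bullet> (Y *\<^sub>v x))"
      using x Yc by (simp add: R_def form_smult[where p = p] form_minus[where p = p])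
    moreover have "x \<bullet> (Y *\<^sub>v x) \<le> y * (x \<bullet> x)" using Y(2) x by (auto simp: form_bound_def abs_le_iff)
    moreover have "y * (x \<bullet> x) < 1 * (x \<bullet> x)"
      using y scalar_prod_self_pos[OF x] by (intro mult_strict_right_mono) auto
    ultimately show ?thesis using m by simp
  qed
  ultimately have "pos_def p R" by (simp add: pos_def_def symmetric_def)
  moreover have "R * R = A"
  proof -
    have "(1\<^sub>m p - Y) * (1\<^sub>m p - Y) = (1\<^sub>m p - Y) - (Y - Y * Y)"
      using minus_mult_distrib_mat[of "1\<^sub>m p" p p Y "1\<^sub>m p - Y" p]
        mult_minus_distrib_mat[of Y p p "1\<^sub>m p" p Y] Yc by simp
    moreover have "R * R = m \<cdot>\<^sub>m ((1\<^sub>m p - Y) * (1\<^sub>m p - Y))"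
      using Yc m by (intro eq_matI) (auto simp: R_def)
    ultimately have RR: "R * R = m \<cdot>\<^sub>m ((1\<^sub>m p - Y) - (Y - Y * Y))" by simp
    show ?thesis
    proof (rule eq_matI)
      fix i j assume "i < dim_row A" "j < dim_col A"
      then have ij: "i < p" "j < p" using Ac by auto
      have "Y $$ (i, j) = f Y $$ (i, j)" using Y(3) by simp
      also have "\<dots> = (B $$ (i, j) + (Y * Y) $$ (i, j)) / 2"
        using ij Bc Yc by (simp add: f_def)
      finally have "(Y * Y) $$ (i, j) = 2 * Y $$ (i, j) - B $$ (i, j)" by simp
      then have "(R * R) $$ (i, j) = m * (1\<^sub>m p $$ (i, j) - B $$ (i, j))"
        using ij Yc by (simp add: RR del: index_mult_mat(1) index_one_mat)
      then show "(R * R) $$ (i, j) = A $$ (i, j)"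
        using ij Ac m by (simp add: B_def del: index_mult_mat(1) index_one_mat)
    qed (use Rc Ac in auto)
  qed
  ultimately show ?thesis by blast
qed

section \<open>Traces, uniqueness of square roots and rank-one decompositions\<close>

lemma mat_trace_comm:
  assumes "A \<in> carrier_mat p p" "B \<in> carrier_mat p p"
  shows "mat_trace (A * B) = mat_trace (B * A)"
  using assms unfolding mat_trace_def scalar_prod_def
  by (auto simp: scalar_prod_def mult.commute atLeast0LessThan intro: sum.swap)

lemma mat_trace_plus:
  "A \<in> carrier_mat p p \<Longrightarrow> B \<in> carrier_mat p p \<Longrightarrow> mat_trace (A + B) = mat_trace A + mat_trace B"
  by (simp add: mat_trace_def sum.distrib)

lemma mat_trace_minus:
  "A \<in> carrier_mat p p \<Longrightarrow> B \<in> carrier_mat p p \<Longrightarrow> mat_trace (A - B) = mat_trace A - mat_trace B"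
  by (simp add: mat_trace_def sum_subtractf)

lemma mat_trace_smult: "A \<in> carrier_mat p p \<Longrightarrow> mat_trace (c \<cdot>\<^sub>m A) = c * mat_trace A"
  by (simp add: mat_trace_def sum_distrib_left)

lemma mat_trace_one: "mat_trace (1\<^sub>m p) = real p"
  by (simp add: mat_trace_def)

text \<open>The diagonal entries of \<open>X * A * X\<close> are the forms of \<open>A\<close> at
  the columns of \<open>X\<close>. This is how signs and bounds of quadratic forms are carried over
  to traces.\<close>

lemma mat_trace_sandwich:
  assumes X: "symmetric p X" and A: "A \<in> carrier_mat p p"
  shows "mat_trace (X * A * X) = (\<Sum>j<p. (X *\<^sub>v unit_vec p j) \<bullet> (A *\<^sub>v (X *\<^sub>v unit_vec p j)))"
proof -
  note Xc = symmetric_carrier[OF X]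
  have "(X * A * X) $$ (j, j) = (X *\<^sub>v unit_vec p j) \<bullet> (A *\<^sub>v (X *\<^sub>v unit_vec p j))" if j: "j < p" for j
  proof -
    have e: "unit_vec p j \<in> carrier_vec p" "X *\<^sub>v unit_vec p j \<in> carrier_vec p"
      using Xc by auto
    have "(X * A * X) $$ (j, j) = unit_vec p j \<bullet> ((X * A * X) *\<^sub>v unit_vec p j)"
      using Xc A j by (subst unit_vec_form) auto
    also have "(X * A * X) *\<^sub>v unit_vec p j = X *\<^sub>v (A *\<^sub>v (X *\<^sub>v unit_vec p j))"
      using Xc A e by (simp add: assoc_mult_mat_vec[where n\<^sub>1 = p and n\<^sub>2 = p and n\<^sub>3 = p])
    finally show ?thesis
      using form_symmetric[OF X e(1), of "A *\<^sub>v (X *\<^sub>v unit_vec p j)"] A e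
      by (simp add: mat_vec_closed)
  qed
  then show ?thesis using Xc A by (simp add: mat_trace_def)
qed

text \<open>The difference \<open>X\<close> solves the Sylvester equation
  \<open>R * X + X * Q = 0\<close>. Multiplying by \<open>X\<close> and taking traces gives two
  nonnegative numbers with sum zero, so the definite form of \<open>R\<close> vanishes at every
  column of \<open>X\<close>.\<close>

lemma pos_def_sqrt_unique:
  assumes R: "pos_def p R" and Q: "pos_def p Q" and eq: "R * R = Q * Q"
  shows "R = Q"
proof -
  define X where "X = R - Q"
  note Rc = symmetric_carrier[OF pos_def_symmetric[OF R]] and Qc = symmetric_carrier[OF pos_def_symmetric[OF Q]]
  have X: "symmetric p X" unfolding X_def using R Q by (intro symmetric_minus) auto
  note Xc = symmetric_carrier[OF X]
  have "R * X + X * Q = (R * R - R * Q) + (R * Q - Q * Q)"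
    using Rc Qc by (simp add: X_def minus_mult_distrib_mat[where nr = p and n = p] mult_minus_distrib_mat[where n = p and nc = p])
  also have "\<dots> = 0\<^sub>m p p" using Rc Qc eq by (intro eq_matI) (auto simp del: index_mult_mat(1))
  finally have z: "R * X + X * Q = 0\<^sub>m p p" .
  have "mat_trace (X * R * X) + mat_trace (X * Q * X) = mat_trace (X * (R * X)) + mat_trace (X * (X * Q))"
    using Xc Rc Qc mat_trace_comm[of "X * Q" p X]
    by (simp add: assoc_mult_mat[where n\<^sub>1 = p and n\<^sub>2 = p and n\<^sub>3 = p and n\<^sub>4 = p])
  also have "\<dots> = mat_trace (X * (R * X + X * Q))"
    using Xc Rc Qc by (subst mult_add_distrib_mat[where nr = p and n = p and nc = p])
      (auto simp: mat_trace_plus[where p = p])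
  also have "\<dots> = 0" using Xc by (simp add: z mat_trace_def)
  finally have t: "mat_trace (X * R * X) + mat_trace (X * Q * X) = 0" .
  let ?x = "\<lambda>j. X *\<^sub>v unit_vec p j"
  have xc: "?x j \<in> carrier_vec p" for j using Xc by auto
  have nn: "0 \<le> ?x j \<bullet> (R *\<^sub>v ?x j)" "0 \<le> ?x j \<bullet> (Q *\<^sub>v ?x j)" for j
    using pos_def_psd[OF R] pos_def_psd[OF Q] xc by (auto simp: psd_def)
  have "(\<Sum>j<p. ?x j \<bullet> (R *\<^sub>v ?x j)) = 0"
  proof -
    have "0 \<le> (\<Sum>j<p. ?x j \<bullet> (R *\<^sub>v ?x j))" "0 \<le> (\<Sum>j<p. ?x j \<bullet> (Q *\<^sub>v ?x j))"
      by (intro sum_nonneg nn)+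
    then show ?thesis
      using t unfolding mat_trace_sandwich[OF X Rc] mat_trace_sandwich[OF X Qc] by linarith
  qed
  then have "?x j \<bullet> (R *\<^sub>v ?x j) = 0" if "j < p" for j
    using that nn(1) by (subst (asm) sum_nonneg_eq_0_iff) auto
  then have x0: "?x j = 0\<^sub>v p" if "j < p" for j
    using pos_def_gt[OF R xc] that by (metis less_irrefl)
  show "R = Q"
  proof (rule eq_matI)
    fix i j assume "i < dim_row Q" "j < dim_col Q"
    then have ij: "i < p" "j < p" using Qc by auto
    have "X $$ (i, j) = 0" using unit_vec_form[OF Xc ij] x0[OF ij(2)] by simp
    then show "R $$ (i, j) = Q $$ (i, j)" using ij Rc Qc by (simp add: X_def)
  qed (use Rc Qc in auto)
qed

lemma mat_sqrt_pos_def: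
  assumes "pos_def p A"
  shows "pos_def p (mat_sqrt A)" "mat_sqrt A * mat_sqrt A = A"
proof -
  have p: "dim_row A = p" using assms by (auto simp: pos_def_def)
  obtain R where R: "pos_def p R \<and> R * R = A" using pos_def_sqrt_exists[OF assms] by blast
  have "pos_def p (mat_sqrt A) \<and> mat_sqrt A * mat_sqrt A = A"
    unfolding mat_sqrt_def p by (rule theI[where a = R]) (use R pos_def_sqrt_unique[of p _ R] in auto)
  then show "pos_def p (mat_sqrt A)" "mat_sqrt A * mat_sqrt A = A" by auto
qed

text \<open>The rows of the square root of \<open>B\<close> are such vectors. An inequality known
  for squares of linear forms can then be summed to one for all positive definite forms, with the
  trace as total weight.\<close>

lemma pos_def_rank_one_decomposition:
  assumes "pos_def p B"
  obtains w :: "nat \<Rightarrow> rvec" where "\<And>j. j < p \<Longrightarrow> w j \<in> carrier_vec p"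
    "\<And>v. v \<in> carrier_vec p \<Longrightarrow> v \<bullet> (B *\<^sub>v v) = (\<Sum>j<p. (w j \<bullet> v)\<^sup>2)"
    "mat_trace B = (\<Sum>j<p. w j \<bullet> w j)"
proof -
  define R where "R = mat_sqrt B"
  have R: "symmetric p R" "R * R = B" using mat_sqrt_pos_def[OF assms] by (auto simp: R_def)
  note Rc = symmetric_carrier[OF R(1)]
  have col: "col R j = row R j" if "j < p" for j
    using that Rc R(1) row_transpose[of j R] by (auto simp: symmetric_def)
  show ?thesis
  proof (rule that[of "\<lambda>j. row R j"])
    show "row R j \<in> carrier_vec p" if "j < p" for j using Rc that by auto
    show "v \<bullet> (B *\<^sub>v v) = (\<Sum>j<p. (row R j \<bullet> v)\<^sup>2)" if v: "v \<in> carrier_vec p" for v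
      using form_square[OF R(1) v] Rc v
      by (simp add: R(2) scalar_prod_self_sum[where p = p] mat_vec_closed)
    show "mat_trace B = (\<Sum>j<p. row R j \<bullet> row R j)"
      unfolding R(2)[symmetric] mat_trace_def using Rc col by auto
  qed
qed

section \<open>Existence of a fixed point near the identity\<close>

text \<open>The common shape of the second moment matrix (all weights one) and of the left-hand side
  of Tyler's equation (weights the reciprocal quadratic forms). Differences of two such left-hand
  sides for the same vectors are again of this shape.\<close>

definition scatter :: "nat \<Rightarrow> nat \<Rightarrow> (nat \<Rightarrow> rvec) \<Rightarrow> (nat \<Rightarrow> real) \<Rightarrow> rmat" where
  "scatter p n v w = Matrix.mat p p (\<lambda>(a, b). real p / real n * (\<Sum>i<n. v i $ a * v i $ b * w i))"

lemma scatter_carrier [simp]: "scatter p n v w \<in> carrier_mat p p"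
  by (simp add: scatter_def)

lemma scatter_symmetric: "symmetric p (scatter p n v w)"
  by (rule symmetricI) (auto simp: scatter_def mult.commute)

lemma sum_swap3: "(\<Sum>a\<in>A. \<Sum>b\<in>B. \<Sum>i\<in>I. f a b i) = (\<Sum>i\<in>I. \<Sum>a\<in>A. \<Sum>b\<in>B. (f a b i :: real))"
proof -
  have "(\<Sum>a\<in>A. \<Sum>b\<in>B. \<Sum>i\<in>I. f a b i) = (\<Sum>a\<in>A. \<Sum>i\<in>I. \<Sum>b\<in>B. f a b i)"
    by (intro sum.cong refl sum.swap)
  also have "\<dots> = (\<Sum>i\<in>I. \<Sum>a\<in>A. \<Sum>b\<in>B. f a b i)" by (rule sum.swap)
  finally show ?thesis .
qed

lemma scatter_form:
  assumes "\<And>i. i < n \<Longrightarrow> v i \<in> carrier_vec p" "x \<in> carrier_vec p" "y \<in> carrier_vec p"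
  shows "x \<bullet> (scatter p n v w *\<^sub>v y) = real p / real n * (\<Sum>i<n. w i * (v i \<bullet> x) * (v i \<bullet> y))"
proof -
  have vx: "v i \<bullet> z = (\<Sum>a<p. v i $ a * z $ a)" if "z \<in> carrier_vec p" for i z
    using that by (auto simp: scalar_prod_def atLeast0LessThan)
  have "x \<bullet> (scatter p n v w *\<^sub>v y) =
      (\<Sum>a<p. \<Sum>b<p. real p / real n * (\<Sum>i<n. w i * (v i $ a * x $ a) * (v i $ b * y $ b)))"
    unfolding form_entries[OF scatter_carrier assms(2,3)]
    by (intro sum.cong refl) (simp add: scatter_def sum_distrib_left sum_distrib_right mult_ac)
  also have "\<dots> = real p / real n * (\<Sum>a<p. \<Sum>b<p. \<Sum>i<n. w i * (v i $ a * x $ a) * (v i $ b * y $ b))"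
    by (simp add: sum_distrib_left)
  also have "(\<Sum>a<p. \<Sum>b<p. \<Sum>i<n. w i * (v i $ a * x $ a) * (v i $ b * y $ b)) =
      (\<Sum>i<n. \<Sum>a<p. \<Sum>b<p. w i * (v i $ a * x $ a) * (v i $ b * y $ b))"
    by (rule sum_swap3)
  also have "\<dots> = (\<Sum>i<n. w i * (v i \<bullet> x) * (v i \<bullet> y))"
    by (simp add: vx[OF assms(2)] vx[OF assms(3)] sum_distrib_left sum_distrib_right mult_ac)
  finally show ?thesis .
qed

lemma mat_trace_mult_scatter:
  assumes "\<And>i. i < n \<Longrightarrow> v i \<in> carrier_vec p" "A \<in> carrier_mat p p"
  shows "mat_trace (A * scatter p n v w) = real p / real n * (\<Sum>i<n. w i * (v i \<bullet> (A *\<^sub>v v i)))"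
proof -
  have "mat_trace (A * scatter p n v w) =
      (\<Sum>a<p. \<Sum>b<p. real p / real n * (\<Sum>i<n. w i * (v i $ a * A $$ (a, b) * v i $ b)))"
    using assms(2) unfolding mat_trace_def
    by (auto simp: scatter_def scalar_prod_def atLeast0LessThan sum_distrib_left sum_distrib_right mult_ac
        intro!: sum.cong)
  also have "\<dots> = real p / real n * (\<Sum>a<p. \<Sum>b<p. \<Sum>i<n. w i * (v i $ a * A $$ (a, b) * v i $ b))"
    by (simp add: sum_distrib_left)
  also have "(\<Sum>a<p. \<Sum>b<p. \<Sum>i<n. w i * (v i $ a * A $$ (a, b) * v i $ b)) =
      (\<Sum>i<n. \<Sum>a<p. \<Sum>b<p. w i * (v i $ a * A $$ (a, b) * v i $ b))"
    by (rule sum_swap3)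
  also have "\<dots> = (\<Sum>i<n. w i * (v i \<bullet> (A *\<^sub>v v i)))"
    by (intro sum.cong refl) (simp add: form_entries[OF assms(2) assms(1) assms(1)] sum_distrib_left)
  finally show ?thesis .
qed

lemma mat_trace_scatter:
  assumes "\<And>i. i < n \<Longrightarrow> v i \<in> carrier_vec p"
  shows "mat_trace (scatter p n v w) = real p / real n * (\<Sum>i<n. w i * (v i \<bullet> v i))"
proof -
  have "(\<Sum>i<n. w i * (v i \<bullet> (1\<^sub>m p *\<^sub>v v i))) = (\<Sum>i<n. w i * (v i \<bullet> v i))"
    using assms by (intro sum.cong refl) simp
  then show ?thesis using mat_trace_mult_scatter[OF assms, where A = "1\<^sub>m p" and w = w] left_mult_one_mat[OF scatter_carrier] by simp
qed

lemma scatter_minus: "scatter p n v w - scatter p n v w' = scatter p n v (\<lambda>i. w i - w' i)"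
  by (intro eq_matI) (auto simp: scatter_def right_diff_distrib sum_subtractf)

lemma scatter_cong: "(\<And>i. i < n \<Longrightarrow> w i = w' i) \<Longrightarrow> scatter p n v w = scatter p n v w'"
  by (intro eq_matI) (auto simp: scatter_def intro!: sum.cong)

section \<open>Inverse quadratic forms near the identity\<close>

lemma near_one_lower:
  assumes S: "symmetric p S" and d: "form_bound p (S - 1\<^sub>m p) d" and x: "x \<in> carrier_vec p"
  shows "(1 - d) * (x \<bullet> x) \<le> x \<bullet> (S *\<^sub>v x)"
proof -
  have "\<bar>x \<bullet> ((S - 1\<^sub>m p) *\<^sub>v x)\<bar> \<le> d * (x \<bullet> x)" using d x by (simp add: form_bound_def)
  then show ?thesis using x symmetric_carrier[OF S] by (simp add: scalar_prod_minus_distrib[where n = p] abs_le_iff algebra_simps)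
qed

lemma near_one_pos_def:
  assumes S: "symmetric p S" and d: "form_bound p (S - 1\<^sub>m p) d" "d < 1"
  shows "pos_def p S"
  unfolding pos_def_def
proof (intro conjI ballI impI)
  fix x :: rvec assume x: "x \<in> carrier_vec p" "x \<noteq> 0\<^sub>v p"
  have "0 < (1 - d) * (x \<bullet> x)" using d scalar_prod_self_pos[OF x] by simp
  with near_one_lower[OF S d(1) x(1)] show "0 < x \<bullet> (S *\<^sub>v x)" by linarith
qed (use S in \<open>auto simp: symmetric_def\<close>)

text \<open>The solution \<open>y\<close> of \<open>S y = v\<close> satisfies
  \<open>v - y = (S - 1) y\<close>, so everything follows from a bound on the length of
  \<open>y\<close>, and this comes from the lower bound on the form of \<open>S\<close>.\<close>

lemma near_one_inverse:
  assumes S: "symmetric p S" and d: "form_bound p (S - 1\<^sub>m p) d" "0 \<le> d" "d \<le> 1 / 4"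
    and v: "v \<in> carrier_vec p" "v \<bullet> v = 1"
  shows "euclid_norm (mat_inv S *\<^sub>v v) \<le> 1 / (1 - d)"
    and "euclid_norm (v - mat_inv S *\<^sub>v v) \<le> d / (1 - d)"
    and "(1 - 2 * d) / (1 - d) \<le> v \<bullet> (mat_inv S *\<^sub>v v)"
proof -
  have pd: "pos_def p S" using near_one_pos_def[OF S d(1)] d by simp
  let ?y = "mat_inv S *\<^sub>v v"
  note y = pos_def_inverse_vec[OF pd v(1)]
  have nv: "euclid_norm v = 1" using v by (simp add: euclid_norm_def)
  have "(1 - d) * (euclid_norm ?y)\<^sup>2 \<le> ?y \<bullet> v"
    using near_one_lower[OF S d(1) y(1)] y by (simp add: euclid_norm_square)
  also have "\<dots> \<le> euclid_norm ?y * 1" using abs_scalar_prod_le[OF y(1) v(1)] nv by simp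
  finally have "euclid_norm ?y * ((1 - d) * euclid_norm ?y) \<le> euclid_norm ?y * 1"
    by (simp add: power2_eq_square mult_ac)
  then have "(1 - d) * euclid_norm ?y \<le> 1"
    using euclid_norm_nonneg[of ?y] by (cases "euclid_norm ?y = 0") (auto dest: mult_left_le_imp_le)
  then show n: "euclid_norm ?y \<le> 1 / (1 - d)" using d by (simp add: field_simps)
  have "v - ?y = (S - 1\<^sub>m p) *\<^sub>v ?y"
    using mat_minus_mult_vec[OF symmetric_carrier[OF S] _ y(1), of "1\<^sub>m p"] y by simp
  then have "euclid_norm (v - ?y) \<le> d * euclid_norm ?y"
    using form_bound_norm[OF symmetric_minus[OF S symmetric_one] d(1) y(1)] by simp
  also have "\<dots> \<le> d * (1 / (1 - d))" using n d by (intro mult_left_mono) auto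
  finally show vy: "euclid_norm (v - ?y) \<le> d / (1 - d)" by simp
  have "v \<bullet> (v - ?y) = 1 - v \<bullet> ?y" using v y by (simp add: scalar_prod_minus_distrib[where n = p])
  moreover have "v \<bullet> (v - ?y) \<le> euclid_norm (v - ?y)"
    using abs_scalar_prod_le[OF v(1), of "v - ?y"] v y nv by simp
  ultimately have "1 - d / (1 - d) \<le> v \<bullet> ?y" using vy by linarith
  then show "(1 - 2 * d) / (1 - d) \<le> v \<bullet> ?y" using d by (simp add: field_simps)
qed

text \<open>The vector \<open>u\<close> minimizes the form of \<open>S\<close> on the hyperplane of
  vectors with inner product one with \<open>v\<close>; the minimum is the reciprocal of
  \<open>v \<bullet> (mat_inv S *\<^sub>v v)\<close>, which is the weight in Tyler's equation. At
  the identity \<open>u\<close> is \<open>v\<close> itself.\<close>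

lemma near_one_normalized:
  assumes S: "symmetric p S" and d: "form_bound p (S - 1\<^sub>m p) d" "0 \<le> d" "d \<le> 1 / 4"
    and v: "v \<in> carrier_vec p" "v \<bullet> v = 1"
  defines "u \<equiv> (1 / (v \<bullet> (mat_inv S *\<^sub>v v))) \<cdot>\<^sub>v (mat_inv S *\<^sub>v v)"
  shows "u \<in> carrier_vec p" "euclid_norm (u - v) \<le> 2 * d" "0 < v \<bullet> (mat_inv S *\<^sub>v v)"
proof -
  have pd: "pos_def p S" using near_one_pos_def[OF S d(1)] d by simp
  let ?y = "mat_inv S *\<^sub>v v"
  let ?q = "v \<bullet> ?y"
  note y = pos_def_inverse_vec[OF pd v(1)]
  show u: "u \<in> carrier_vec p" using y by (simp add: u_def)
  have "0 < (1 - 2 * d) / (1 - d)" using d by simp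
  with near_one_inverse(3)[OF S d v] show q: "0 < ?q" by linarith
  \<comment> \<open>\<open>?q\<close> times the unit vector \<open>v\<close> is the orthogonal
    projection of \<open>?y\<close> onto the line of \<open>v\<close>, hence at least as close to
    \<open>?y\<close> as \<open>v\<close> is.\<close>
  have "(?y - ?q \<cdot>\<^sub>v v) \<bullet> (?y - ?q \<cdot>\<^sub>v v) = ?y \<bullet> ?y - ?q\<^sup>2"
    using v y comm_scalar_prod[OF v(1) y(1)]
    by (simp add: scalar_prod_minus_distrib[where n = p] minus_scalar_prod_distrib[where n = p] power2_eq_square)
  moreover have "(v - ?y) \<bullet> (v - ?y) = ?y \<bullet> ?y - 2 * ?q + 1"
    using v y comm_scalar_prod[OF v(1) y(1)]
    by (simp add: scalar_prod_minus_distrib[where n = p] minus_scalar_prod_distrib[where n = p])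
  ultimately have "(?y - ?q \<cdot>\<^sub>v v) \<bullet> (?y - ?q \<cdot>\<^sub>v v) \<le> (v - ?y) \<bullet> (v - ?y)"
    using zero_le_power2[of "?q - 1"] by (simp add: power2_eq_square algebra_simps)
  then have "euclid_norm (?y - ?q \<cdot>\<^sub>v v) \<le> d / (1 - d)"
    using near_one_inverse(2)[OF S d v] by (simp add: euclid_norm_def) (meson order_trans real_sqrt_le_mono)
  moreover have "u - v = (1 / ?q) \<cdot>\<^sub>v (?y - ?q \<cdot>\<^sub>v v)"
    using q v pos_def_inverse(1)[OF pd] by (intro eq_vecI) (auto simp: u_def field_simps)
  ultimately have "euclid_norm (u - v) \<le> 1 / ?q * (d / (1 - d))"
    using q by (simp add: euclid_norm_smult) (metis divide_divide_eq_left divide_right_mono less_imp_le mult.commute)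
  also have "\<dots> \<le> (1 - d) / (1 - 2 * d) * (d / (1 - d))"
    using near_one_inverse(3)[OF S d v] q d by (intro mult_right_mono) (auto simp: field_simps)
  also have "\<dots> = d / (1 - 2 * d)" using d by simp
  also have "\<dots> \<le> 2 * d"
    using d mult_left_mono[of "d" "1 / 4" d] by (simp add: field_simps power2_eq_square)
  finally show "euclid_norm (u - v) \<le> 2 * d" .
qed

text \<open>The difference of the reciprocals is exactly the bilinear form of \<open>S - S'\<close>
  at the two minimizers \<open>u'\<close> and \<open>u\<close>. Each lies within \<open>2 d\<close>
  of \<open>v\<close> and has length at most 3/2, so moving them to \<open>v\<close> costs
  \<open>3 d \<eta>\<close> and \<open>2 d \<eta>\<close>. The error is \<open>d\<close> times the
  distance \<open>\<eta>\<close>, as a contraction estimate for two nearby matrices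
  requires.\<close>

lemma inverse_form_expansion:
  assumes S: "symmetric p S" "form_bound p (S - 1\<^sub>m p) d"
    and S': "symmetric p S'" "form_bound p (S' - 1\<^sub>m p) d"
    and d: "0 \<le> d" "d \<le> 1 / 4" and \<eta>: "form_bound p (S - S') \<eta>" "0 \<le> \<eta>"
    and v: "v \<in> carrier_vec p" "v \<bullet> v = 1"
  shows "\<bar>1 / (v \<bullet> (mat_inv S *\<^sub>v v)) - 1 / (v \<bullet> (mat_inv S' *\<^sub>v v)) - v \<bullet> ((S - S') *\<^sub>v v)\<bar> \<le> 5 * d * \<eta>"
proof -
  have pd: "pos_def p S" "pos_def p S'"
    using near_one_pos_def[OF S] near_one_pos_def[OF S'] d by auto
  define y where "y = mat_inv S *\<^sub>v v"
  define y' where "y' = mat_inv S' *\<^sub>v v"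
  define u where "u = (1 / (v \<bullet> y)) \<cdot>\<^sub>v y"
  define u' where "u' = (1 / (v \<bullet> y')) \<cdot>\<^sub>v y'"
  define E where "E = S - S'"
  have Es: "symmetric p E" unfolding E_def by (rule symmetric_minus[OF S(1) S'(1)])
  note Ec = symmetric_carrier[OF Es] and Sc = symmetric_carrier[OF S(1)] and Sc' = symmetric_carrier[OF S'(1)]
  have y: "y \<in> carrier_vec p" "S *\<^sub>v y = v" and y': "y' \<in> carrier_vec p" "S' *\<^sub>v y' = v"
    using pos_def_inverse_vec[OF pd(1) v(1)] pos_def_inverse_vec[OF pd(2) v(1)] by (auto simp: y_def y'_def)
  have u: "u \<in> carrier_vec p" "euclid_norm (u - v) \<le> 2 * d" "0 < v \<bullet> y"
    using near_one_normalized[OF S d v] by (auto simp: u_def y_def)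
  have u': "u' \<in> carrier_vec p" "euclid_norm (u' - v) \<le> 2 * d" "0 < v \<bullet> y'"
    using near_one_normalized[OF S' d v] by (auto simp: u'_def y'_def)
  have nv: "euclid_norm v = 1" using v by (simp add: euclid_norm_def)
  have "y' \<bullet> (E *\<^sub>v y) = y' \<bullet> v - y' \<bullet> (S' *\<^sub>v y)"
    using y y' Sc Sc' by (simp add: E_def form_minus[where p = p])
  also have "\<dots> = v \<bullet> y' - v \<bullet> y"
    using form_symmetric[OF S'(1) y'(1) y(1)] comm_scalar_prod[OF v(1) y'(1)] y'(2) by simp
  finally have yEy: "y' \<bullet> (E *\<^sub>v y) = v \<bullet> y' - v \<bullet> y" .
  have "u' \<bullet> (E *\<^sub>v u) = (1 / (v \<bullet> y')) * ((1 / (v \<bullet> y)) * (y' \<bullet> (E *\<^sub>v y)))"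
    using y y' Ec by (simp add: u_def u'_def mult_mat_vec[OF Ec y(1)])
  then have diff: "1 / (v \<bullet> y) - 1 / (v \<bullet> y') = u' \<bullet> (E *\<^sub>v u)"
    using u(3) u'(3) by (simp add: yEy field_simps)
  have uv: "u - v \<in> carrier_vec p" "u' - v \<in> carrier_vec p" using u u' v by auto
  have "u' \<bullet> (E *\<^sub>v u) - v \<bullet> (E *\<^sub>v v) = (u' - v) \<bullet> (E *\<^sub>v u) + v \<bullet> (E *\<^sub>v (u - v))"
    using u u' v Ec
    by (simp add: mat_mult_vec_minus[OF Ec] scalar_prod_minus_distrib[where n = p] minus_scalar_prod_distrib[where n = p])
  moreover have "euclid_norm u \<le> 3 / 2"
  proof -
    have "u = v + (u - v)" using u v by (intro eq_vecI) auto
    then show ?thesis using euclid_norm_add[OF v(1) uv(1)] u(2) nv d by simp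
  qed
  then have "\<eta> * euclid_norm (u' - v) * euclid_norm u \<le> \<eta> * (2 * d) * (3 / 2)"
    using u'(2) \<eta> d by (intro mult_mono) auto
  with form_bound_bilinear[OF Es \<eta>(1)[folded E_def] uv(2) u(1)]
  have "\<bar>(u' - v) \<bullet> (E *\<^sub>v u)\<bar> \<le> \<eta> * (2 * d) * (3 / 2)" by linarith
  moreover have "\<bar>v \<bullet> (E *\<^sub>v (u - v))\<bar> \<le> \<eta> * (2 * d)"
    using form_bound_bilinear[OF Es \<eta>(1)[folded E_def] v(1) uv(1)] nv mult_left_mono[OF u(2) \<eta>(2)] by simp
  ultimately show ?thesis
    using diff by (simp add: y_def y'_def E_def algebra_simps)
qed

text \<open>The analysis of the fixed point uses nothing else about the directions. The order
  \<open>1 / p\<close> in \<open>cross\<close> is the right one: for a uniform direction and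
  orthonormal \<open>e\<close>, \<open>f\<close>, the mean of p times the two squared cosines is 1 /
  (p + 2).\<close>

locale tyler_sample =
  fixes p n :: nat and v :: "nat \<Rightarrow> rvec" and c t :: real
  assumes p: "1 \<le> p" and n: "0 < n" and c: "0 < c" "c \<le> 1"
    and v: "\<And>i. i < n \<Longrightarrow> v i \<in> carrier_vec p" and unit: "\<And>i. i < n \<Longrightarrow> v i \<bullet> v i = 1"
    and second: "form_bound p (scatter p n v (\<lambda>_. 1) - 1\<^sub>m p) t"
    and cross: "\<And>e f. e \<in> carrier_vec p \<Longrightarrow> f \<in> carrier_vec p \<Longrightarrow>
      c / real p * (e \<bullet> e) * (f \<bullet> f) \<le> real p / real n * (\<Sum>i<n. (v i \<bullet> e)\<^sup>2 * (v i \<bullet> f)\<^sup>2)"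
begin

lemma second_form:
  assumes "f \<in> carrier_vec p"
  shows "\<bar>real p / real n * (\<Sum>i<n. (v i \<bullet> f)\<^sup>2) - f \<bullet> f\<bar> \<le> t * (f \<bullet> f)"
proof -
  have "\<bar>f \<bullet> ((scatter p n v (\<lambda>_. 1) - 1\<^sub>m p) *\<^sub>v f)\<bar> \<le> t * (f \<bullet> f)"
    using second assms by (simp add: form_bound_def)
  moreover have "f \<bullet> (scatter p n v (\<lambda>_. 1) *\<^sub>v f) = real p / real n * (\<Sum>i<n. (v i \<bullet> f)\<^sup>2)"
    using scatter_form[where n = n and v = v, OF v assms assms, where w = "\<lambda>_. 1"]
    by (simp add: power2_eq_square)
  ultimately show ?thesis using assms by (simp add: form_minus[where p = p])
qed

lemma cross_pos_def:
  assumes B: "pos_def p B" and f: "f \<in> carrier_vec p"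
  shows "c / real p * (f \<bullet> f) * mat_trace B \<le> real p / real n * (\<Sum>i<n. (v i \<bullet> f)\<^sup>2 * (v i \<bullet> (B *\<^sub>v v i)))"
proof -
  obtain w where w: "\<And>j. j < p \<Longrightarrow> w j \<in> carrier_vec p"
    and Bw: "\<And>v. v \<in> carrier_vec p \<Longrightarrow> v \<bullet> (B *\<^sub>v v) = (\<Sum>j<p. (w j \<bullet> v)\<^sup>2)"
    and tr: "mat_trace B = (\<Sum>j<p. w j \<bullet> w j)"
    using pos_def_rank_one_decomposition[OF B] by blast
  have "c / real p * (f \<bullet> f) * mat_trace B = (\<Sum>j<p. c / real p * (f \<bullet> f) * (w j \<bullet> w j))"
    by (simp add: tr sum_distrib_left)
  also have "\<dots> \<le> (\<Sum>j<p. real p / real n * (\<Sum>i<n. (v i \<bullet> f)\<^sup>2 * (v i \<bullet> w j)\<^sup>2))"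
    by (intro sum_mono cross f w) auto
  also have "\<dots> = real p / real n * (\<Sum>i<n. \<Sum>j<p. (v i \<bullet> f)\<^sup>2 * (v i \<bullet> w j)\<^sup>2)"
    by (subst sum.swap) (simp add: sum_distrib_left)
  also have "(\<Sum>i<n. \<Sum>j<p. (v i \<bullet> f)\<^sup>2 * (v i \<bullet> w j)\<^sup>2) = (\<Sum>i<n. (v i \<bullet> f)\<^sup>2 * (v i \<bullet> (B *\<^sub>v v i)))"
    using comm_scalar_prod[OF w v] by (intro sum.cong refl) (simp add: Bw[OF v] sum_distrib_left)
  finally show ?thesis .
qed

lemma second_pos_def:
  assumes B: "pos_def p B"
  shows "(1 - t) * mat_trace B \<le> real p / real n * (\<Sum>i<n. v i \<bullet> (B *\<^sub>v v i))"
proof -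
  obtain w where w: "\<And>j. j < p \<Longrightarrow> w j \<in> carrier_vec p"
    and Bw: "\<And>v. v \<in> carrier_vec p \<Longrightarrow> v \<bullet> (B *\<^sub>v v) = (\<Sum>j<p. (w j \<bullet> v)\<^sup>2)"
    and tr: "mat_trace B = (\<Sum>j<p. w j \<bullet> w j)"
    using pos_def_rank_one_decomposition[OF B] by blast
  have "(1 - t) * mat_trace B = (\<Sum>j<p. (1 - t) * (w j \<bullet> w j))"
    by (simp add: tr sum_distrib_left)
  also have "\<dots> \<le> (\<Sum>j<p. real p / real n * (\<Sum>i<n. (v i \<bullet> w j)\<^sup>2))"
  proof (intro sum_mono)
    fix j assume "j \<in> {..<p}"
    then show "(1 - t) * (w j \<bullet> w j) \<le> real p / real n * (\<Sum>i<n. (v i \<bullet> w j)\<^sup>2)"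
      using second_form[OF w, of j] by (simp add: abs_le_iff algebra_simps)
  qed
  also have "\<dots> = real p / real n * (\<Sum>i<n. \<Sum>j<p. (v i \<bullet> w j)\<^sup>2)"
    by (subst sum.swap) (simp add: sum_distrib_left)
  also have "(\<Sum>i<n. \<Sum>j<p. (v i \<bullet> w j)\<^sup>2) = (\<Sum>i<n. v i \<bullet> (B *\<^sub>v v i))"
    using comm_scalar_prod[OF w v] by (intro sum.cong refl) (simp add: Bw[OF v])
  finally show ?thesis .
qed

definition T :: "rmat \<Rightarrow> rmat" where
  "T S = scatter p n v (\<lambda>i. 1 / (v i \<bullet> (mat_inv S *\<^sub>v v i)))"

text \<open>Any fixed point of this trace-preserving map is one of \<open>T\<close>, see \<open>T_eq_if_recentred_eq\<close>.\<close>

definition recentred :: "rmat \<Rightarrow> rmat" where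
  "recentred S = T S - (mat_trace (T S) / real p - 1) \<cdot>\<^sub>m 1\<^sub>m p"

lemma T_symmetric: "symmetric p (T S)"
  by (simp add: T_def scatter_symmetric)

lemma recentred_symmetric: "symmetric p (recentred S)"
  unfolding recentred_def by (intro symmetric_minus symmetric_smult symmetric_one T_symmetric)

lemma recentred_trace: "mat_trace (recentred S) = real p"
  using symmetric_carrier[OF T_symmetric] p
  by (simp add: recentred_def mat_trace_minus[where p = p] mat_trace_smult[where p = p] mat_trace_one field_simps)

text \<open>Each weight cancels its own quadratic form, so \<open>mat_inv S * T S\<close> has trace
  \<open>p\<close> for every positive definite \<open>S\<close>. If \<open>T S\<close> is
  \<open>S\<close> plus \<open>\<tau>\<close> times the identity, the same trace is \<open>p\<close>
  plus \<open>\<tau>\<close> times the positive trace of \<open>mat_inv S\<close>.\<close>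

lemma T_eq_if_recentred_eq:
  assumes S: "pos_def p S" and fp: "recentred S = S"
  shows "T S = S"
proof -
  define \<tau> where "\<tau> = mat_trace (T S) / real p - 1"
  note Tc = symmetric_carrier[OF T_symmetric, of S] and Sc = symmetric_carrier[OF pos_def_symmetric[OF S]]
  note inv = pos_def_inverse[OF S]
  have TS: "T S = S + \<tau> \<cdot>\<^sub>m 1\<^sub>m p"
  proof (rule eq_matI)
    fix i j assume "i < dim_row (S + \<tau> \<cdot>\<^sub>m 1\<^sub>m p)" "j < dim_col (S + \<tau> \<cdot>\<^sub>m 1\<^sub>m p)"
    then have ij: "i < p" "j < p" by auto
    have "recentred S $$ (i, j) = S $$ (i, j)" by (simp add: fp)
    with ij Tc Sc show "T S $$ (i, j) = (S + \<tau> \<cdot>\<^sub>m 1\<^sub>m p) $$ (i, j)"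
      by (simp add: recentred_def \<tau>_def)
  qed (use Tc in auto)
  have pos: "0 < v i \<bullet> (mat_inv S *\<^sub>v v i)" if "i < n" for i
  proof -
    have "v i \<noteq> 0\<^sub>v p" using unit[OF that] by auto
    then show ?thesis using pos_def_gt[OF pos_def_mat_inv[OF S] v] that by blast
  qed
  have "mat_trace (mat_inv S * T S) = real p / real n * (\<Sum>i<n. 1)"
  proof -
    have "(\<Sum>i<n. 1 / (v i \<bullet> (mat_inv S *\<^sub>v v i)) * (v i \<bullet> (mat_inv S *\<^sub>v v i))) = (\<Sum>i<n. 1)"
      using pos by (intro sum.cong refl) (simp add: less_imp_neq[symmetric])
    then show ?thesis
      using mat_trace_mult_scatter[OF v inv(1), where w = "\<lambda>i. 1 / (v i \<bullet> (mat_inv S *\<^sub>v v i))"]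
      by (simp add: T_def)
  qed
  then have "mat_trace (mat_inv S * T S) = real p" using n by simp
  moreover have "mat_inv S * T S = 1\<^sub>m p + \<tau> \<cdot>\<^sub>m mat_inv S"
    unfolding TS using inv Sc mult_add_distrib_mat[OF inv(1) Sc, of "\<tau> \<cdot>\<^sub>m 1\<^sub>m p"]
      mult_smult_distrib[OF inv(1), of "1\<^sub>m p" p \<tau>] by simp
  ultimately have "\<tau> * mat_trace (mat_inv S) = 0"
    using inv by (simp add: mat_trace_plus[where p = p] mat_trace_smult[where p = p] mat_trace_one)
  moreover have "0 < mat_trace (mat_inv S)"
  proof -
    have "0 < mat_inv S $$ (j, j)" if "j < p" for j
    proof -
      have "unit_vec p j \<noteq> (0\<^sub>v p :: rvec)" using that by (auto simp: vec_eq_iff)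
      then show ?thesis
        using pos_def_gt[OF pos_def_mat_inv[OF S], of "unit_vec p j"] unit_vec_form[OF inv(1) that that] by simp
    qed
    then show ?thesis using inv p unfolding mat_trace_def by (intro sum_pos) (auto simp: lessThan_empty_iff)
  qed
  ultimately have "\<tau> = 0" by simp
  then show ?thesis using TS Sc by (intro eq_matI) auto
qed

text \<open>Upper bounds are enough, since lower ones arise by exchanging \<open>S\<close> and
  \<open>S'\<close>. The slack \<open>\<zeta>\<close> makes
  \<open>(1 + \<zeta>) \<eta> 1 - E\<close> strictly positive, as the rank-one decomposition
  demands, and \<open>5 d\<close> comes from linearizing the weights. The trace is bounded
  separately because the recentring shift depends on it.\<close>

lemma T_diff_upper:
  assumes S: "symmetric p S" "form_bound p (S - 1\<^sub>m p) d" "mat_trace S = real p"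
    and S': "symmetric p S'" "form_bound p (S' - 1\<^sub>m p) d" "mat_trace S' = real p"
    and d: "0 \<le> d" "d \<le> 1 / 4" and \<eta>: "form_bound p (S - S') \<eta>" "0 < \<eta>" and \<zeta>: "0 < \<zeta>"
    and f: "f \<in> carrier_vec p"
  shows "f \<bullet> ((T S - T S') *\<^sub>v f) \<le> \<eta> * ((1 + \<zeta>) * (1 + t - c) + 5 * d * (1 + t)) * (f \<bullet> f)"
    and "mat_trace (T S - T S') / real p \<le> \<eta> * (t * (1 + \<zeta>) + 5 * d)"
proof -
  define E where "E = S - S'"
  have Es: "symmetric p E" unfolding E_def by (rule symmetric_minus[OF S(1) S'(1)])
  note Ec = symmetric_carrier[OF Es]
  define a where "a = (1 + \<zeta>) * \<eta>"
  define B where "B = a \<cdot>\<^sub>m 1\<^sub>m p - E"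
  have Bs: "symmetric p B" unfolding B_def by (intro symmetric_minus symmetric_smult symmetric_one Es)
  have Bform: "x \<bullet> (B *\<^sub>v x) = a * (x \<bullet> x) - x \<bullet> (E *\<^sub>v x)" if "x \<in> carrier_vec p" for x
    using that Ec by (simp add: B_def form_minus[where p = p] form_smult[where p = p])
  have B: "pos_def p B"
    unfolding pos_def_def
  proof (intro conjI ballI impI)
    fix x :: rvec assume x: "x \<in> carrier_vec p" "x \<noteq> 0\<^sub>v p"
    have "x \<bullet> (E *\<^sub>v x) \<le> \<eta> * (x \<bullet> x)" using \<eta>(1) x by (auto simp: form_bound_def E_def abs_le_iff)
    also have "\<dots> < a * (x \<bullet> x)"
      using \<zeta> \<eta> scalar_prod_self_pos[OF x] by (simp add: a_def)
    finally show "0 < x \<bullet> (B *\<^sub>v x)" using Bform[OF x(1)] by simp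
  qed (use Bs in \<open>auto simp: symmetric_def\<close>)
  \<comment> \<open>The trace normalization of \<open>S\<close> and \<open>S'\<close> enters here:
    \<open>E\<close> has trace zero, so \<open>B\<close> keeps the full trace of the multiple of the
    identity.\<close>
  have trB: "mat_trace B = a * real p"
    using Ec S(3) S'(3) symmetric_carrier[OF S(1)] symmetric_carrier[OF S'(1)]
    by (simp add: B_def E_def mat_trace_minus[where p = p] mat_trace_smult[where p = p] mat_trace_one)
  define w where "w i = 1 / (v i \<bullet> (mat_inv S *\<^sub>v v i)) - 1 / (v i \<bullet> (mat_inv S' *\<^sub>v v i))" for i
  have w: "w i \<le> a + 5 * d * \<eta> - v i \<bullet> (B *\<^sub>v v i)" if "i < n" for i
    using inverse_form_expansion[OF S(1,2) S'(1,2) d \<eta>(1) less_imp_le[OF \<eta>(2)] v[OF that] unit[OF that]]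
      Bform[OF v[OF that]] unit[OF that]
    by (simp add: w_def E_def abs_le_iff)
  have F: "T S - T S' = scatter p n v w"
    unfolding T_def scatter_minus w_def ..
  have pn: "0 \<le> real p / real n" by simp
  have "f \<bullet> ((T S - T S') *\<^sub>v f) = real p / real n * (\<Sum>i<n. w i * (v i \<bullet> f)\<^sup>2)"
    unfolding F using scatter_form[where n = n and v = v, OF v f f, where w = w]
    by (simp add: power2_eq_square mult.assoc)
  also have "\<dots> \<le> real p / real n * (\<Sum>i<n. (a + 5 * d * \<eta> - v i \<bullet> (B *\<^sub>v v i)) * (v i \<bullet> f)\<^sup>2)"
    using w by (intro mult_left_mono[OF _ pn] sum_mono mult_right_mono) auto
  also have "\<dots> = (a + 5 * d * \<eta>) * (real p / real n * (\<Sum>i<n. (v i \<bullet> f)\<^sup>2)) -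
      real p / real n * (\<Sum>i<n. (v i \<bullet> f)\<^sup>2 * (v i \<bullet> (B *\<^sub>v v i)))"
    by (simp add: left_diff_distrib sum_subtractf sum_distrib_left right_diff_distrib mult_ac)
  also have "\<dots> \<le> (a + 5 * d * \<eta>) * ((1 + t) * (f \<bullet> f)) - c / real p * (f \<bullet> f) * mat_trace B"
    using second_form[OF f] \<zeta> \<eta> d cross_pos_def[OF B f]
    by (intro diff_mono mult_left_mono) (auto simp: a_def abs_le_iff algebra_simps)
  also have "\<dots> = \<eta> * ((1 + \<zeta>) * (1 + t - c) + 5 * d * (1 + t)) * (f \<bullet> f)"
    using p by (simp add: trB a_def field_simps)
  finally show "f \<bullet> ((T S - T S') *\<^sub>v f) \<le> \<eta> * ((1 + \<zeta>) * (1 + t - c) + 5 * d * (1 + t)) * (f \<bullet> f)" .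
  have "mat_trace (T S - T S') = real p / real n * (\<Sum>i<n. w i * (v i \<bullet> v i))"
    unfolding F by (rule mat_trace_scatter) (rule v)
  also have "\<dots> = real p / real n * (\<Sum>i<n. w i)" by (simp add: unit)
  also have "\<dots> \<le> real p / real n * (\<Sum>i<n. a + 5 * d * \<eta> - v i \<bullet> (B *\<^sub>v v i))"
    using w by (intro mult_left_mono[OF _ pn] sum_mono) auto
  also have "\<dots> = (a + 5 * d * \<eta>) * real p - real p / real n * (\<Sum>i<n. v i \<bullet> (B *\<^sub>v v i))"
    using n by (simp add: sum_subtractf field_simps)
  also have "\<dots> \<le> (a + 5 * d * \<eta>) * real p - (1 - t) * (a * real p)"
    using second_pos_def[OF B] trB by simp
  also have "\<dots> = \<eta> * (t * (1 + \<zeta>) + 5 * d) * real p" by (simp add: a_def algebra_simps)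
  finally show "mat_trace (T S - T S') / real p \<le> \<eta> * (t * (1 + \<zeta>) + 5 * d)"
    using p by (simp add: field_simps)
qed

lemma t_nonneg: "0 \<le> t"
proof -
  have "unit_vec p 0 \<bullet> unit_vec p 0 = (1 :: real)" using p by simp
  with second_form[of "unit_vec p 0"] show ?thesis
    using abs_ge_zero order_trans by (metis mult.right_neutral unit_vec_carrier)
qed

lemma recentred_contraction:
  assumes S: "symmetric p S" "form_bound p (S - 1\<^sub>m p) d" "mat_trace S = real p"
    and S': "symmetric p S'" "form_bound p (S' - 1\<^sub>m p) d" "mat_trace S' = real p"
    and d: "0 \<le> d" "d \<le> c / 80" and t: "t \<le> c / 160" and \<eta>: "form_bound p (S - S') \<eta>" "0 < \<eta>"
  shows "form_bound p (recentred S - recentred S') ((1 - c / 2) * \<eta>)"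
proof -
  have d4: "d \<le> 1 / 4" using d c by linarith
  have upper: "f \<bullet> ((recentred S1 - recentred S2) *\<^sub>v f) \<le> (1 - c / 2) * \<eta> * (f \<bullet> f)"
    if S1: "symmetric p S1" "form_bound p (S1 - 1\<^sub>m p) d" "mat_trace S1 = real p"
      and S2: "symmetric p S2" "form_bound p (S2 - 1\<^sub>m p) d" "mat_trace S2 = real p"
      and \<eta>1: "form_bound p (S1 - S2) \<eta>" "form_bound p (S2 - S1) \<eta>" and f: "f \<in> carrier_vec p" for S1 S2 f
  proof -
    \<comment> \<open>This slack spends a quarter of the gain \<open>c\<close>: the leading factor
      becomes \<open>1 - 3 * c / 4 - c * c / 4\<close>. The bounds on \<open>d\<close> and
      \<open>t\<close> keep all remaining errors below another \<open>c / 4\<close>.\<close>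
    let ?z = "c / 4"
    note Tc = symmetric_carrier[OF T_symmetric]
    have z: "0 < ?z" using c by simp
    note up = T_diff_upper[OF S1 S2 d(1) d4 \<eta>1(1) \<eta>(2) z f]
      and low = T_diff_upper(2)[OF S2 S1 d(1) d4 \<eta>1(2) \<eta>(2) z f]
    \<comment> \<open>Recentring subtracts the trace difference, so its upper bound needs the trace
      estimate for the exchanged pair.\<close>
    have "f \<bullet> ((recentred S1 - recentred S2) *\<^sub>v f) =
        f \<bullet> ((T S1 - T S2) *\<^sub>v f) + (mat_trace (T S2 - T S1) / real p) * (f \<bullet> f)"
      using f Tc[of S1] Tc[of S2]
      by (simp add: recentred_def form_minus[where p = p] form_smult[where p = p] mat_trace_minus[where p = p]
          left_diff_distrib diff_divide_distrib)
    also have "\<dots> \<le> \<eta> * ((1 + ?z) * (1 + t - c) + 5 * d * (1 + t)) * (f \<bullet> f) + \<eta> * (t * (1 + ?z) + 5 * d) * (f \<bullet> f)"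
      by (intro add_mono up(1) mult_right_mono low scalar_prod_self_nonneg)
    also have "\<dots> = \<eta> * (f \<bullet> f) * ((1 + ?z) * (1 + t - c) + 5 * d * (1 + t) + t * (1 + ?z) + 5 * d)"
      by (simp add: algebra_simps)
    also have "\<dots> \<le> \<eta> * (f \<bullet> f) * (1 - c / 2)"
    proof (intro mult_left_mono)
      have "c * t \<le> 1 * t" "d * t \<le> 1 * t" using c d d4 t_nonneg by (intro mult_right_mono; simp)+
      moreover have "0 \<le> c * c" by simp
      moreover have "(1 + ?z) * (1 + t - c) + 5 * d * (1 + t) + t * (1 + ?z) + 5 * d =
          1 - 3 * c / 4 - c * c / 4 + 2 * t + c * t / 2 + 10 * d + 5 * (d * t)"
        by (simp add: field_simps)
      ultimately show "(1 + ?z) * (1 + t - c) + 5 * d * (1 + t) + t * (1 + ?z) + 5 * d \<le> 1 - c / 2"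
        using d t c by linarith
      show "0 \<le> \<eta> * (f \<bullet> f)" using \<eta>(2) scalar_prod_self_nonneg[of f] by simp
    qed
    finally show ?thesis by (simp add: mult_ac)
  qed
  have \<eta>': "form_bound p (S' - S) \<eta>"
    by (rule form_bound_commute[OF symmetric_carrier[OF S(1)] symmetric_carrier[OF S'(1)] \<eta>(1)])
  note Rc = symmetric_carrier[OF recentred_symmetric]
  show ?thesis
    unfolding form_bound_def
  proof
    fix f :: rvec assume f: "f \<in> carrier_vec p"
    show "\<bar>f \<bullet> ((recentred S - recentred S') *\<^sub>v f)\<bar> \<le> (1 - c / 2) * \<eta> * (f \<bullet> f)"
      using upper[OF S S' \<eta>(1) \<eta>' f] upper[OF S' S \<eta>' \<eta>(1) f] f Rc
      by (simp add: form_minus[where p = p] abs_le_iff)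
  qed
qed

lemma mat_inv_one: "mat_inv (1\<^sub>m p) = 1\<^sub>m p"
  by (rule mat_inv_eqI[where p = p]) auto

lemma T_one: "T (1\<^sub>m p) = scatter p n v (\<lambda>_. 1)"
  unfolding T_def mat_inv_one by (rule scatter_cong) (simp add: v unit)

lemma recentred_one: "recentred (1\<^sub>m p) = scatter p n v (\<lambda>_. 1)"
proof -
  have "mat_trace (scatter p n v (\<lambda>_. 1)) = real p / real n * (\<Sum>i<n. 1 * (v i \<bullet> v i))"
    by (rule mat_trace_scatter) (rule v)
  also have "\<dots> = real p" using n by (simp add: unit)
  finally have "mat_trace (scatter p n v (\<lambda>_. 1)) = real p" .
  then show ?thesis using p by (intro eq_matI) (auto simp: recentred_def T_one carrier_matD[OF scatter_carrier])
qed

text \<open>The centre of the ball is moved by at most \<open>t\<close>, and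
  \<open>t = c * d / 2\<close> is exactly what a contraction by \<open>1 - c / 2\<close> on a ball
  of radius \<open>d\<close> can absorb while mapping it into itself.\<close>

lemma fixed_point_exists:
  assumes d: "0 < d" "d \<le> c / 80" and t: "t = c * d / 2"
  shows "\<exists>S. symmetric p S \<and> form_bound p (S - 1\<^sub>m p) d \<and> mat_trace S = real p \<and> T S = S"
proof -
  define \<S> where "\<S> = {S. symmetric p S \<and> form_bound p (1\<^sub>m p - S) d \<and> mat_trace S = real p}"
  have SD: "symmetric p S" "form_bound p (S - 1\<^sub>m p) d" "form_bound p (1\<^sub>m p - S) d" "mat_trace S = real p"
    if "S \<in> \<S>" for S
    using that form_bound_commute[of "1\<^sub>m p" p S d] by (auto simp: \<S>_def dest: symmetric_carrier)
  have t160: "t \<le> c / 160"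
  proof -
    have "c * d \<le> 1 * d" using c d by (intro mult_right_mono) auto
    then show ?thesis using d t by linarith
  qed
  have oneS: "1\<^sub>m p \<in> \<S>"
    using d scalar_prod_self_nonneg by (simp add: \<S>_def symmetric_one mat_trace_one form_bound_def form_minus[where p = p])
  have "\<exists>S \<in> \<S>. recentred S = S"
  proof (rule matrix_contraction_fixpoint)
    show "symmetric p S" if "S \<in> \<S>" for S using SD[OF that] by simp
    show "S \<in> \<S>" if X: "\<And>k. X k \<in> \<S>" and S: "S \<in> carrier_mat p p"
      and lim: "\<And>i j. i < p \<Longrightarrow> j < p \<Longrightarrow> (\<lambda>k :: nat. X k $$ (i, j)) \<longlonglongrightarrow> S $$ (i, j)" for X S
    proof -
      note s = SD[OF X]
      have "(\<lambda>k. \<Sum>i<p. X k $$ (i, i)) \<longlonglongrightarrow> (\<Sum>i<p. S $$ (i, i))"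
        by (intro tendsto_sum lim) auto
      moreover have "(\<Sum>i<p. X k $$ (i, i)) = real p" for k
        using s(4)[of k] symmetric_carrier[OF s(1)[of k]] by (simp add: mat_trace_def)
      ultimately have "mat_trace S = real p"
        using S LIMSEQ_unique[OF _ tendsto_const[of "real p"]] by (auto simp: mat_trace_def)
      then show ?thesis
        using symmetric_limit[OF s(1) S lim]
          form_bound_limit[OF symmetric_carrier[OF s(1)] S _ lim, where B = "1\<^sub>m p" and d = d and N = 0] s(3)
        by (simp add: \<S>_def)
    qed
    show "recentred S \<in> \<S>" if "S \<in> \<S>" for S
    proof -
      note S = SD[OF that]
      note Rc = symmetric_carrier[OF recentred_symmetric]
      have "form_bound p (recentred (1\<^sub>m p) - recentred S) ((1 - c / 2) * d)"
        by (rule recentred_contraction[OF SD(1,2,4)[OF oneS] S(1,2,4) less_imp_le[OF d(1)] d(2) t160 S(3) d(1)])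
      moreover have "form_bound p (1\<^sub>m p - recentred (1\<^sub>m p)) t"
        unfolding recentred_one by (rule form_bound_commute[OF _ _ second]) auto
      ultimately have "form_bound p (1\<^sub>m p - recentred S) (t + (1 - c / 2) * d)"
        using form_bound_triangle[OF one_carrier_mat Rc Rc] by blast
      also have "t + (1 - c / 2) * d = d" using t by (simp add: algebra_simps)
      finally show ?thesis by (simp add: \<S>_def recentred_symmetric recentred_trace)
    qed
    show "1\<^sub>m p \<in> \<S>" by (rule oneS)
    show "0 < 1 - c / 2" "1 - c / 2 < 1" using c by auto
    show "form_bound p (recentred A - recentred B) ((1 - c / 2) * \<eta>)"
      if "A \<in> \<S>" "B \<in> \<S>" "0 < \<eta>" "form_bound p (A - B) \<eta>" for A B \<eta>
      using recentred_contraction[OF SD(1,2,4) SD(1,2,4) less_imp_le[OF d(1)] d(2) t160] that by auto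
  qed
  then obtain S where S: "S \<in> \<S>" "recentred S = S" by blast
  have "pos_def p S" using near_one_pos_def[OF SD(1,2)[OF S(1)]] d c by simp
  then show ?thesis using T_eq_if_recentred_eq S SD[OF S(1)] by blast
qed

end

section \<open>Uniqueness and the deterministic estimate\<close>

lemma tyler_solution_scatter:
  "tyler_solution p n x S \<longleftrightarrow> pos_def p S \<and> mat_trace S = real p \<and>
     scatter p n x (\<lambda>i. 1 / (x i \<bullet> (mat_inv S *\<^sub>v x i))) = S"
  by (auto simp: tyler_solution_def scatter_def)

text \<open>Inversion reverses the order. With \<open>S y = v\<close> and \<open>S' y' = v\<close>,
  Cauchy-Schwarz in the form of \<open>S'\<close> at \<open>y'\<close> and \<open>y\<close> bounds
  the square of \<open>v \<bullet> y\<close> by \<open>v \<bullet> y'\<close> times the form of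
  \<open>S'\<close> at \<open>y\<close>, and the hypothesis bounds the latter by
  \<open>l * (v \<bullet> y)\<close>.\<close>

lemma inverse_antimono:
  assumes S: "pos_def p S" and S': "pos_def p S'" and l: "0 < l"
    and le: "\<And>x. x \<in> carrier_vec p \<Longrightarrow> x \<bullet> (S' *\<^sub>v x) \<le> l * (x \<bullet> (S *\<^sub>v x))"
    and v: "v \<in> carrier_vec p"
  shows "v \<bullet> (mat_inv S *\<^sub>v v) \<le> l * (v \<bullet> (mat_inv S' *\<^sub>v v))"
proof (cases "v = 0\<^sub>v p")
  case True
  then show ?thesis
    using pos_def_inverse(1)[OF S] pos_def_inverse(1)[OF S'] by simp
next
  case False
  define y where "y = mat_inv S *\<^sub>v v"
  define y' where "y' = mat_inv S' *\<^sub>v v"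
  have y: "y \<in> carrier_vec p" "S *\<^sub>v y = v" and y': "y' \<in> carrier_vec p" "S' *\<^sub>v y' = v"
    using pos_def_inverse_vec[OF S v] pos_def_inverse_vec[OF S' v] by (auto simp: y_def y'_def)
  have pos: "0 < v \<bullet> y" "0 < v \<bullet> y'"
    using pos_def_gt[OF pos_def_mat_inv[OF S] v False] pos_def_gt[OF pos_def_mat_inv[OF S'] v False]
    by (auto simp: y_def y'_def)
  have "v \<bullet> y = y' \<bullet> (S' *\<^sub>v y)"
    using form_symmetric[OF pos_def_symmetric[OF S'] y'(1) y(1)] y'(2) by simp
  then have "(v \<bullet> y)\<^sup>2 \<le> (y' \<bullet> (S' *\<^sub>v y')) * (y \<bullet> (S' *\<^sub>v y))"
    using psd_Cauchy_Schwarz[OF pos_def_psd[OF S'] y'(1) y(1)] by simp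
  also have "\<dots> \<le> (v \<bullet> y') * (l * (v \<bullet> y))"
    using le[OF y(1)] y y' pos comm_scalar_prod[OF v y(1)] comm_scalar_prod[OF v y'(1)]
    by (simp add: mult_left_mono)
  finally have "(v \<bullet> y) * (v \<bullet> y) \<le> (l * (v \<bullet> y')) * (v \<bullet> y)"
    by (simp add: power2_eq_square mult_ac)
  then show ?thesis using pos by (simp add: y_def y'_def)
qed

lemma psd_kernel:
  assumes N: "psd p N" and x: "x \<in> carrier_vec p" and z: "x \<bullet> (N *\<^sub>v x) = 0"
  shows "N *\<^sub>v x = 0\<^sub>v p"
proof -
  have Nc: "N \<in> carrier_mat p p" using N by (auto simp: psd_def)
  have Nx: "N *\<^sub>v x \<in> carrier_vec p" using Nc x by simp
  have "((N *\<^sub>v x) \<bullet> (N *\<^sub>v x))\<^sup>2 \<le> 0"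
    using psd_Cauchy_Schwarz[OF N Nx x] z by simp
  then show ?thesis using vec_eq_zeroI[OF Nx] by simp
qed

text \<open>
  Take the least \<open>\<lambda>\<close> with \<open>S' \<le> \<lambda> S\<close> and a vector \<open>e\<close> where equality holds. Comparing the two
  equations along \<open>e\<close> forces every sample that is not orthogonal to \<open>e\<close> into the kernel of
  \<open>N = S'\<^sup>-\<^sup>1 - (\<lambda> S)\<^sup>-\<^sup>1 \<ge> 0\<close>, so \<open>N = 0\<close>.
\<close>

lemma tyler_solution_unique:
  assumes p: "1 \<le> p" and n: "0 < n"
    and x: "\<And>i. i < n \<Longrightarrow> x i \<in> carrier_vec p"
    and nz: "\<And>e f. e \<in> carrier_vec p \<Longrightarrow> f \<in> carrier_vec p \<Longrightarrow> e \<noteq> 0\<^sub>v p \<Longrightarrow> f \<noteq> 0\<^sub>v p \<Longrightarrow>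
      \<exists>i<n. x i \<bullet> e \<noteq> 0 \<and> x i \<bullet> f \<noteq> 0"
    and sol: "tyler_solution p n x S" "tyler_solution p n x S'"
  shows "S = S'"
proof -
  have S: "pos_def p S" "mat_trace S = real p" "scatter p n x (\<lambda>i. 1 / (x i \<bullet> (mat_inv S *\<^sub>v x i))) = S"
    and S': "pos_def p S'" "mat_trace S' = real p" "scatter p n x (\<lambda>i. 1 / (x i \<bullet> (mat_inv S' *\<^sub>v x i))) = S'"
    using sol by (auto simp: tyler_solution_scatter)
  note Sc = symmetric_carrier[OF pos_def_symmetric[OF S(1)]] and Sc' = symmetric_carrier[OF pos_def_symmetric[OF S'(1)]]
  obtain c where c: "c > 0" "\<And>x. x \<in> carrier_vec p \<Longrightarrow> c * (x \<bullet> x) \<le> x \<bullet> (S *\<^sub>v x)"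
    using pos_def_lower_bound[OF S(1)] by blast
  obtain m where m: "m > 0" "form_bound p S m" using form_bound_exists[OF Sc] by blast
  obtain m' where m': "m' > 0" "form_bound p S' m'" using form_bound_exists[OF Sc'] by blast
  define L where "L = {l. \<forall>x \<in> carrier_vec p. x \<bullet> (S' *\<^sub>v x) \<le> l * (x \<bullet> (S *\<^sub>v x))}"
  have L: "x \<bullet> (S' *\<^sub>v x) \<le> l * (x \<bullet> (S *\<^sub>v x))" if "l \<in> L" "x \<in> carrier_vec p" for l x
    using that by (simp add: L_def)
  have "m' / c \<in> L"
    unfolding L_def
  proof (intro CollectI ballI)
    fix y :: rvec assume y: "y \<in> carrier_vec p"
    have "y \<bullet> (S' *\<^sub>v y) \<le> m' * (y \<bullet> y)" using m' y by (auto simp: form_bound_def abs_le_iff)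
    also have "\<dots> \<le> m' / c * (y \<bullet> (S *\<^sub>v y))" using c(2)[OF y] c(1) m'(1) by (simp add: field_simps)
    finally show "y \<bullet> (S' *\<^sub>v y) \<le> m' / c * (y \<bullet> (S *\<^sub>v y))" .
  qed
  then have ne: "L \<noteq> {}" by blast
  have Spos: "0 < y \<bullet> (S *\<^sub>v y)" "0 < y \<bullet> (S' *\<^sub>v y)" if "y \<in> carrier_vec p" "y \<noteq> 0\<^sub>v p" for y
    using pos_def_gt[OF S(1) that] pos_def_gt[OF S'(1) that] by auto
  have lower: "(y \<bullet> (S' *\<^sub>v y)) / (y \<bullet> (S *\<^sub>v y)) \<le> l" if "l \<in> L" "y \<in> carrier_vec p" "y \<noteq> 0\<^sub>v p" for l y
    using L[OF that(1,2)] Spos[OF that(2,3)] by (simp add: field_simps)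
  define e0 where "e0 = (unit_vec p 0 :: rvec)"
  have e0: "e0 \<in> carrier_vec p" "e0 \<noteq> 0\<^sub>v p" using p by (auto simp: e0_def vec_eq_iff)
  have bdd: "bdd_below L" using lower[OF _ e0] by (rule bdd_belowI)
  define l where "l = Inf L"
  have linf: "(y \<bullet> (S' *\<^sub>v y)) / (y \<bullet> (S *\<^sub>v y)) \<le> l" if "y \<in> carrier_vec p" "y \<noteq> 0\<^sub>v p" for y
    unfolding l_def using lower that by (intro cInf_greatest ne) auto
  have l: "0 < l" using linf[OF e0] Spos[OF e0] by (meson divide_pos_pos order_less_le_trans)
  have le: "y \<bullet> (S' *\<^sub>v y) \<le> l * (y \<bullet> (S *\<^sub>v y))" if "y \<in> carrier_vec p" for y
  proof (cases "y = 0\<^sub>v p")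
    case True
    then show ?thesis using Sc Sc' by simp
  next
    case False
    with linf[OF that] Spos[OF that] show ?thesis by (simp add: field_simps)
  qed
  define D where "D = l \<cdot>\<^sub>m S - S'"
  have Dform: "y \<bullet> (D *\<^sub>v y) = l * (y \<bullet> (S *\<^sub>v y)) - y \<bullet> (S' *\<^sub>v y)" if "y \<in> carrier_vec p" for y
    using that Sc Sc' by (simp add: D_def form_minus[where p = p] form_smult[where p = p])
  have Ds: "symmetric p D"
    unfolding D_def by (intro symmetric_minus symmetric_smult pos_def_symmetric S S')
  \<comment> \<open>Minimality of \<open>l\<close>: a definite \<open>D\<close> would leave room to
    lower \<open>l\<close> by \<open>b / m\<close>, where \<open>m\<close> bounds \<open>S\<close>
    from above. Failure of definiteness provides the vector of contact \<open>e\<close>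
    directly.\<close>
  have "\<not> pos_def p D"
  proof
    assume "pos_def p D"
    then obtain b where b: "b > 0" "\<And>x. x \<in> carrier_vec p \<Longrightarrow> b * (x \<bullet> x) \<le> x \<bullet> (D *\<^sub>v x)"
      using pos_def_lower_bound by blast
    have "l - b / m \<in> L"
      unfolding L_def
    proof (intro CollectI ballI)
      fix y :: rvec assume y: "y \<in> carrier_vec p"
      have "y \<bullet> (S *\<^sub>v y) \<le> m * (y \<bullet> y)" using m y by (auto simp: form_bound_def abs_le_iff)
      then have "b / m * (y \<bullet> (S *\<^sub>v y)) \<le> b * (y \<bullet> y)" using b m by (simp add: field_simps)
      with b(2)[OF y] Dform[OF y] show "y \<bullet> (S' *\<^sub>v y) \<le> (l - b / m) * (y \<bullet> (S *\<^sub>v y))"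
        by (simp add: left_diff_distrib)
    qed
    then have "l \<le> l - b / m" unfolding l_def by (rule cInf_lower[OF _ bdd])
    then show False using divide_pos_pos[OF b(1) m(1)] by simp
  qed
  then obtain e where e: "e \<in> carrier_vec p" "e \<noteq> 0\<^sub>v p" "e \<bullet> (D *\<^sub>v e) \<le> 0"
    using Ds by (auto simp: pos_def_def symmetric_def not_less)
  then have De: "e \<bullet> (D *\<^sub>v e) = 0" using le[OF e(1)] Dform[OF e(1)] by simp
  define N where "N = mat_inv S' - (1 / l) \<cdot>\<^sub>m mat_inv S"
  note W = pos_def_mat_inv[OF S(1)] and W' = pos_def_mat_inv[OF S'(1)]
  have Ns: "symmetric p N"
    unfolding N_def by (intro symmetric_minus symmetric_smult pos_def_symmetric W W')
  note Nc = symmetric_carrier[OF Ns] and Wc = pos_def_inverse(1)[OF S(1)] and Wc' = pos_def_inverse(1)[OF S'(1)]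
  have Nform: "y \<bullet> (N *\<^sub>v y) = y \<bullet> (mat_inv S' *\<^sub>v y) - (y \<bullet> (mat_inv S *\<^sub>v y)) / l" if "y \<in> carrier_vec p" for y
    using that Wc Wc' by (simp add: N_def form_minus[where p = p] form_smult[where p = p])
  have anti: "y \<bullet> (mat_inv S *\<^sub>v y) \<le> l * (y \<bullet> (mat_inv S' *\<^sub>v y))" if "y \<in> carrier_vec p" for y
    by (rule inverse_antimono[OF S(1) S'(1) l le that])
  have N: "psd p N"
    unfolding psd_def
  proof (intro conjI ballI Ns)
    fix y :: rvec assume y: "y \<in> carrier_vec p"
    show "0 \<le> y \<bullet> (N *\<^sub>v y)" unfolding Nform[OF y] using anti[OF y] l by (simp add: field_simps)
  qed
  have kernel: "N *\<^sub>v x i = 0\<^sub>v p" if i: "i < n" "x i \<bullet> e \<noteq> 0" for i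
  proof -
    let ?a = "\<lambda>i. x i \<bullet> (mat_inv S *\<^sub>v x i)" and ?b = "\<lambda>i. x i \<bullet> (mat_inv S' *\<^sub>v x i)"
    let ?g = "\<lambda>i. (l / ?a i - 1 / ?b i) * (x i \<bullet> e)\<^sup>2"
    have ab: "0 \<le> ?g j" if "j < n" for j
    \<comment> \<open>The hypotheses allow zero samples; their terms vanish through the inner
      product with \<open>e\<close>, whatever the weights are.\<close>
    proof (cases "x j = 0\<^sub>v p")
      case True
      then show ?thesis using e by simp
    next
      case False
      have "0 < ?a j" "0 < ?b j"
        using pos_def_gt[OF W x[OF that] False] pos_def_gt[OF W' x[OF that] False] by auto
      then have "0 \<le> l / ?a j - 1 / ?b j" using anti[OF x[OF that]] by (simp add: field_simps)
      then show ?thesis by simp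
    qed
    have sf: "e \<bullet> (scatter p n x w *\<^sub>v e) = real p / real n * (\<Sum>i<n. w i * (x i \<bullet> e) * (x i \<bullet> e))" for w
      by (rule scatter_form) (use x e in auto)
    have "0 = l * (e \<bullet> (S *\<^sub>v e)) - e \<bullet> (S' *\<^sub>v e)" using De Dform[OF e(1)] by simp
    also have "\<dots> = real p / real n * (\<Sum>i<n. ?g i)"
      using sf[of "\<lambda>i. 1 / ?a i"] sf[of "\<lambda>i. 1 / ?b i"] unfolding S(3) S'(3)
      by (simp add: sum_distrib_left sum_subtractf left_diff_distrib right_diff_distrib power2_eq_square mult_ac)
    finally have "(\<Sum>i<n. ?g i) = 0" using p n by simp
    then have "?g i = 0" using ab i by (subst (asm) sum_nonneg_eq_0_iff) auto
    then have g: "l / ?a i = 1 / ?b i" using i by simp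
    have "x i \<noteq> 0\<^sub>v p" using i e by auto
    then have "0 < ?a i" "0 < ?b i"
      using pos_def_gt[OF W x[OF i(1)]] pos_def_gt[OF W' x[OF i(1)]] by auto
    with g l have "?b i = ?a i / l" by (simp add: field_simps)
    then have "x i \<bullet> (N *\<^sub>v x i) = 0" using Nform[OF x[OF i(1)]] by simp
    then show ?thesis by (rule psd_kernel[OF N x[OF i(1)]])
  qed
  \<comment> \<open>A nonzero image of \<open>g\<close> under \<open>N\<close>, paired with
    \<open>e\<close>, would be met by a sample not orthogonal to \<open>e\<close>; but
    \<open>N\<close> annihilates such a sample, and symmetry moves \<open>N\<close> onto it.\<close>
  have N0: "N *\<^sub>v g = 0\<^sub>v p" if g: "g \<in> carrier_vec p" for g
  proof (rule ccontr)
    assume "N *\<^sub>v g \<noteq> 0\<^sub>v p"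
    moreover have Ng: "N *\<^sub>v g \<in> carrier_vec p" using Nc g by simp
    ultimately obtain i where i: "i < n" "x i \<bullet> e \<noteq> 0" "x i \<bullet> (N *\<^sub>v g) \<noteq> 0"
      using nz[OF e(1) _ e(2)] by blast
    have "x i \<bullet> (N *\<^sub>v g) = (N *\<^sub>v x i) \<bullet> g" by (rule form_symmetric[OF Ns x[OF i(1)] g])
    then show False using kernel[OF i(1,2)] i(3) g by simp
  qed
  have "mat_inv S' = (1 / l) \<cdot>\<^sub>m mat_inv S"
  proof (rule eq_matI)
    fix i j assume "i < dim_row ((1 / l) \<cdot>\<^sub>m mat_inv S)" "j < dim_col ((1 / l) \<cdot>\<^sub>m mat_inv S)"
    then have ij: "i < p" "j < p" using Wc by auto
    have "N $$ (i, j) = 0"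
      using unit_vec_form[OF Nc ij] N0[of "unit_vec p j"] by simp
    then show "mat_inv S' $$ (i, j) = ((1 / l) \<cdot>\<^sub>m mat_inv S) $$ (i, j)"
      using ij Wc Wc' by (simp add: N_def)
  qed (use Wc Wc' in auto)
  note inv_eq = this
  have "S = (1 / l) \<cdot>\<^sub>m S'"
  proof (rule mat_eq_vecI[OF Sc])
    fix y :: rvec assume y: "y \<in> carrier_vec p"
    have Sy: "S *\<^sub>v y \<in> carrier_vec p" using Sc y by simp
    have "mat_inv S' *\<^sub>v (S *\<^sub>v y) = (1 / l) \<cdot>\<^sub>v y"
      unfolding inv_eq smult_mat_mult_vec[OF Wc Sy] pos_def_inverse_vec(3)[OF S(1) y] ..
    then have "S *\<^sub>v y = S' *\<^sub>v ((1 / l) \<cdot>\<^sub>v y)"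
      using pos_def_inverse_vec(2)[OF S'(1) Sy] by simp
    then show "S *\<^sub>v y = ((1 / l) \<cdot>\<^sub>m S') *\<^sub>v y"
      using mult_mat_vec[OF Sc' y] smult_mat_mult_vec[OF Sc' y] by simp
  qed (use Sc' in auto)
  moreover from this have "1 / l * real p = real p"
    using mat_trace_smult[OF Sc', of "1 / l"] S(2) S'(2) by metis
  then have "1 / l = 1" using p l by (simp add: field_simps)
  ultimately have "S = 1 \<cdot>\<^sub>m S'" by simp
  also have "\<dots> = S'" by (intro eq_matI) auto
  finally show ?thesis .
qed

section \<open>Change of coordinates by a positive definite matrix\<close>

lemma scatter_conjugate:
  assumes v: "\<And>i. i < n \<Longrightarrow> v i \<in> carrier_vec p" and R: "symmetric p R"
  shows "R * scatter p n v w * R = scatter p n (\<lambda>i. R *\<^sub>v v i) w"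
proof (rule eq_matI)
  note Rc = symmetric_carrier[OF R]
  let ?M = "scatter p n v w"
  have Mc: "?M \<in> carrier_mat p p" by simp
  fix a b assume "a < dim_row (scatter p n (\<lambda>i. R *\<^sub>v v i) w)" "b < dim_col (scatter p n (\<lambda>i. R *\<^sub>v v i) w)"
  then have ab: "a < p" "b < p" by (auto simp: scatter_def)
  let ?a = "unit_vec p a :: rvec" and ?b = "unit_vec p b :: rvec"
  have Rab: "R *\<^sub>v ?a \<in> carrier_vec p" "R *\<^sub>v ?b \<in> carrier_vec p" using Rc by auto
  have vR: "v i \<bullet> (R *\<^sub>v unit_vec p k) = (R *\<^sub>v v i) $ k" if "i < n" "k < p" for i k
    using form_symmetric[OF R v[OF that(1)], of "unit_vec p k"] that Rc v[OF that(1)] by simp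
  have "(R * ?M * R) $$ (a, b) = ?a \<bullet> ((R * ?M * R) *\<^sub>v ?b)"
    by (rule unit_vec_form[symmetric]) (use Rc ab in auto)
  also have "(R * ?M * R) *\<^sub>v ?b = R *\<^sub>v (?M *\<^sub>v (R *\<^sub>v ?b))"
    using assoc_mult_mat_vec[of "R * ?M" p p R p ?b] assoc_mult_mat_vec[OF Rc Mc Rab(2)] Rc by simp
  also have "?a \<bullet> (R *\<^sub>v (?M *\<^sub>v (R *\<^sub>v ?b))) = (R *\<^sub>v ?a) \<bullet> (?M *\<^sub>v (R *\<^sub>v ?b))"
    by (rule form_symmetric[OF R]) (use Rab in auto)
  also have "\<dots> = real p / real n * (\<Sum>i<n. w i * (v i \<bullet> (R *\<^sub>v ?a)) * (v i \<bullet> (R *\<^sub>v ?b)))"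
    by (rule scatter_form) (use v Rab in auto)
  also have "\<dots> = scatter p n (\<lambda>i. R *\<^sub>v v i) w $$ (a, b)"
    using ab vR by (simp add: scatter_def mult_ac)
  finally show "(R * ?M * R) $$ (a, b) = scatter p n (\<lambda>i. R *\<^sub>v v i) w $$ (a, b)" .
qed (use symmetric_carrier[OF R] in \<open>auto simp: scatter_def\<close>)

lemma pos_def_smult: "pos_def p A \<Longrightarrow> 0 < s \<Longrightarrow> pos_def p (s \<cdot>\<^sub>m A)"
  using symmetric_smult[OF pos_def_symmetric, of p A s]
  by (auto simp: pos_def_def symmetric_def form_smult[where p = p])

lemma conj_vec:
  assumes "R \<in> carrier_mat p p" "A \<in> carrier_mat p p" "(x :: rvec) \<in> carrier_vec p"
  shows "(R * A * R) *\<^sub>v x = R *\<^sub>v (A *\<^sub>v (R *\<^sub>v x))"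
  using assoc_mult_mat_vec[of "R * A" p p R p x] assoc_mult_mat_vec[of R p p A p "R *\<^sub>v x"] assms by simp

lemma pos_def_conjugate:
  assumes R: "pos_def p R" and A: "pos_def p A"
  shows "pos_def p (R * A * R)"
proof -
  note Rs = pos_def_symmetric[OF R] and As = pos_def_symmetric[OF A]
  note Rc = symmetric_carrier[OF Rs] and Ac = symmetric_carrier[OF As]
  have form: "x \<bullet> ((R * A * R) *\<^sub>v y) = (R *\<^sub>v x) \<bullet> (A *\<^sub>v (R *\<^sub>v y))"
    if "x \<in> carrier_vec p" "y \<in> carrier_vec p" for x y
    using that conj_vec[OF Rc Ac that(2)] form_symmetric[OF Rs that(1), of "A *\<^sub>v (R *\<^sub>v y)"] Rc Ac by simp
  have c: "R * A * R \<in> carrier_mat p p" using Rc Ac by simp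
  have "symmetric p (R * A * R)"
  proof (rule symmetricI[OF c])
    fix i j assume ij: "i < p" "j < p"
    show "(R * A * R) $$ (i, j) = (R * A * R) $$ (j, i)"
      using form[of "unit_vec p i" "unit_vec p j"] form[of "unit_vec p j" "unit_vec p i"]
        form_commute[OF As, of "R *\<^sub>v unit_vec p i" "R *\<^sub>v unit_vec p j"] Rc
      unfolding unit_vec_form[OF c ij] unit_vec_form[OF c ij(2,1)] by simp
  qed
  moreover have "0 < x \<bullet> ((R * A * R) *\<^sub>v x)" if x: "x \<in> carrier_vec p" "x \<noteq> 0\<^sub>v p" for x
  proof -
    have "R *\<^sub>v x \<noteq> 0\<^sub>v p" using pos_def_gt[OF R x] x by auto
    then show ?thesis using pos_def_gt[OF A, of "R *\<^sub>v x"] form[OF x(1) x(1)] Rc x by simp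
  qed
  ultimately show ?thesis by (simp add: pos_def_def symmetric_def)
qed

lemma mat_inv_conjugate:
  assumes R: "pos_def p R" and A: "pos_def p A" and s: "0 < s"
  shows "mat_inv (s \<cdot>\<^sub>m (R * A * R)) = (1 / s) \<cdot>\<^sub>m (mat_inv R * mat_inv A * mat_inv R)"
proof (rule mat_inv_eqI[where p = p])
  note Ri = pos_def_inverse[OF R] and Ai = pos_def_inverse[OF A]
  have Rc: "R \<in> carrier_mat p p" and Ac: "A \<in> carrier_mat p p" using R A by (auto simp: pos_def_def)
  show c1: "s \<cdot>\<^sub>m (R * A * R) \<in> carrier_mat p p" using Rc Ac by simp
  show c2: "(1 / s) \<cdot>\<^sub>m (mat_inv R * mat_inv A * mat_inv R) \<in> carrier_mat p p" using Ri Ai by simp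
  show "s \<cdot>\<^sub>m (R * A * R) * ((1 / s) \<cdot>\<^sub>m (mat_inv R * mat_inv A * mat_inv R)) = 1\<^sub>m p"
  proof (rule mat_eq_vecI[where p = p])
    fix x :: rvec assume x: "x \<in> carrier_vec p"
    let ?y = "mat_inv R *\<^sub>v (mat_inv A *\<^sub>v (mat_inv R *\<^sub>v x))"
    note iR = pos_def_inverse_vec[OF R] and iA = pos_def_inverse_vec[OF A]
    have y: "?y \<in> carrier_vec p" using iR iA x by simp
    have "(s \<cdot>\<^sub>m (R * A * R) * ((1 / s) \<cdot>\<^sub>m (mat_inv R * mat_inv A * mat_inv R))) *\<^sub>v x =
        s \<cdot>\<^sub>m (R * A * R) *\<^sub>v ((1 / s) \<cdot>\<^sub>v ?y)"
      using assoc_mult_mat_vec[OF c1 c2 x] conj_vec[OF Ri(1) Ai(1) x] Ri Ai x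
      by (simp add: smult_mat_mult_vec[where n = p and m = p])
    also have "\<dots> = (1 / s) \<cdot>\<^sub>v (s \<cdot>\<^sub>v ((R * A * R) *\<^sub>v ?y))"
      using mult_mat_vec[OF c1 y] Rc Ac y by (simp add: smult_mat_mult_vec[where n = p and m = p])
    also have "(R * A * R) *\<^sub>v ?y = x"
      using conj_vec[OF Rc Ac y] iR iA x by simp
    also have "(1 / s) \<cdot>\<^sub>v (s \<cdot>\<^sub>v x) = 1\<^sub>m p *\<^sub>v x"
      using s x by (intro eq_vecI) auto
    finally show "(s \<cdot>\<^sub>m (R * A * R) * ((1 / s) \<cdot>\<^sub>m (mat_inv R * mat_inv A * mat_inv R))) *\<^sub>v x = 1\<^sub>m p *\<^sub>v x" .
  qed (use c1 c2 in auto)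
qed

lemma frobenius_norm_le:
  assumes A: "A \<in> carrier_mat p p" and b: "0 \<le> b"
    and le: "\<And>j. j < p \<Longrightarrow> euclid_norm (A *\<^sub>v unit_vec p j) \<le> b"
  shows "frobenius_norm A \<le> b * sqrt (real p)"
proof -
  have "(\<Sum>i<p. (A $$ (i, j))\<^sup>2) \<le> b\<^sup>2" if j: "j < p" for j
  proof -
    have "(A *\<^sub>v unit_vec p j) \<bullet> (A *\<^sub>v unit_vec p j) \<le> b\<^sup>2"
      unfolding euclid_norm_square[symmetric] by (intro power_mono le j) simp
    moreover have "(A *\<^sub>v unit_vec p j) \<bullet> (A *\<^sub>v unit_vec p j) = (\<Sum>i<p. (A $$ (i, j))\<^sup>2)"
      using A j by (subst scalar_prod_self_sum[where p = p]) auto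
    ultimately show ?thesis by simp
  qed
  then have "(\<Sum>j<p. \<Sum>i<p. (A $$ (i, j))\<^sup>2) \<le> (\<Sum>j<p. b\<^sup>2)" by (intro sum_mono) auto
  also have "(\<Sum>j<p. \<Sum>i<p. (A $$ (i, j))\<^sup>2) = (\<Sum>i<p. \<Sum>j<p. (A $$ (i, j))\<^sup>2)" by (rule sum.swap)
  finally have "(\<Sum>i<p. \<Sum>j<p. (A $$ (i, j))\<^sup>2) \<le> real p * b\<^sup>2" by simp
  then have "frobenius_norm A \<le> sqrt (real p * b\<^sup>2)"
    using A by (auto simp: frobenius_norm_def)
  also have "\<dots> = b * sqrt (real p)" using b by (simp add: real_sqrt_mult)
  finally show ?thesis .
qed

text \<open>Tyler's equation is equivariant under linear maps, and the square of a radial factor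
  cancels between numerator and quadratic form. So \<open>R * S0 * R\<close>, with \<open>S0\<close>
  the fixed point for the directions, solves the equation for the samples once its trace is rescaled
  to \<open>p\<close>. Conversely \<open>R * mat_inv S * R\<close> is \<open>\<tau>\<close> times
  \<open>mat_inv S0\<close>, and each of its \<open>p\<close> columns is compared with a unit
  vector, which accounts for \<open>sqrt (real p)\<close>.\<close>

lemma tyler_estimate:
  fixes x :: "nat \<Rightarrow> rvec" and v :: "nat \<Rightarrow> rvec" and u :: "nat \<Rightarrow> real"
  assumes \<Sigma>: "pos_def p \<Sigma>" "mat_trace \<Sigma> = real p"
    and sample: "tyler_sample p n v c t"
    and d: "0 < d" "d \<le> c / 80" "t = c * d / 2"
    and u: "\<And>i. i < n \<Longrightarrow> u i \<noteq> 0"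
    and x: "\<And>i. i < n \<Longrightarrow> x i = u i \<cdot>\<^sub>v (mat_sqrt \<Sigma> *\<^sub>v v i)"
  shows "tyler_exists p n x"
    and "frobenius_norm (1\<^sub>m p - mat_sqrt \<Sigma> * mat_inv (tyler p n x) * mat_sqrt \<Sigma>) \<le> 4 * d * sqrt (real p)"
proof -
  interpret tyler_sample p n v c t by (rule sample)
  define R where "R = mat_sqrt \<Sigma>"
  have R: "pos_def p R" "R * R = \<Sigma>" using mat_sqrt_pos_def[OF \<Sigma>(1)] by (auto simp: R_def)
  note Rs = pos_def_symmetric[OF R(1)]
  note Rc = symmetric_carrier[OF Rs] and Ri = pos_def_inverse[OF R(1)] and Riv = pos_def_inverse_vec[OF R(1)]
  obtain S0 where S0: "symmetric p S0" "form_bound p (S0 - 1\<^sub>m p) d" "mat_trace S0 = real p" "T S0 = S0"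
    using fixed_point_exists[OF d] by blast
  have d4: "d \<le> 1 / 4" using d c by linarith
  have S0pd: "pos_def p S0" using near_one_pos_def[OF S0(1,2)] d4 by simp
  note S0c = symmetric_carrier[OF S0(1)] and W = pos_def_inverse[OF S0pd]
  have conjpd: "pos_def p (R * S0 * R)" by (rule pos_def_conjugate[OF R(1) S0pd])
  have conjc: "R * S0 * R \<in> carrier_mat p p" using conjpd by (simp add: pos_def_def)
  define \<tau> where "\<tau> = mat_trace (R * S0 * R) / real p"
  \<comment> \<open>The columns of \<open>R\<close> have total squared length \<open>p\<close>, the
    trace of \<open>\<Sigma>\<close>, so replacing the identity by \<open>S0\<close> between two
    copies of \<open>R\<close> changes the trace by at most \<open>d * p\<close>.\<close>
  have \<tau>: "\<bar>\<tau> - 1\<bar> \<le> d"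
  proof -
    let ?r = "\<lambda>j. R *\<^sub>v unit_vec p j :: rvec"
    have r: "?r j \<in> carrier_vec p" for j using Rc by simp
    have "R * 1\<^sub>m p * R = \<Sigma>" using R Rc by simp
    then have tr: "real p = (\<Sum>j<p. ?r j \<bullet> (1\<^sub>m p *\<^sub>v ?r j))"
      using mat_trace_sandwich[OF Rs one_carrier_mat] \<Sigma>(2) by simp
    then have "mat_trace (R * S0 * R) - real p = (\<Sum>j<p. ?r j \<bullet> ((S0 - 1\<^sub>m p) *\<^sub>v ?r j))"
      unfolding mat_trace_sandwich[OF Rs S0c] using r S0c
      by (simp add: form_minus[where p = p] sum_subtractf)
    also have "\<bar>\<dots>\<bar> \<le> (\<Sum>j<p. d * (?r j \<bullet> ?r j))"
      using S0(2) r by (intro order_trans[OF sum_abs] sum_mono) (auto simp: form_bound_def)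
    also have "\<dots> = d * real p" using tr r by (simp add: sum_distrib_left)
    finally show ?thesis using p by (simp add: \<tau>_def field_simps abs_le_iff)
  qed
  have \<tau>0: "0 < \<tau>" using \<tau> d4 by linarith
  define S where "S = (1 / \<tau>) \<cdot>\<^sub>m (R * S0 * R)"
  have Spd: "pos_def p S" unfolding S_def using \<tau>0 by (intro pos_def_smult conjpd) simp
  have Sinv: "mat_inv S = \<tau> \<cdot>\<^sub>m (mat_inv R * mat_inv S0 * mat_inv R)"
    unfolding S_def using mat_inv_conjugate[OF R(1) S0pd, of "1 / \<tau>"] \<tau>0 by simp
  have xc: "x i \<in> carrier_vec p" if "i < n" for i
    using that x v Rc by (simp add: R_def[symmetric])
  have q: "x i \<bullet> (mat_inv S *\<^sub>v x i) = \<tau> * ((u i)\<^sup>2 * (v i \<bullet> (mat_inv S0 *\<^sub>v v i)))" if i: "i < n" for i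
  proof -
    have Rix: "mat_inv R *\<^sub>v x i = u i \<cdot>\<^sub>v v i"
      using x[OF i] mult_mat_vec[OF Ri(1), of "R *\<^sub>v v i" "u i"] Riv[OF v[OF i]] Rc v[OF i] by (simp add: R_def[symmetric])
    have "x i \<bullet> (mat_inv S *\<^sub>v x i) = \<tau> * (x i \<bullet> ((mat_inv R * mat_inv S0 * mat_inv R) *\<^sub>v x i))"
      unfolding Sinv by (rule form_smult) (use Ri W xc[OF i] in auto)
    also have "(mat_inv R * mat_inv S0 * mat_inv R) *\<^sub>v x i = mat_inv R *\<^sub>v (mat_inv S0 *\<^sub>v (u i \<cdot>\<^sub>v v i))"
      using conj_vec[OF Ri(1) W(1) xc[OF i]] Rix by simp
    also have "x i \<bullet> \<dots> = (u i \<cdot>\<^sub>v v i) \<bullet> (mat_inv S0 *\<^sub>v (u i \<cdot>\<^sub>v v i))"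
      using form_symmetric[OF pos_def_symmetric[OF pos_def_mat_inv[OF R(1)]] xc[OF i],
          of "mat_inv S0 *\<^sub>v (u i \<cdot>\<^sub>v v i)"] Rix W(1) v[OF i] by simp
    also have "\<dots> = (u i)\<^sup>2 * (v i \<bullet> (mat_inv S0 *\<^sub>v v i))"
      using mult_mat_vec[OF W(1) v[OF i]] v[OF i] W(1) by (simp add: power2_eq_square)
    finally show ?thesis .
  qed
  have "scatter p n x (\<lambda>i. 1 / (x i \<bullet> (mat_inv S *\<^sub>v x i))) =
      (1 / \<tau>) \<cdot>\<^sub>m scatter p n (\<lambda>i. R *\<^sub>v v i) (\<lambda>i. 1 / (v i \<bullet> (mat_inv S0 *\<^sub>v v i)))"
  proof (rule eq_matI)
    fix a b
    assume "a < dim_row ((1 / \<tau>) \<cdot>\<^sub>m scatter p n (\<lambda>i. R *\<^sub>v v i) (\<lambda>i. 1 / (v i \<bullet> (mat_inv S0 *\<^sub>v v i))))"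
      and "b < dim_col ((1 / \<tau>) \<cdot>\<^sub>m scatter p n (\<lambda>i. R *\<^sub>v v i) (\<lambda>i. 1 / (v i \<bullet> (mat_inv S0 *\<^sub>v v i))))"
    then have ab: "a < p" "b < p" by (auto simp: scatter_def)
    have xa: "x i $ k = u i * (R *\<^sub>v v i) $ k" if "i < n" "k < p" for i k
      using that x[OF that(1)] Rc by (simp add: R_def[symmetric])
    have "x i $ a * x i $ b * (1 / (x i \<bullet> (mat_inv S *\<^sub>v x i))) =
        1 / \<tau> * ((R *\<^sub>v v i) $ a * (R *\<^sub>v v i) $ b * (1 / (v i \<bullet> (mat_inv S0 *\<^sub>v v i))))" if "i < n" for i
      unfolding q[OF that] xa[OF that ab(1)] xa[OF that ab(2)]
      using u[OF that] by (simp add: power2_eq_square field_simps)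
    then have "(\<Sum>i<n. x i $ a * x i $ b * (1 / (x i \<bullet> (mat_inv S *\<^sub>v x i)))) =
        1 / \<tau> * (\<Sum>i<n. (R *\<^sub>v v i) $ a * (R *\<^sub>v v i) $ b * (1 / (v i \<bullet> (mat_inv S0 *\<^sub>v v i))))"
      unfolding sum_distrib_left by (intro sum.cong refl) auto
    then show "scatter p n x (\<lambda>i. 1 / (x i \<bullet> (mat_inv S *\<^sub>v x i))) $$ (a, b) =
        ((1 / \<tau>) \<cdot>\<^sub>m scatter p n (\<lambda>i. R *\<^sub>v v i) (\<lambda>i. 1 / (v i \<bullet> (mat_inv S0 *\<^sub>v v i)))) $$ (a, b)"
      using ab by (simp add: scatter_def del: index_mult_mat_vec)
  qed (auto simp: scatter_def)
  also have "\<dots> = (1 / \<tau>) \<cdot>\<^sub>m (R * T S0 * R)"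
    unfolding T_def by (subst scatter_conjugate[OF v Rs]) auto
  finally have "scatter p n x (\<lambda>i. 1 / (x i \<bullet> (mat_inv S *\<^sub>v x i))) = S" by (simp add: S0(4) S_def)
  moreover have "mat_trace S = real p"
  proof -
    have "mat_trace (R * S0 * R) = \<tau> * real p" using p by (simp add: \<tau>_def)
    then show ?thesis unfolding S_def mat_trace_smult[OF conjc] using \<tau>0 by simp
  qed
  ultimately have sol: "tyler_solution p n x S" using Spd by (simp add: tyler_solution_scatter)
  \<comment> \<open>Strict positivity in \<open>cross\<close>, carried over by \<open>R\<close>,
    supplies the nonorthogonality that uniqueness requires.\<close>
  have nz: "\<exists>i<n. x i \<bullet> e \<noteq> 0 \<and> x i \<bullet> f \<noteq> 0"
    if e: "e \<in> carrier_vec p" "e \<noteq> 0\<^sub>v p" and f: "f \<in> carrier_vec p" "f \<noteq> 0\<^sub>v p" for e f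
  proof -
    have R0: "R *\<^sub>v g \<in> carrier_vec p" "0 < (R *\<^sub>v g) \<bullet> (R *\<^sub>v g)" if "g \<in> carrier_vec p" "g \<noteq> 0\<^sub>v p" for g
    proof -
      show "R *\<^sub>v g \<in> carrier_vec p" using Rc that by simp
      moreover have "R *\<^sub>v g \<noteq> 0\<^sub>v p" using pos_def_gt[OF R(1) that] that by auto
      ultimately show "0 < (R *\<^sub>v g) \<bullet> (R *\<^sub>v g)" by (rule scalar_prod_self_pos)
    qed
    have xv: "x i \<bullet> g = u i * (v i \<bullet> (R *\<^sub>v g))" if "i < n" "g \<in> carrier_vec p" for i g
      using x[OF that(1)] form_symmetric[OF Rs v[OF that(1)] that(2)] that Rc v[OF that(1)] by (simp add: R_def[symmetric])
    have "0 < c / real p * ((R *\<^sub>v e) \<bullet> (R *\<^sub>v e)) * ((R *\<^sub>v f) \<bullet> (R *\<^sub>v f))"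
      using R0[OF e] R0[OF f] c p by simp
    also have "\<dots> \<le> real p / real n * (\<Sum>i<n. (v i \<bullet> (R *\<^sub>v e))\<^sup>2 * (v i \<bullet> (R *\<^sub>v f))\<^sup>2)"
      by (rule cross[OF R0(1)[OF e] R0(1)[OF f]])
    finally have "(\<Sum>i<n. (v i \<bullet> (R *\<^sub>v e))\<^sup>2 * (v i \<bullet> (R *\<^sub>v f))\<^sup>2) \<noteq> 0" by auto
    then obtain i where "i < n" "(v i \<bullet> (R *\<^sub>v e))\<^sup>2 * (v i \<bullet> (R *\<^sub>v f))\<^sup>2 \<noteq> 0"
      by (rule sum.not_neutral_contains_not_neutral) auto
    then show ?thesis using xv u e f by (intro exI[of _ i]) auto
  qed
  have uniq: "S' = S" if "tyler_solution p n x S'" for S'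
    using tyler_solution_unique[OF p n xc _ that sol] nz by blast
  show "tyler_exists p n x" unfolding tyler_exists_def using sol uniq by blast
  have "tyler p n x = S" unfolding tyler_def using sol uniq by (rule the_equality)
  moreover have RSR: "R * mat_inv S * R = \<tau> \<cdot>\<^sub>m mat_inv S0"
  proof (rule mat_eq_vecI[where p = p])
    have Sic: "mat_inv S \<in> carrier_mat p p" by (rule pos_def_inverse(1)[OF Spd])
    show "R * mat_inv S * R \<in> carrier_mat p p" "\<tau> \<cdot>\<^sub>m mat_inv S0 \<in> carrier_mat p p"
      using Sic Rc W by auto
    fix y :: rvec assume y: "y \<in> carrier_vec p"
    have Ry: "R *\<^sub>v y \<in> carrier_vec p" using Rc y by simp
    have Wy: "mat_inv S0 *\<^sub>v y \<in> carrier_vec p" using W y by simp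
    have "mat_inv S *\<^sub>v (R *\<^sub>v y) = \<tau> \<cdot>\<^sub>v (mat_inv R *\<^sub>v (mat_inv S0 *\<^sub>v y))"
      unfolding Sinv using conj_vec[OF Ri(1) W(1) Ry] Riv[OF y] Ri W Ry
      by (simp add: smult_mat_mult_vec[where n = p and m = p])
    then have "R *\<^sub>v (mat_inv S *\<^sub>v (R *\<^sub>v y)) = \<tau> \<cdot>\<^sub>v (mat_inv S0 *\<^sub>v y)"
      using mult_mat_vec[OF Rc, of "mat_inv R *\<^sub>v (mat_inv S0 *\<^sub>v y)" \<tau>] Riv[OF Wy] by simp
    then show "(R * mat_inv S * R) *\<^sub>v y = (\<tau> \<cdot>\<^sub>m mat_inv S0) *\<^sub>v y"
      using conj_vec[OF Rc Sic y] smult_mat_mult_vec[OF W(1) y] by simp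
  qed
  moreover have "frobenius_norm (1\<^sub>m p - \<tau> \<cdot>\<^sub>m mat_inv S0) \<le> 4 * d * sqrt (real p)"
  proof (rule frobenius_norm_le)
    fix j assume j: "j < p"
    let ?e = "unit_vec p j :: rvec"
    let ?y = "mat_inv S0 *\<^sub>v ?e"
    have e: "?e \<in> carrier_vec p" "?e \<bullet> ?e = 1" using j by auto
    note near = near_one_inverse[OF S0(1,2) less_imp_le[OF d(1)] d4 e]
    have yc: "?y \<in> carrier_vec p" using W by simp
    \<comment> \<open>Two errors, each at most \<open>d / (1 - d)\<close>: \<open>mat_inv S0\<close>
      differs from the identity, and \<open>\<tau>\<close> differs from one.\<close>
    have "(1\<^sub>m p - \<tau> \<cdot>\<^sub>m mat_inv S0) *\<^sub>v ?e = (?e - ?y) + (1 - \<tau>) \<cdot>\<^sub>v ?y"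
      using W mat_minus_mult_vec[OF one_carrier_mat, of "\<tau> \<cdot>\<^sub>m mat_inv S0" p ?e]
        smult_mat_mult_vec[OF W(1) e(1), of \<tau>] j
      by (intro eq_vecI) (auto simp: algebra_simps)
    then have "euclid_norm ((1\<^sub>m p - \<tau> \<cdot>\<^sub>m mat_inv S0) *\<^sub>v ?e) \<le> euclid_norm (?e - ?y) + \<bar>1 - \<tau>\<bar> * euclid_norm ?y"
      using euclid_norm_add[of "?e - ?y" p "(1 - \<tau>) \<cdot>\<^sub>v ?y"] yc by (simp add: euclid_norm_smult)
    also have "\<dots> \<le> d / (1 - d) + d * (1 / (1 - d))"
      using near \<tau> d by (intro add_mono mult_mono) auto
    also have "\<dots> \<le> 4 * d"
    proof -
      have "1 / (1 - d) \<le> 2" using d4 by (simp add: field_simps)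
      then have "d * (1 / (1 - d)) \<le> d * 2" using d(1) by (intro mult_left_mono) auto
      then show ?thesis by simp
    qed
    finally show "euclid_norm ((1\<^sub>m p - \<tau> \<cdot>\<^sub>m mat_inv S0) *\<^sub>v ?e) \<le> 4 * d" .
  qed (use W d in auto)
  ultimately show "frobenius_norm (1\<^sub>m p - mat_sqrt \<Sigma> * mat_inv (tyler p n x) * mat_sqrt \<Sigma>) \<le> 4 * d * sqrt (real p)"
    by (simp add: R_def[symmetric])
qed

section \<open>The uniform distribution on the sphere and Gaussian vectors\<close>

lemma space_vec_borel [simp]: "space (vec_borel p) = carrier_vec p"
  by (simp add: vec_borel_def)

lemma measurable_vec_borel_index [measurable]:
  assumes "i < p"
  shows "(\<lambda>v. v $ i) \<in> borel_measurable (vec_borel p)"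
proof -
  have "(\<lambda>v. \<lambda>i\<in>{..<p}. v $ i) \<in> measurable (vec_borel p) (\<Pi>\<^sub>M i\<in>{..<p}. borel :: real measure)"
    unfolding vec_borel_def by (rule measurable_vimage_algebra1) (auto simp: space_PiM)
  from measurable_compose[OF this measurable_component_singleton[of i]]
  show ?thesis using assms by simp
qed

lemma measurable_vec_borelI:
  assumes "\<And>x. x \<in> space N \<Longrightarrow> g x \<in> carrier_vec p"
    and "\<And>i. i < p \<Longrightarrow> (\<lambda>x. g x $ i) \<in> borel_measurable N"
  shows "g \<in> measurable N (vec_borel p)"
  unfolding vec_borel_def
  by (rule measurable_vimage_algebra2) (use assms in \<open>auto intro!: measurable_restrict\<close>)

lemma scalar_prod_sum: "y \<in> carrier_vec p \<Longrightarrow> (x :: rvec) \<bullet> y = (\<Sum>i<p. x $ i * y $ i)"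
  by (auto simp: scalar_prod_def atLeast0LessThan)

lemma measurable_scalar_prod:
  assumes f: "f \<in> measurable N (vec_borel p)" and g: "g \<in> measurable N (vec_borel p)"
  shows "(\<lambda>x. f x \<bullet> g x) \<in> borel_measurable N"
proof -
  have "(\<lambda>x. \<Sum>i<p. f x $ i * g x $ i) \<in> borel_measurable N"
    by (intro borel_measurable_sum borel_measurable_times
        measurable_compose[OF f measurable_vec_borel_index] measurable_compose[OF g measurable_vec_borel_index]) auto
  moreover have "(\<lambda>x. f x \<bullet> g x) \<in> borel_measurable N \<longleftrightarrow> (\<lambda>x. \<Sum>i<p. f x $ i * g x $ i) \<in> borel_measurable N"
    using measurable_space[OF g] by (intro measurable_cong scalar_prod_sum) auto
  ultimately show ?thesis by simp
qed

lemma measurable_euclid_norm: "euclid_norm \<in> borel_measurable (vec_borel p)"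
  unfolding euclid_norm_def using measurable_scalar_prod[of "\<lambda>x. x" "vec_borel p" p "\<lambda>x. x"] by measurable

lemma measurable_scalar_prod_const:
  assumes "e \<in> carrier_vec p"
  shows "(\<lambda>v. e \<bullet> v) \<in> borel_measurable (vec_borel p)"
  by (rule measurable_scalar_prod[where p = p]) (use assms in \<open>auto intro!: measurable_const\<close>)

lemma measurable_smult_vec:
  assumes "f \<in> borel_measurable N" "g \<in> measurable N (vec_borel p)"
  shows "(\<lambda>x. f x \<cdot>\<^sub>v g x) \<in> measurable N (vec_borel p)"
proof (rule measurable_vec_borelI)
  fix i assume i: "i < p"
  have "(\<lambda>x. f x * g x $ i) \<in> borel_measurable N"
    by (intro borel_measurable_times assms measurable_compose[OF assms(2) measurable_vec_borel_index[OF i]])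
  moreover have "(f x \<cdot>\<^sub>v g x) $ i = f x * g x $ i" if "x \<in> space N" for x
    using measurable_space[OF assms(2) that] i by auto
  ultimately show "(\<lambda>x. (f x \<cdot>\<^sub>v g x) $ i) \<in> borel_measurable N"
    by (subst measurable_cong) auto
qed (use measurable_space[OF assms(2)] in auto)

lemma measurable_mult_mat_vec:
  assumes A: "A \<in> carrier_mat p p" and g: "g \<in> measurable N (vec_borel p)"
  shows "(\<lambda>x. A *\<^sub>v g x) \<in> measurable N (vec_borel p)"
proof (rule measurable_vec_borelI)
  fix i assume i: "i < p"
  have "(\<lambda>x. row A i \<bullet> g x) \<in> borel_measurable N"
    by (rule measurable_compose[OF g measurable_scalar_prod_const]) (use A i in auto)
  then show "(\<lambda>x. (A *\<^sub>v g x) $ i) \<in> borel_measurable N" using A i by simp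
qed (use A measurable_space[OF g] in auto)

section \<open>Lebesgue and Gaussian measure in polar form\<close>

abbreviation coords_lborel :: "nat \<Rightarrow> (nat \<Rightarrow> real) measure" where
  "coords_lborel p \<equiv> \<Pi>\<^sub>M i\<in>{..<p}. lborel"

abbreviation gauss :: "nat \<Rightarrow> (nat \<Rightarrow> real) measure" where
  "gauss p \<equiv> \<Pi>\<^sub>M i\<in>{..<p}. density lborel std_normal_density"

definition sumsq :: "nat \<Rightarrow> (nat \<Rightarrow> real) \<Rightarrow> real" where
  "sumsq p x = (\<Sum>i<p. (x i)\<^sup>2)"

lemma sumsq_nonneg: "0 \<le> sumsq p x"
  by (simp add: sumsq_def sum_nonneg)

lemma sumsq_vec: "euclid_norm (Matrix.vec p x) = sqrt (sumsq p x)"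
  by (simp add: euclid_norm_def scalar_prod_self_sum[where p = p] sumsq_def)

lemma measurable_sumsq [measurable]: "sumsq p \<in> borel_measurable (\<Pi>\<^sub>M i\<in>{..<p}. lborel)"
  unfolding sumsq_def by measurable

lemma measurable_vec: "Matrix.vec p \<in> measurable (coords_lborel p) (vec_borel p)"
  by (rule measurable_vec_borelI) auto

text \<open>The image of the measure under scaling, reweighted by \<open>s ^ p\<close>, has the
  right value on boxes, so uniqueness of the product measure identifies it; each side of a box is
  handled by the one-dimensional affine substitution.\<close>

lemma coords_lborel_scale:
  assumes s: "0 < s" and F[measurable]: "F \<in> borel_measurable (coords_lborel p)"
  shows "(\<integral>\<^sup>+x. F x \<partial>coords_lborel p) = ennreal (s ^ p) * (\<integral>\<^sup>+x. F (\<lambda>i\<in>{..<p}. s * x i) \<partial>coords_lborel p)"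
proof -
  interpret product_sigma_finite "\<lambda>_ :: nat. lborel :: real measure" ..
  define h where "h x = (\<lambda>i\<in>{..<p}. s * x i)" for x :: "nat \<Rightarrow> real"
  have h[measurable]: "h \<in> measurable (coords_lborel p) (coords_lborel p)"
    unfolding h_def by (intro measurable_restrict) measurable
  define P where "P = density (distr (coords_lborel p) (coords_lborel p) h) (\<lambda>_. ennreal (s ^ p))"
  have "P = coords_lborel p"
  proof (rule PiM_eqI)
    fix A :: "nat \<Rightarrow> real set" assume A: "\<And>i. i \<in> {..<p} \<Longrightarrow> A i \<in> sets lborel"
    have box: "Pi\<^sub>E {..<p} A \<in> sets (coords_lborel p)" by (intro sets_PiM_I_finite A) auto
    have "h -` Pi\<^sub>E {..<p} A \<inter> space (coords_lborel p) = Pi\<^sub>E {..<p} (\<lambda>i. (\<lambda>y. s * y) -` A i)"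
      by (auto simp: h_def space_PiM PiE_iff extensional_def)
    then have "emeasure P (Pi\<^sub>E {..<p} A) = ennreal (s ^ p) * emeasure (coords_lborel p) (Pi\<^sub>E {..<p} (\<lambda>i. (\<lambda>y. s * y) -` A i))"
      using box by (simp add: P_def emeasure_density_const emeasure_distr)
    also have "emeasure (coords_lborel p) (Pi\<^sub>E {..<p} (\<lambda>i. (\<lambda>y. s * y) -` A i)) = (\<Prod>i<p. emeasure lborel ((\<lambda>y. s * y) -` A i))"
      using A by (intro emeasure_PiM) (auto intro!: measurable_sets_borel[where f = "\<lambda>y. s * y" and M = borel])
    also have "ennreal (s ^ p) * \<dots> = (\<Prod>i<p. ennreal s * emeasure lborel ((\<lambda>y. s * y) -` A i))"
      using s by (simp add: prod.distrib ennreal_power)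
    also have "\<dots> = (\<Prod>i<p. emeasure lborel (A i))"
    proof (intro prod.cong refl)
      fix i assume i: "i \<in> {..<p}"
      have "emeasure lborel (A i) = emeasure (density (distr lborel borel (\<lambda>y. 0 + s * y)) (\<lambda>_. ennreal \<bar>s\<bar>)) (A i)"
        using lborel_real_affine[of s 0] s by simp
      also have "\<dots> = ennreal s * emeasure lborel ((\<lambda>y. s * y) -` A i)"
        using A[OF i] s by (simp add: emeasure_density_const emeasure_distr)
      finally show "ennreal s * emeasure lborel ((\<lambda>y. s * y) -` A i) = emeasure lborel (A i)" by simp
    qed
    finally show "emeasure P (Pi\<^sub>E {..<p} A) = (\<Prod>i\<in>{..<p}. emeasure lborel (A i))" .
  qed (auto simp: P_def)
  then have "(\<integral>\<^sup>+x. F x \<partial>coords_lborel p) = (\<integral>\<^sup>+x. F x \<partial>P)" by simp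
  also have "\<dots> = ennreal (s ^ p) * (\<integral>\<^sup>+x. F (h x) \<partial>coords_lborel p)"
    by (simp add: P_def nn_integral_density nn_integral_distr nn_integral_cmult)
  finally show ?thesis by (simp add: h_def)
qed

text \<open>
  Layer-cake integration in polar form: the radial profile is written as a superposition of
  indicators of balls, and each ball is rescaled to the unit ball.
\<close>

lemma radial_integral:
  fixes w :: "real \<Rightarrow> ennreal" and F :: "(nat \<Rightarrow> real) \<Rightarrow> ennreal"
  assumes w[measurable]: "w \<in> borel_measurable borel" and F[measurable]: "F \<in> borel_measurable (coords_lborel p)"
    and hom: "\<And>s x. 0 < s \<Longrightarrow> x \<in> space (coords_lborel p) \<Longrightarrow> F (\<lambda>i\<in>{..<p}. s * x i) = F x"
  shows "(\<integral>\<^sup>+x. F x * (\<integral>\<^sup>+\<tau>. w \<tau> * indicator {0<..} \<tau> * indicator {sumsq p x..} \<tau> \<partial>lborel) \<partial>coords_lborel p) =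
    (\<integral>\<^sup>+\<tau>. w \<tau> * indicator {0<..} \<tau> * ennreal (sqrt \<tau> ^ p) \<partial>lborel) *
    (\<integral>\<^sup>+x. F x * indicator {..1} (sumsq p x) \<partial>coords_lborel p)"
proof -
  interpret product_sigma_finite "\<lambda>_ :: nat. lborel :: real measure" ..
  interpret sigma_finite_measure "coords_lborel p" by (rule sigma_finite) simp
  interpret pair_sigma_finite "coords_lborel p" "lborel :: real measure" ..
  let ?J = "\<integral>\<^sup>+x. F x * indicator {..1} (sumsq p x) \<partial>coords_lborel p"
  \<comment> \<open>Written through the difference, the indicator is jointly measurable in
    \<open>x\<close> and \<open>\<tau>\<close>, as the exchange of integrals requires.\<close>
  have ind: "indicator {sumsq p x..} \<tau> = (indicator {0..} (\<tau> - sumsq p x) :: ennreal)" for x \<tau>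
    by (simp add: indicator_def)
  have "(\<integral>\<^sup>+x. F x * (\<integral>\<^sup>+\<tau>. w \<tau> * indicator {0<..} \<tau> * indicator {sumsq p x..} \<tau> \<partial>lborel) \<partial>coords_lborel p) =
      (\<integral>\<^sup>+x. (\<integral>\<^sup>+\<tau>. F x * (w \<tau> * indicator {0<..} \<tau> * indicator {0..} (\<tau> - sumsq p x)) \<partial>lborel) \<partial>coords_lborel p)"
    unfolding ind by (intro nn_integral_cong nn_integral_cmult[symmetric]) measurable
  also have "\<dots> = (\<integral>\<^sup>+\<tau>. (\<integral>\<^sup>+x. F x * (w \<tau> * indicator {0<..} \<tau> * indicator {0..} (\<tau> - sumsq p x)) \<partial>coords_lborel p) \<partial>lborel)"
    by (rule Fubini'[symmetric]) measurable
  also have "\<dots> = (\<integral>\<^sup>+\<tau>. w \<tau> * indicator {0<..} \<tau> * ennreal (sqrt \<tau> ^ p) * ?J \<partial>lborel)"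
  proof (intro nn_integral_cong)
    fix \<tau> :: real
    show "(\<integral>\<^sup>+x. F x * (w \<tau> * indicator {0<..} \<tau> * indicator {0..} (\<tau> - sumsq p x)) \<partial>coords_lborel p) =
        w \<tau> * indicator {0<..} \<tau> * ennreal (sqrt \<tau> ^ p) * ?J"
    proof (cases "\<tau> > 0")
      case True
      have "(\<integral>\<^sup>+x. F x * (w \<tau> * indicator {0<..} \<tau> * indicator {0..} (\<tau> - sumsq p x)) \<partial>coords_lborel p) =
          w \<tau> * (\<integral>\<^sup>+x. F x * indicator {0..} (\<tau> - sumsq p x) \<partial>coords_lborel p)"
        using True by (subst nn_integral_cmult[symmetric]) (auto simp: mult_ac)
      also have "(\<integral>\<^sup>+x. F x * indicator {0..} (\<tau> - sumsq p x) \<partial>coords_lborel p) = ennreal (sqrt \<tau> ^ p) *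
          (\<integral>\<^sup>+x. F (\<lambda>i\<in>{..<p}. sqrt \<tau> * x i) * indicator {0..} (\<tau> - sumsq p (\<lambda>i\<in>{..<p}. sqrt \<tau> * x i)) \<partial>coords_lborel p)"
        using True by (intro coords_lborel_scale) auto
      also have "(\<integral>\<^sup>+x. F (\<lambda>i\<in>{..<p}. sqrt \<tau> * x i) * indicator {0..} (\<tau> - sumsq p (\<lambda>i\<in>{..<p}. sqrt \<tau> * x i)) \<partial>coords_lborel p) = ?J"
      proof (intro nn_integral_cong)
        fix x assume x: "x \<in> space (coords_lborel p)"
        have "sumsq p (\<lambda>i\<in>{..<p}. sqrt \<tau> * x i) = \<tau> * sumsq p x"
          using True by (simp add: sumsq_def power_mult_distrib sum_distrib_left)
        moreover have "0 \<le> \<tau> - \<tau> * sumsq p x \<longleftrightarrow> sumsq p x \<le> 1"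
          using True mult_le_cancel_left_pos[of \<tau> "sumsq p x" 1] by simp
        ultimately show "F (\<lambda>i\<in>{..<p}. sqrt \<tau> * x i) * indicator {0..} (\<tau> - sumsq p (\<lambda>i\<in>{..<p}. sqrt \<tau> * x i)) =
            F x * indicator {..1} (sumsq p x)"
          using hom[OF _ x, of "sqrt \<tau>"] True by (simp add: indicator_def)
      qed
      finally show ?thesis using True by (simp add: mult_ac)
    qed simp
  qed
  also have "\<dots> = (\<integral>\<^sup>+\<tau>. w \<tau> * indicator {0<..} \<tau> * ennreal (sqrt \<tau> ^ p) \<partial>lborel) * ?J"
    by (rule nn_integral_multc) measurable
  finally show ?thesis .
qed

lemma gauss_density:
  "gauss p = density (coords_lborel p) (\<lambda>x. ennreal ((1 / sqrt (2 * pi)) ^ p * exp (- sumsq p x / 2)))"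
proof -
  have dens: "(1 / sqrt (2 * pi)) ^ p * exp (- sumsq p x / 2) = (\<Prod>i<p. std_normal_density (x i))" for x
    by (simp add: std_normal_density_def sumsq_def prod.distrib prod_dividef exp_sum[symmetric] sum_negf sum_divide_distrib power_divide)
  interpret L: product_sigma_finite "\<lambda>_ :: nat. lborel :: real measure" ..
  interpret N: product_sigma_finite "\<lambda>_ :: nat. density lborel std_normal_density"
    by (simp add: product_sigma_finite_def prob_space_imp_sigma_finite prob_space_normal_density)
  have "density (coords_lborel p) (\<lambda>x. ennreal ((1 / sqrt (2 * pi)) ^ p * exp (- sumsq p x / 2))) = gauss p"
  proof (rule N.PiM_eqI)
    fix A :: "nat \<Rightarrow> real set" assume A: "\<And>i. i \<in> {..<p} \<Longrightarrow> A i \<in> sets (density lborel std_normal_density)"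
    then have A': "\<And>i. i < p \<Longrightarrow> A i \<in> sets borel" by simp
    have box: "Pi\<^sub>E {..<p} A \<in> sets (coords_lborel p)" using A' by (intro sets_PiM_I_finite) auto
    have "emeasure (density (coords_lborel p) (\<lambda>x. ennreal ((1 / sqrt (2 * pi)) ^ p * exp (- sumsq p x / 2)))) (Pi\<^sub>E {..<p} A) =
        (\<integral>\<^sup>+x. ennreal (\<Prod>i<p. std_normal_density (x i)) * indicator (Pi\<^sub>E {..<p} A) x \<partial>coords_lborel p)"
      using box unfolding dens[symmetric] by (subst emeasure_density) auto
    also have "\<dots> = (\<integral>\<^sup>+x. (\<Prod>i<p. ennreal (std_normal_density (x i)) * indicator (A i) (x i)) \<partial>coords_lborel p)"
    proof (intro nn_integral_cong)
      fix x assume "x \<in> space (coords_lborel p)"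
      then have "indicator (Pi\<^sub>E {..<p} A) x = (\<Prod>i<p. indicator (A i) (x i) :: ennreal)"
        by (auto simp: space_PiM PiE_iff indicator_def prod_zero_iff)
      then show "ennreal (\<Prod>i<p. std_normal_density (x i)) * indicator (Pi\<^sub>E {..<p} A) x =
          (\<Prod>i<p. ennreal (std_normal_density (x i)) * indicator (A i) (x i))"
        by (simp add: prod.distrib prod_ennreal)
    qed
    also have "\<dots> = (\<Prod>i<p. \<integral>\<^sup>+y. ennreal (std_normal_density y) * indicator (A i) y \<partial>lborel)"
      using A' by (intro L.product_nn_integral_prod) auto
    also have "\<dots> = (\<Prod>i<p. emeasure (density lborel std_normal_density) (A i))"
      using A' by (intro prod.cong refl) (simp add: emeasure_density)
    finally show "emeasure (density (coords_lborel p) (\<lambda>x. ennreal ((1 / sqrt (2 * pi)) ^ p * exp (- sumsq p x / 2)))) (Pi\<^sub>E {..<p} A) =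
        (\<Prod>i\<in>{..<p}. emeasure (density lborel std_normal_density) (A i))" .
  qed (auto intro!: sets_PiM_cong)
  then show ?thesis by simp
qed

lemma sets_gauss: "sets (gauss p) = sets (coords_lborel p)"
  by (intro sets_PiM_cong) auto

lemma prob_space_gauss: "prob_space (gauss p)"
  by (rule prob_space_PiM) (simp add: prob_space_normal_density)

text \<open>The Gaussian weight at squared length \<open>r\<close> as a mixture of indicators of
  balls: a point belongs to the ball of squared radius \<open>\<tau>\<close> precisely when
  \<open>\<tau> \<ge> r\<close>.\<close>

lemma profile_exp:
  assumes "0 \<le> r"
  shows "(\<integral>\<^sup>+\<tau>. ennreal (exp (- \<tau> / 2) / 2) * indicator {0<..} \<tau> * indicator {r..} \<tau> \<partial>lborel) = ennreal (exp (- r / 2))"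
proof -
  have "(\<integral>\<^sup>+\<tau>. ennreal (exp (- \<tau> / 2) / 2) * indicator {0<..} \<tau> * indicator {r..} \<tau> \<partial>lborel) =
      (\<integral>\<^sup>+\<tau>. ennreal (exp (- \<tau> / 2) / 2) * indicator {r..} \<tau> \<partial>lborel)"
  \<comment> \<open>For \<open>r = 0\<close> the two integrands differ at the single point
    0.\<close>
  proof (rule nn_integral_cong_AE)
    show "AE \<tau> in lborel. ennreal (exp (- \<tau> / 2) / 2) * indicator {0<..} \<tau> * indicator {r..} \<tau> =
        ennreal (exp (- \<tau> / 2) / 2) * indicator {r..} \<tau>"
      using AE_lborel_singleton[of "0 :: real"] by eventually_elim (use assms in \<open>auto simp: indicator_def\<close>)
  qed
  also have "\<dots> = ennreal (0 - (- exp (- r / 2)))"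
    by (rule nn_integral_FTC_atLeast) (auto intro!: derivative_eq_intros, real_asymp)
  finally show ?thesis by simp
qed

text \<open>The shift by two is the price of a nonnegative mixing density:
  \<open>r * exp (- r / 2)\<close> increases up to \<open>r = 2\<close> and is no mixture of balls,
  whereas \<open>(r + 2) * exp (- r / 2)\<close> is decreasing. It reappears as the summand two in
  all integrals against the squared length.\<close>

lemma profile_exp_linear:
  assumes "0 \<le> r"
  shows "(\<integral>\<^sup>+\<tau>. ennreal (\<tau> * exp (- \<tau> / 2) / 2) * indicator {0<..} \<tau> * indicator {r..} \<tau> \<partial>lborel) =
    ennreal ((r + 2) * exp (- r / 2))"
proof -
  have "(\<integral>\<^sup>+\<tau>. ennreal (\<tau> * exp (- \<tau> / 2) / 2) * indicator {0<..} \<tau> * indicator {r..} \<tau> \<partial>lborel) =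
      (\<integral>\<^sup>+\<tau>. ennreal (\<tau> * exp (- \<tau> / 2) / 2) * indicator {r..} \<tau> \<partial>lborel)"
    by (intro nn_integral_cong) (use assms in \<open>auto simp: indicator_def\<close>)
  also have "\<dots> = ennreal (0 - (- ((r + 2) * exp (- r / 2))))"
  proof (rule nn_integral_FTC_atLeast)
    fix \<tau> :: real assume "r \<le> \<tau>"
    show "((\<lambda>\<tau>. - ((\<tau> + 2) * exp (- \<tau> / 2))) has_real_derivative \<tau> * exp (- \<tau> / 2) / 2) (at \<tau>)"
      by (auto intro!: derivative_eq_intros simp: field_simps)
    show "0 \<le> \<tau> * exp (- \<tau> / 2) / 2" using \<open>r \<le> \<tau>\<close> assms by simp
  next
    show "((\<lambda>\<tau> :: real. - ((\<tau> + 2) * exp (- \<tau> / 2))) \<longlongrightarrow> 0) at_top" by real_asymp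
  qed measurable
  finally show ?thesis by simp
qed

definition direction :: "nat \<Rightarrow> (nat \<Rightarrow> real) \<Rightarrow> rvec" where
  "direction p x = (1 / euclid_norm (Matrix.vec p x)) \<cdot>\<^sub>v Matrix.vec p x"

lemma measurable_direction: "direction p \<in> measurable (coords_lborel p) (vec_borel p)"
  unfolding direction_def
  by (intro measurable_smult_vec measurable_vec borel_measurable_divide borel_measurable_const
      measurable_compose[OF measurable_vec measurable_euclid_norm])

lemma direction_scale:
  assumes "0 < s"
  shows "direction p (\<lambda>i\<in>{..<p}. s * x i) = direction p x"
proof -
  have "Matrix.vec p (\<lambda>i\<in>{..<p}. s * x i) = s \<cdot>\<^sub>v Matrix.vec p x"
    by (intro eq_vecI) auto
  then show ?thesis
    unfolding direction_def using assms by (intro eq_vecI) (auto simp: euclid_norm_smult)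
qed

lemma nn_integral_sphere_uniform:
  assumes H[measurable]: "H \<in> borel_measurable (vec_borel p)"
  shows "(\<integral>\<^sup>+v. H v \<partial>sphere_uniform p) =
    (\<integral>\<^sup>+x. H (direction p x) * indicator {..1} (sumsq p x) \<partial>coords_lborel p) /
    (\<integral>\<^sup>+x. indicator {..1} (sumsq p x) \<partial>coords_lborel p)"
proof -
  note [measurable] = measurable_vec measurable_euclid_norm
  let ?B = "{v \<in> carrier_vec p. euclid_norm v \<le> 1}"
  have B[measurable]: "?B \<in> sets (vec_borel p)"
    using measurable_sets[OF measurable_euclid_norm[of p], of "{..1}"]
    by (simp add: vimage_def Int_def conj_commute)
  have sv: "sets (vec_lborel p) = sets (vec_borel p)" by (simp add: vec_lborel_def)
  have nm: "(\<lambda>v. (1 / euclid_norm v) \<cdot>\<^sub>v v) \<in> measurable (vec_borel p) (vec_borel p)"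
    by (intro measurable_smult_vec borel_measurable_divide borel_measurable_const measurable_euclid_norm) auto
  have Hn: "(\<lambda>v. H ((1 / euclid_norm v) \<cdot>\<^sub>v v)) \<in> borel_measurable (vec_borel p)"
    by (rule measurable_compose[OF nm H])
  have "(\<integral>\<^sup>+v. H v \<partial>sphere_uniform p) =
      (\<integral>\<^sup>+v. H ((1 / euclid_norm v) \<cdot>\<^sub>v v) \<partial>uniform_measure (vec_lborel p) ?B)"
    unfolding sphere_uniform_def
    by (rule nn_integral_distr) (use nm H in \<open>simp_all add: measurable_cong_sets[OF sv refl] cong: measurable_cong_sets\<close>)
  also have "\<dots> = (\<integral>\<^sup>+v. H ((1 / euclid_norm v) \<cdot>\<^sub>v v) * indicator ?B v \<partial>vec_lborel p) / emeasure (vec_lborel p) ?B"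
    by (rule nn_integral_uniform_measure) (use Hn B in \<open>simp_all add: sv measurable_cong_sets[OF sv refl]\<close>)
  also have "(\<integral>\<^sup>+v. H ((1 / euclid_norm v) \<cdot>\<^sub>v v) * indicator ?B v \<partial>vec_lborel p) =
      (\<integral>\<^sup>+x. H (direction p x) * indicator ?B (Matrix.vec p x) \<partial>coords_lborel p)"
    unfolding vec_lborel_def direction_def
    by (rule nn_integral_distr[OF measurable_vec]) (use Hn B in measurable)
  also have "emeasure (vec_lborel p) ?B = (\<integral>\<^sup>+x. indicator ?B (Matrix.vec p x) \<partial>coords_lborel p)"
    unfolding vec_lborel_def
    by (subst nn_integral_distr[OF measurable_vec, symmetric]) (use B in auto)
  also have "(\<lambda>x. indicator ?B (Matrix.vec p x) :: ennreal) = (\<lambda>x. indicator {..1} (sumsq p x))"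
    by (auto simp: indicator_def sumsq_vec fun_eq_iff)
  finally show ?thesis .
qed

lemma nn_integral_gauss_sumsq: "(\<integral>\<^sup>+x. ennreal (sumsq p x) \<partial>gauss p) = ennreal (real p)"
proof -
  have "(\<integral>\<^sup>+x. ennreal ((x i)\<^sup>2) \<partial>gauss p) = 1" if i: "i < p" for i
  proof -
    have "(\<integral>\<^sup>+x. ennreal ((x i)\<^sup>2) \<partial>gauss p) =
        (\<integral>\<^sup>+y. ennreal (y\<^sup>2) \<partial>distr (gauss p) (density lborel std_normal_density) (\<lambda>x. x i))"
      using i by (subst nn_integral_distr) (auto intro!: measurable_component_singleton)
    also have "\<dots> = (\<integral>\<^sup>+y. ennreal (y\<^sup>2) \<partial>density lborel std_normal_density)"
      using i by (subst distr_PiM_component) (auto simp: prob_space_normal_density)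
    also have "\<dots> = (\<integral>\<^sup>+y. ennreal (std_normal_density y * y ^ (2 * 1)) \<partial>lborel)"
      by (subst nn_integral_density) (auto simp: ennreal_mult)
    also have "\<dots> = ennreal 1"
      using std_normal_moment_even[of 1]
      by (subst nn_integral_eq_integral) (auto simp: has_bochner_integral_iff normal_density_nonneg)
    finally show ?thesis by simp
  qed
  moreover have "(\<integral>\<^sup>+x. ennreal (sumsq p x) \<partial>gauss p) = (\<Sum>i<p. \<integral>\<^sup>+x. ennreal ((x i)\<^sup>2) \<partial>gauss p)"
  proof -
    have "(\<integral>\<^sup>+x. ennreal (sumsq p x) \<partial>gauss p) = (\<integral>\<^sup>+x. (\<Sum>i<p. ennreal ((x i)\<^sup>2)) \<partial>gauss p)"
      by (intro nn_integral_cong) (simp add: sumsq_def sum_ennreal)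
    also have "\<dots> = (\<Sum>i<p. \<integral>\<^sup>+x. ennreal ((x i)\<^sup>2) \<partial>gauss p)"
      by (rule nn_integral_sum, subst measurable_cong_sets[OF sets_gauss refl]) measurable
    finally show ?thesis .
  qed
  ultimately show ?thesis by (simp add: ennreal_of_nat_eq_real_of_nat)
qed

text \<open>Direction and length of a Gaussian vector are independent; the second identity is this
  independence tested against the squared length, whose mean is \<open>p\<close>. Both follow from
  the polar formula, where \<open>H\<close> contributes the same factor for either radial profile.
  The constants are fixed by taking \<open>H = 1\<close>, so no Gamma integral has to be
  evaluated.\<close>

lemma sphere_uniform_gauss:
  assumes H[measurable]: "H \<in> borel_measurable (vec_borel p)"
  shows "(\<integral>\<^sup>+v. H v \<partial>sphere_uniform p) = (\<integral>\<^sup>+x. H (direction p x) \<partial>gauss p)"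
    and "ennreal (real p + 2) * (\<integral>\<^sup>+v. H v \<partial>sphere_uniform p) =
      (\<integral>\<^sup>+x. H (direction p x) * ennreal (sumsq p x + 2) \<partial>gauss p)"
proof -
  note md[measurable] = measurable_direction
  interpret G: prob_space "gauss p" by (rule prob_space_gauss)
  define \<kappa> where "\<kappa> = (1 / sqrt (2 * pi)) ^ p"
  have \<kappa>: "0 \<le> \<kappa>" by (simp add: \<kappa>_def)
  define J where "J K = (\<integral>\<^sup>+x. K (direction p x) * indicator {..1} (sumsq p x) \<partial>coords_lborel p)" for K :: "rvec \<Rightarrow> ennreal"
  define C0 where "C0 = (\<integral>\<^sup>+\<tau>. ennreal (exp (- \<tau> / 2) / 2) * indicator {0<..} \<tau> * ennreal (sqrt \<tau> ^ p) \<partial>lborel)"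
  define C1 where "C1 = (\<integral>\<^sup>+\<tau>. ennreal (\<tau> * exp (- \<tau> / 2) / 2) * indicator {0<..} \<tau> * ennreal (sqrt \<tau> ^ p) \<partial>lborel)"
  have mg: "f \<in> borel_measurable (gauss p) \<longleftrightarrow> f \<in> borel_measurable (coords_lborel p)" for f :: "(nat \<Rightarrow> real) \<Rightarrow> ennreal"
    by (rule arg_cong[where f = "(\<in>) f"], rule measurable_cong_sets[OF sets_gauss refl])
  have E0: "(\<integral>\<^sup>+x. K (direction p x) \<partial>gauss p) = ennreal \<kappa> * (C0 * J K)"
    if K[measurable]: "K \<in> borel_measurable (vec_borel p)" for K :: "rvec \<Rightarrow> ennreal"
  proof -
    have "(\<integral>\<^sup>+x. K (direction p x) \<partial>gauss p) =
        (\<integral>\<^sup>+x. ennreal (\<kappa> * exp (- sumsq p x / 2)) * K (direction p x) \<partial>coords_lborel p)"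
      unfolding gauss_density \<kappa>_def[symmetric] by (rule nn_integral_density) measurable
    also have "\<dots> = (\<integral>\<^sup>+x. ennreal \<kappa> * (K (direction p x) *
        (\<integral>\<^sup>+\<tau>. ennreal (exp (- \<tau> / 2) / 2) * indicator {0<..} \<tau> * indicator {sumsq p x..} \<tau> \<partial>lborel)) \<partial>coords_lborel p)"
      unfolding profile_exp[OF sumsq_nonneg] using \<kappa>
      by (intro nn_integral_cong) (simp add: ennreal_mult mult_ac)
    also have "\<dots> = ennreal \<kappa> * (\<integral>\<^sup>+x. K (direction p x) *
        (\<integral>\<^sup>+\<tau>. ennreal (exp (- \<tau> / 2) / 2) * indicator {0<..} \<tau> * indicator {sumsq p x..} \<tau> \<partial>lborel) \<partial>coords_lborel p)"
      unfolding profile_exp[OF sumsq_nonneg] by (rule nn_integral_cmult) measurable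
    also have "\<dots> = ennreal \<kappa> * (C0 * J K)"
      unfolding C0_def J_def by (subst radial_integral) (auto simp: direction_scale)
    finally show ?thesis .
  qed
  have E1: "(\<integral>\<^sup>+x. K (direction p x) * ennreal (sumsq p x + 2) \<partial>gauss p) = ennreal \<kappa> * (C1 * J K)"
    if K[measurable]: "K \<in> borel_measurable (vec_borel p)" for K :: "rvec \<Rightarrow> ennreal"
  proof -
    have "(\<integral>\<^sup>+x. K (direction p x) * ennreal (sumsq p x + 2) \<partial>gauss p) =
        (\<integral>\<^sup>+x. ennreal (\<kappa> * exp (- sumsq p x / 2)) * (K (direction p x) * ennreal (sumsq p x + 2)) \<partial>coords_lborel p)"
      unfolding gauss_density \<kappa>_def[symmetric] by (rule nn_integral_density) measurable
    also have "\<dots> = (\<integral>\<^sup>+x. ennreal \<kappa> * (K (direction p x) *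
        (\<integral>\<^sup>+\<tau>. ennreal (\<tau> * exp (- \<tau> / 2) / 2) * indicator {0<..} \<tau> * indicator {sumsq p x..} \<tau> \<partial>lborel)) \<partial>coords_lborel p)"
      unfolding profile_exp_linear[OF sumsq_nonneg] using \<kappa> sumsq_nonneg
      by (intro nn_integral_cong) (simp add: ennreal_mult mult_ac del: ennreal_plus)
    also have "\<dots> = ennreal \<kappa> * (\<integral>\<^sup>+x. K (direction p x) *
        (\<integral>\<^sup>+\<tau>. ennreal (\<tau> * exp (- \<tau> / 2) / 2) * indicator {0<..} \<tau> * indicator {sumsq p x..} \<tau> \<partial>lborel) \<partial>coords_lborel p)"
      unfolding profile_exp_linear[OF sumsq_nonneg] by (rule nn_integral_cmult) measurable
    also have "\<dots> = ennreal \<kappa> * (C1 * J K)"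
      unfolding C1_def J_def by (subst radial_integral) (auto simp: direction_scale)
    finally show ?thesis .
  qed
  have one: "ennreal \<kappa> * (C0 * J (\<lambda>_. 1)) = 1"
    using E0[of "\<lambda>_. 1"] G.emeasure_space_1 by simp
  have two: "ennreal \<kappa> * (C1 * J (\<lambda>_. 1)) = ennreal (real p + 2)"
  proof -
    have "(\<integral>\<^sup>+x. ennreal (sumsq p x + 2) \<partial>gauss p) = (\<integral>\<^sup>+x. ennreal (sumsq p x) + 2 \<partial>gauss p)"
      using sumsq_nonneg by (intro nn_integral_cong) simp
    also have "\<dots> = (\<integral>\<^sup>+x. ennreal (sumsq p x) \<partial>gauss p) + 2"
      by (subst nn_integral_add) (auto simp: mg G.emeasure_space_1)
    also have "\<dots> = ennreal (real p + 2)" by (simp add: nn_integral_gauss_sumsq)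
    finally show ?thesis using E1[of "\<lambda>_. 1"] by simp
  qed
  \<comment> \<open>Positivity and finiteness of the volume of the unit ball are read off from the
    Gaussian normalization.\<close>
  have J1: "J (\<lambda>_. 1) \<noteq> 0" "J (\<lambda>_. 1) \<noteq> \<top>"
  proof -
    show "J (\<lambda>_. 1) \<noteq> 0" using one by auto
    show "J (\<lambda>_. 1) \<noteq> \<top>"
    proof
      assume "J (\<lambda>_. 1) = \<top>"
      moreover have "ennreal \<kappa> * C0 \<noteq> 0" using one by (auto simp: mult.assoc[symmetric])
      ultimately have "ennreal \<kappa> * (C0 * J (\<lambda>_. 1)) = \<top>" by (simp add: mult.assoc[symmetric] ennreal_mult_top)
      with one show False by simp
    qed
  qed
  have sphere: "(\<integral>\<^sup>+v. H v \<partial>sphere_uniform p) = J H / J (\<lambda>_. 1)"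
    using nn_integral_sphere_uniform[OF H] by (simp add: J_def)
  have cancel: "J H / J (\<lambda>_. 1) * J (\<lambda>_. 1) = J H"
    using mult_divide_eq_ennreal[OF J1, of "J H"] ennreal_times_divide[of "J (\<lambda>_. 1)" "J H" "J (\<lambda>_. 1)"]
    by (simp add: mult.commute)
  show "(\<integral>\<^sup>+v. H v \<partial>sphere_uniform p) = (\<integral>\<^sup>+x. H (direction p x) \<partial>gauss p)"
  proof -
    have "ennreal \<kappa> * (C0 * J H) = ennreal \<kappa> * (C0 * J (\<lambda>_. 1)) * (J H / J (\<lambda>_. 1))"
      using cancel by (metis mult.assoc mult.commute)
    then show ?thesis unfolding E0[OF H] sphere one by simp
  qed
  show "ennreal (real p + 2) * (\<integral>\<^sup>+v. H v \<partial>sphere_uniform p) =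
      (\<integral>\<^sup>+x. H (direction p x) * ennreal (sumsq p x + 2) \<partial>gauss p)"
  proof -
    have "ennreal \<kappa> * (C1 * J H) = ennreal \<kappa> * (C1 * J (\<lambda>_. 1)) * (J H / J (\<lambda>_. 1))"
      using cancel by (metis mult.assoc mult.commute)
    then show ?thesis unfolding E1[OF H] sphere two by simp
  qed
qed

section \<open>Linear marginals and exponential moments on the sphere\<close>

lemma gauss_coordinate:
  assumes "i < p"
  shows "distributed (gauss p) lborel (\<lambda>x. x i) std_normal_density"
proof -
  have "distr (gauss p) lborel (\<lambda>x. x i) = distr (gauss p) (density lborel std_normal_density) (\<lambda>x. x i)"
    by (rule distr_cong) auto
  also have "\<dots> = density lborel std_normal_density"
    using assms by (subst distr_PiM_component) (auto simp: prob_space_normal_density)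
  finally show ?thesis
    using assms measurable_component_singleton[of i "{..<p}" "\<lambda>_. density lborel std_normal_density"]
    by (auto simp: distributed_def)
qed

lemma gauss_indep:
  assumes "0 < p"
  shows "prob_space.indep_vars (gauss p) (\<lambda>_. borel) (\<lambda>i x. x i) {..<p}"
proof -
  interpret G: prob_space "gauss p" by (rule prob_space_gauss)
  let ?N = "density lborel std_normal_density"
  have m: "(\<lambda>x. x i) \<in> borel_measurable (gauss p)" if "i < p" for i
    using gauss_coordinate[OF that] by (auto simp: distributed_def)
  have d: "distr (gauss p) borel (\<lambda>x. x i) = distr (gauss p) ?N (\<lambda>x. x i)" for i
    by (rule distr_cong) auto
  have "distr (gauss p) (\<Pi>\<^sub>M i\<in>{..<p}. borel) (\<lambda>x. \<lambda>i\<in>{..<p}. x i) = distr (gauss p) (gauss p) (\<lambda>x. x)"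
    by (rule distr_cong) (auto simp: space_PiM restrict_def PiE_iff extensional_def fun_eq_iff intro!: sets_PiM_cong)
  also have "\<dots> = gauss p" by (rule distr_id)
  also have "\<dots> = (\<Pi>\<^sub>M i\<in>{..<p}. distr (gauss p) borel (\<lambda>x. x i))"
  proof (rule PiM_cong)
    fix i assume "i \<in> {..<p}"
    then show "?N = distr (gauss p) borel (\<lambda>x. x i)"
      unfolding d by (subst distr_PiM_component[where M = "\<lambda>_. ?N"]) (auto simp: prob_space_normal_density)
  qed simp
  finally show ?thesis
    using assms m by (subst G.indep_vars_iff_distr_eq_PiM') (auto simp: lessThan_empty_iff)
qed

lemma gauss_linear_distributed:
  assumes e: "e \<in> carrier_vec p" "e \<bullet> e = (1 :: real)"
  shows "distributed (gauss p) lborel (\<lambda>x. \<Sum>i<p. e $ i * x i) std_normal_density"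
proof -
  interpret G: prob_space "gauss p" by (rule prob_space_gauss)
  \<comment> \<open>Coordinates with coefficient zero are dropped because the addition theorem for
    independent normal variables asks for positive standard deviations.\<close>
  define I where "I = {i \<in> {..<p}. e $ i \<noteq> 0}"
  have "(\<Sum>i<p. (e $ i)\<^sup>2) = 1" using e scalar_prod_self_sum[OF e(1)] by simp
  moreover have sumI: "(\<Sum>i\<in>I. (e $ i)\<^sup>2) = (\<Sum>i<p. (e $ i)\<^sup>2)"
    by (rule sum.mono_neutral_left) (auto simp: I_def)
  ultimately have s1: "(\<Sum>i\<in>I. (e $ i)\<^sup>2) = 1" by simp
  then have ne: "I \<noteq> {}" by auto
  then have p: "0 < p" by (auto simp: I_def)
  have "G.indep_vars (\<lambda>_. borel) (\<lambda>i x. x i) I"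
    by (rule G.indep_vars_subset[OF gauss_indep[OF p]]) (auto simp: I_def)
  then have ind: "G.indep_vars (\<lambda>_. borel) (\<lambda>i x. e $ i * x i) I"
    by (rule G.indep_vars_compose2[where Y = "\<lambda>i y. e $ i * y"]) auto
  have "distributed (gauss p) lborel (\<lambda>x. \<Sum>i\<in>I. e $ i * x i)
      (normal_density (\<Sum>i\<in>I. 0) (sqrt (\<Sum>i\<in>I. \<bar>e $ i\<bar>\<^sup>2)))"
  proof (rule G.sum_indep_normal[OF _ ne ind])
    fix i assume i: "i \<in> I"
    show "0 < \<bar>e $ i\<bar>" using i by (simp add: I_def)
    have "distributed (gauss p) lborel (\<lambda>x. 0 + e $ i * x i) (normal_density (0 + e $ i * 0) (\<bar>e $ i\<bar> * 1))"
      by (rule G.normal_density_affine) (use i gauss_coordinate in \<open>auto simp: I_def\<close>)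
    then show "distributed (gauss p) lborel (\<lambda>x. e $ i * x i) (normal_density 0 \<bar>e $ i\<bar>)" by simp
  qed (auto simp: I_def)
  moreover have "(\<lambda>x. \<Sum>i\<in>I. e $ i * x i) = (\<lambda>x. \<Sum>i<p. e $ i * x i)"
    by (intro ext sum.mono_neutral_left) (auto simp: I_def)
  ultimately show ?thesis by (simp add: s1)
qed

text \<open>Tilting by the exponential of a square keeps the density Gaussian: the variance becomes
  \<open>1 / (1 - 2 * l)\<close>, and the total mass is the new standard deviation
  \<open>\<sigma>\<close>.\<close>

lemma gauss_square_mgf:
  assumes l: "l < 1 / 2"
  shows "(\<integral>\<^sup>+y. ennreal (std_normal_density y) * ennreal (exp (l * y\<^sup>2)) \<partial>lborel) = ennreal (1 / sqrt (1 - 2 * l))"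
proof -
  define \<sigma> where "\<sigma> = 1 / sqrt (1 - 2 * l)"
  have \<sigma>: "0 < \<sigma>" "\<sigma>\<^sup>2 = 1 / (1 - 2 * l)" using l by (auto simp: \<sigma>_def power_divide)
  have eq: "std_normal_density y * exp (l * y\<^sup>2) = \<sigma> * normal_density 0 \<sigma> y" for y
  proof -
    have "- (y\<^sup>2) / (2 * \<sigma>\<^sup>2) = - (y\<^sup>2) / 2 + l * y\<^sup>2"
      unfolding \<sigma>(2) using l by (simp add: field_simps)
    then have "exp (- (y\<^sup>2) / (2 * \<sigma>\<^sup>2)) = exp (- (y\<^sup>2) / 2) * exp (l * y\<^sup>2)" by (simp only: exp_add)
    moreover have "sqrt (2 * pi * \<sigma>\<^sup>2) = sqrt (2 * pi) * \<sigma>" using \<sigma>(1) by (simp only: real_sqrt_mult real_sqrt_abs abs_of_pos)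
    ultimately show ?thesis using \<sigma>(1) by (simp add: normal_density_def)
  qed
  have "(\<integral>\<^sup>+y. ennreal (std_normal_density y) * ennreal (exp (l * y\<^sup>2)) \<partial>lborel) =
      (\<integral>\<^sup>+y. ennreal \<sigma> * ennreal (normal_density 0 \<sigma> y) \<partial>lborel)"
    by (intro nn_integral_cong) (use \<sigma>(1) in \<open>simp add: ennreal_mult[symmetric] eq normal_density_nonneg\<close>)
  also have "\<dots> = ennreal \<sigma> * (\<integral>\<^sup>+y. ennreal (normal_density 0 \<sigma> y) \<partial>lborel)"
    by (rule nn_integral_cmult) simp
  also have "(\<integral>\<^sup>+y. ennreal (normal_density 0 \<sigma> y) \<partial>lborel) = 1"
    using prob_space.emeasure_space_1[OF prob_space_normal_density[OF \<sigma>(1), of 0]]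
    by (simp add: emeasure_density)
  finally show ?thesis by (simp add: \<sigma>_def)
qed

text \<open>
  Conditionally on the direction of a Gaussian vector \<open>g\<close>, Jensen's inequality replaces the squared length
  of \<open>g\<close> by its mean \<open>p\<close>. Conditioning is avoided by integrating the tangent line inequality for the
  exponential at \<open>p\<close>, with terms moved between the sides to keep all integrands nonnegative.
\<close>

lemma sphere_uniform_mgf:
  assumes e: "e \<in> carrier_vec p" "e \<bullet> e = (1 :: real)" and l: "l < 1 / 2"
  shows "(\<integral>\<^sup>+v. ennreal (exp (l * real p * (e \<bullet> v)\<^sup>2)) \<partial>sphere_uniform p) \<le> ennreal (1 / sqrt (1 - 2 * l))"
proof -
  interpret G: prob_space "gauss p" by (rule prob_space_gauss)
  note [measurable] = measurable_scalar_prod_const[OF e(1)] measurable_direction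
  have mg: "f \<in> borel_measurable (gauss p) \<longleftrightarrow> f \<in> borel_measurable (coords_lborel p)" for f :: "(nat \<Rightarrow> real) \<Rightarrow> ennreal"
    by (rule arg_cong[where f = "(\<in>) f"], rule measurable_cong_sets[OF sets_gauss refl])
  define K where "K v = ennreal (exp (l * real p * (e \<bullet> v)\<^sup>2))" for v
  \<comment> \<open>Up to sign the slope of the tangent line in the squared length. The absolute
    value keeps it nonnegative; the sign of \<open>l\<close> decides on which side of the inequality
    a term is placed.\<close>
  define K2 where "K2 v = ennreal (exp (l * real p * (e \<bullet> v)\<^sup>2) * (\<bar>l\<bar> * (e \<bullet> v)\<^sup>2))" for v
  have K[measurable]: "K \<in> borel_measurable (vec_borel p)" and K2[measurable]: "K2 \<in> borel_measurable (vec_borel p)"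
    unfolding K_def K2_def by measurable
  let ?y = "\<lambda>x. \<Sum>i<p. e $ i * x i"
  let ?I = "\<integral>\<^sup>+x. ennreal (exp (l * (?y x)\<^sup>2)) \<partial>gauss p"
  have dir_le: "(e \<bullet> direction p x)\<^sup>2 \<le> 1" for x
  proof -
    have "euclid_norm (direction p x) \<le> 1" by (simp add: direction_def euclid_norm_smult)
    moreover have "euclid_norm e = 1" using e by (simp add: euclid_norm_def)
    ultimately have "\<bar>e \<bullet> direction p x\<bar> \<le> 1"
      using abs_scalar_prod_le[OF e(1), of "direction p x"] by (simp add: direction_def)
    then show ?thesis by (simp add: abs_square_le_1)
  qed
  have y: "(?y x)\<^sup>2 = (e \<bullet> direction p x)\<^sup>2 * sumsq p x" for x
  proof (cases "sumsq p x = 0")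
    case True
    then have "x i = 0" if "i < p" for i using that by (simp add: sumsq_def sum_nonneg_eq_0_iff)
    then show ?thesis using True by simp
  next
    case False
    then have "sumsq p x > 0" using sumsq_nonneg[of p x] by simp
    moreover have "e \<bullet> Matrix.vec p x = ?y x" by (simp add: scalar_prod_sum[where p = p])
    ultimately show ?thesis
      using e by (simp add: direction_def sumsq_vec power_mult_distrib power_divide)
  qed
  \<comment> \<open>The tangent line inequality bounds exp (l h s) below by exp (l p h) (1 + l h (s
    - p)), where h is the squared cosine and s the squared length. Adding two to both s and p brings
    the correction terms into the form covered by the second identity of
    \<open>sphere_uniform_gauss\<close>; after integration they coincide.\<close>
  have ptw: "K (direction p x) + (if l \<ge> 0 then K2 (direction p x) * ennreal (sumsq p x + 2) else ennreal (real p + 2) * K2 (direction p x))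
      \<le> ennreal (exp (l * (?y x)\<^sup>2)) + (if l \<ge> 0 then ennreal (real p + 2) * K2 (direction p x) else K2 (direction p x) * ennreal (sumsq p x + 2))" for x
  proof -
    define h where "h = (e \<bullet> direction p x)\<^sup>2"
    define s where "s = sumsq p x"
    have h: "0 \<le> h" and s: "0 \<le> s" by (auto simp: h_def s_def sumsq_nonneg)
    have "1 + l * h * (s - real p) \<le> exp (l * h * (s - real p))" by (rule exp_ge_add_one_self)
    then have "exp (l * real p * h) * (1 + l * h * (s - real p)) \<le> exp (l * real p * h) * exp (l * h * (s - real p))"
      by (intro mult_left_mono) auto
    also have "\<dots> = exp (l * (h * s))" by (simp add: exp_add[symmetric] algebra_simps)
    finally have main: "exp (l * real p * h) * (1 + l * h * (s - real p)) \<le> exp (l * (h * s))" .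
    define k where "k = exp (l * real p * h)"
    define k2 where "k2 = k * (\<bar>l\<bar> * h)"
    have k: "0 \<le> k" "0 \<le> k2" using h by (auto simp: k_def k2_def)
    have K: "K (direction p x) = ennreal k" "K2 (direction p x) = ennreal k2"
      by (simp_all add: K_def K2_def k_def k2_def h_def)
    note main = main[folded k_def]
    show ?thesis
    proof (cases "l \<ge> 0")
      case True
      then have "k + k2 * (s + 2) \<le> exp (l * (h * s)) + (real p + 2) * k2"
        using main by (simp add: k2_def algebra_simps)
      then have "ennreal (k + k2 * (s + 2)) \<le> ennreal (exp (l * (h * s)) + (real p + 2) * k2)" by (rule ennreal_leI)
      then show ?thesis using True k s
        by (simp add: K y h_def[symmetric] s_def[symmetric] ennreal_mult ennreal_plus)
    next
      case False
      then have "k + (real p + 2) * k2 \<le> exp (l * (h * s)) + k2 * (s + 2)"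
        using main by (simp add: k2_def algebra_simps)
      then have "ennreal (k + (real p + 2) * k2) \<le> ennreal (exp (l * (h * s)) + k2 * (s + 2))" by (rule ennreal_leI)
      then show ?thesis using False k s
        by (simp add: K y h_def[symmetric] s_def[symmetric] ennreal_mult ennreal_plus)
    qed
  qed
  let ?A = "\<integral>\<^sup>+x. (if l \<ge> 0 then K2 (direction p x) * ennreal (sumsq p x + 2) else ennreal (real p + 2) * K2 (direction p x)) \<partial>gauss p"
  let ?B = "\<integral>\<^sup>+x. (if l \<ge> 0 then ennreal (real p + 2) * K2 (direction p x) else K2 (direction p x) * ennreal (sumsq p x + 2)) \<partial>gauss p"
  let ?S = "\<integral>\<^sup>+v. K2 v \<partial>sphere_uniform p"
  have cm: "(\<integral>\<^sup>+x. ennreal (real p + 2) * K2 (direction p x) \<partial>gauss p) = ennreal (real p + 2) * ?S"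
    unfolding sphere_uniform_gauss(1)[OF K2] by (rule nn_integral_cmult) (simp add: mg)
  have A: "?A = ennreal (real p + 2) * ?S" and B: "?B = ennreal (real p + 2) * ?S"
    using cm sphere_uniform_gauss(2)[OF K2] by (cases "l \<ge> 0"; simp del: ennreal_plus)+
  \<comment> \<open>Finiteness is what allows the common correction term to be cancelled in the
    extended reals.\<close>
  have fin: "?S < \<top>"
  proof -
    have "?S = (\<integral>\<^sup>+x. K2 (direction p x) \<partial>gauss p)" by (rule sphere_uniform_gauss(1)[OF K2])
    also have "\<dots> \<le> (\<integral>\<^sup>+x. ennreal (exp (\<bar>l\<bar> * real p) * \<bar>l\<bar>) \<partial>gauss p)"
    proof (intro nn_integral_mono)
      fix x
      have "l * real p * (e \<bullet> direction p x)\<^sup>2 \<le> \<bar>l\<bar> * real p * 1"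
        using dir_le[of x] by (intro mult_mono) auto
      then show "K2 (direction p x) \<le> ennreal (exp (\<bar>l\<bar> * real p) * \<bar>l\<bar>)"
        unfolding K2_def using dir_le[of x] mult_left_mono[of "(e \<bullet> direction p x)\<^sup>2" 1 "\<bar>l\<bar>"]
        by (intro ennreal_leI mult_mono) auto
    qed
    also have "\<dots> < \<top>" using G.emeasure_space_1 by simp
    finally show ?thesis .
  qed
  have "(\<integral>\<^sup>+v. K v \<partial>sphere_uniform p) + ?A =
      (\<integral>\<^sup>+x. K (direction p x) + (if l \<ge> 0 then K2 (direction p x) * ennreal (sumsq p x + 2) else ennreal (real p + 2) * K2 (direction p x)) \<partial>gauss p)"
    unfolding sphere_uniform_gauss(1)[OF K] by (rule nn_integral_add[symmetric]) (simp_all add: mg)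
  also have "\<dots> \<le> (\<integral>\<^sup>+x. ennreal (exp (l * (?y x)\<^sup>2)) + (if l \<ge> 0 then ennreal (real p + 2) * K2 (direction p x) else K2 (direction p x) * ennreal (sumsq p x + 2)) \<partial>gauss p)"
    by (intro nn_integral_mono ptw)
  also have "\<dots> = ?I + ?B"
    by (rule nn_integral_add) (simp_all add: mg)
  finally have "ennreal (real p + 2) * ?S + (\<integral>\<^sup>+v. K v \<partial>sphere_uniform p) \<le> ennreal (real p + 2) * ?S + ?I"
    unfolding A B by (simp add: add.commute)
  moreover have "ennreal (real p + 2) * ?S \<noteq> \<top>" using fin by (simp add: ennreal_mult_eq_top_iff)
  ultimately have "(\<integral>\<^sup>+v. K v \<partial>sphere_uniform p) \<le> ?I"
    by (simp add: ennreal_add_left_cancel_le)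
  also have "?I = (\<integral>\<^sup>+y. ennreal (std_normal_density y) * ennreal (exp (l * y\<^sup>2)) \<partial>lborel)"
    by (rule distributed_nn_integral[OF gauss_linear_distributed[OF e], symmetric]) simp
  also have "\<dots> = ennreal (1 / sqrt (1 - 2 * l))" by (rule gauss_square_mgf[OF l])
  finally show ?thesis by (simp add: K_def)
qed

lemma sets_sphere_uniform [simp]: "sets (sphere_uniform p) = sets (vec_borel p)"
  by (simp add: sphere_uniform_def)

lemma space_sphere_uniform [simp]: "space (sphere_uniform p) = carrier_vec p"
  using sets_eq_imp_space_eq[OF sets_sphere_uniform] by simp

lemma prob_space_sphere_uniform: "prob_space (sphere_uniform p)"
proof
  interpret G: prob_space "gauss p" by (rule prob_space_gauss)
  have "emeasure (sphere_uniform p) (space (sphere_uniform p)) = (\<integral>\<^sup>+v. 1 \<partial>sphere_uniform p)" by simp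
  also have "\<dots> = 1" using sphere_uniform_gauss(1)[of "\<lambda>_. 1" p] G.emeasure_space_1 by simp
  finally show "emeasure (sphere_uniform p) (space (sphere_uniform p)) = 1" .
qed

text \<open>The cone construction normalizes the whole unit ball, and the origin is sent to the zero
  vector. The first coordinate of a Gaussian vector is almost surely nonzero, so this exception is
  null; \<open>1 \<le> p\<close> provides that coordinate.\<close>

lemma AE_sphere_uniform_unit:
  assumes p: "1 \<le> p"
  shows "AE v in sphere_uniform p. v \<bullet> v = 1"
proof -
  let ?B = "{v \<in> carrier_vec p. v \<bullet> v \<noteq> 1} :: rvec set"
  have m: "(\<lambda>v. v \<bullet> v) \<in> borel_measurable (vec_borel p)" by (rule measurable_scalar_prod[where p = p]) auto
  have B: "?B \<in> sets (vec_borel p)"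
    using measurable_sets[OF m, of "- {1}"] by (simp add: vimage_def Int_def conj_commute)
  have "(\<integral>\<^sup>+x. indicator {0} (x 0) \<partial>gauss p) = (\<integral>\<^sup>+y. ennreal (std_normal_density y) * indicator {0} y \<partial>lborel)"
    using p by (intro distributed_nn_integral[OF gauss_coordinate, symmetric]) auto
  also have "\<dots> = 0"
    using AE_lborel_singleton[of "0 :: real"] by (subst nn_integral_0_iff_AE) (auto simp: indicator_def elim!: eventually_mono)
  finally have "AE x in gauss p. x 0 \<noteq> 0"
    using p by (subst (asm) nn_integral_0_iff_AE) (auto simp: measurable_cong_sets[OF sets_gauss refl] indicator_def elim!: eventually_mono)
  then have "AE x in gauss p. indicator ?B (direction p x) = (0 :: ennreal)"
  proof (eventually_elim)
    case (elim x)
    have "0 < (x 0)\<^sup>2" using elim by simp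
    also have "\<dots> \<le> sumsq p x" unfolding sumsq_def using p by (intro member_le_sum) auto
    finally have "direction p x \<bullet> direction p x = 1"
      by (simp add: direction_def euclid_norm_square[symmetric] euclid_norm_smult sumsq_vec)
    then show ?case by simp
  qed
  then have "(\<integral>\<^sup>+x. indicator ?B (direction p x) \<partial>gauss p) = 0"
    by (subst nn_integral_0_iff_AE)
      (use measurable_compose[OF measurable_direction borel_measurable_indicator[OF B]] in
        \<open>simp_all add: measurable_cong_sets[OF sets_gauss refl]\<close>)
  then have "emeasure (sphere_uniform p) ?B = 0"
    using sphere_uniform_gauss(1)[of "indicator ?B" p] B by simp
  then show ?thesis
    using B by (intro AE_I[where N = ?B]) auto
qed

section \<open>Concentration for elliptical samples\<close>

definition normalized :: "rvec \<Rightarrow> rvec" where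
  "normalized y = (1 / euclid_norm y) \<cdot>\<^sub>v y"

lemma normalized_carrier [simp]: "y \<in> carrier_vec p \<Longrightarrow> normalized y \<in> carrier_vec p"
  by (simp add: normalized_def)

lemma normalized_unit:
  assumes "y \<in> carrier_vec p" "y \<noteq> 0\<^sub>v p"
  shows "normalized y \<bullet> normalized y = 1"
proof -
  have "euclid_norm (normalized y) = 1"
    using euclid_norm_pos[OF assms] by (simp add: normalized_def euclid_norm_smult)
  then show ?thesis using euclid_norm_square[of "normalized y"] by simp
qed

lemma smult_normalized:
  assumes "y \<in> carrier_vec p" "y \<noteq> 0\<^sub>v p"
  shows "euclid_norm y \<cdot>\<^sub>v normalized y = y"
  using euclid_norm_pos[OF assms] by (intro eq_vecI) (auto simp: normalized_def)

text \<open>The squared cosine between \<open>e\<close> and the whitened sample, which does not depend on the radial factor.\<close>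

definition cosine2 :: "rmat \<Rightarrow> rvec \<Rightarrow> rvec \<Rightarrow> real" where
  "cosine2 R e x = (e \<bullet> normalized (mat_inv R *\<^sub>v x))\<^sup>2"

lemma measurable_normalized: "normalized \<in> measurable (vec_borel p) (vec_borel p)"
  unfolding normalized_def
  by (intro measurable_smult_vec borel_measurable_divide borel_measurable_const measurable_euclid_norm) auto

lemma measurable_cosine2:
  assumes R: "pos_def p R" and e: "e \<in> carrier_vec p"
  shows "cosine2 R e \<in> borel_measurable (vec_borel p)"
proof -
  have "(\<lambda>x. mat_inv R *\<^sub>v x) \<in> measurable (vec_borel p) (vec_borel p)"
    by (rule measurable_mult_mat_vec[OF pos_def_inverse(1)[OF R]]) simp
  from measurable_compose[OF measurable_compose[OF this measurable_normalized] measurable_scalar_prod_const[OF e]]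
  show ?thesis unfolding cosine2_def by measurable
qed

lemma cosine2_sample:
  assumes R: "pos_def p R" and v: "v \<in> carrier_vec p" "v \<bullet> v = 1" and u: "u \<noteq> 0" and e: "e \<in> carrier_vec p"
  shows "cosine2 R e (u \<cdot>\<^sub>v (R *\<^sub>v v)) = (e \<bullet> v)\<^sup>2"
proof -
  have Rc: "R \<in> carrier_mat p p" using R by (simp add: pos_def_def)
  have "mat_inv R *\<^sub>v (u \<cdot>\<^sub>v (R *\<^sub>v v)) = u \<cdot>\<^sub>v v"
    using mult_mat_vec[OF pos_def_inverse(1)[OF R], of "R *\<^sub>v v" u] pos_def_inverse_vec(3)[OF R v(1)] Rc v by simp
  moreover have "euclid_norm v = 1" using v by (simp add: euclid_norm_def)
  then have "normalized (u \<cdot>\<^sub>v v) = (u / \<bar>u\<bar>) \<cdot>\<^sub>v v"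
    using v by (intro eq_vecI) (auto simp: normalized_def euclid_norm_smult)
  ultimately show ?thesis
    using u e v by (simp add: cosine2_def power_mult_distrib power_divide)
qed

section \<open>Integration against an elliptical law\<close>

lemma elliptical_pos_def: "elliptical p \<Sigma> D \<Longrightarrow> pos_def p \<Sigma>" and elliptical_trace: "elliptical p \<Sigma> D \<Longrightarrow> mat_trace \<Sigma> = real p"
  by (auto simp: elliptical_def)

lemma elliptical_map_measurable:
  assumes "R \<in> carrier_mat p p" "sets \<mu> = sets (borel :: real measure)"
  shows "(\<lambda>(u, v). u \<cdot>\<^sub>v (R *\<^sub>v v)) \<in> measurable (\<mu> \<Otimes>\<^sub>M sphere_uniform p) (vec_borel p)"
proof -
  have f: "fst \<in> borel_measurable (\<mu> \<Otimes>\<^sub>M sphere_uniform p)"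
    using measurable_fst[of \<mu> "sphere_uniform p"] measurable_cong_sets[OF refl assms(2)] by blast
  have g: "snd \<in> measurable (\<mu> \<Otimes>\<^sub>M sphere_uniform p) (vec_borel p)"
    using measurable_snd[of \<mu> "sphere_uniform p"] measurable_cong_sets[OF refl sets_sphere_uniform] by blast
  show ?thesis
    unfolding case_prod_beta by (intro measurable_smult_vec measurable_mult_mat_vec assms f g)
qed

lemma elliptical_sets: "elliptical p \<Sigma> D \<Longrightarrow> sets D = sets (vec_borel p)"
  by (auto simp: elliptical_def)

lemma elliptical_space: "elliptical p \<Sigma> D \<Longrightarrow> space D = carrier_vec p"
  using sets_eq_imp_space_eq[OF elliptical_sets] by simp

lemma elliptical_prob_space:
  assumes "elliptical p \<Sigma> D"
  shows "prob_space D"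
proof -
  obtain \<mu> :: "real measure" where \<mu>: "prob_space \<mu>" "sets \<mu> = sets borel"
    and D: "D = distr (\<mu> \<Otimes>\<^sub>M sphere_uniform p) (vec_borel p) (\<lambda>(u, v). u \<cdot>\<^sub>v (mat_sqrt \<Sigma> *\<^sub>v v))"
    using assms by (auto simp: elliptical_def)
  have R: "mat_sqrt \<Sigma> \<in> carrier_mat p p"
    using mat_sqrt_pos_def(1)[OF elliptical_pos_def[OF assms]] by (simp add: pos_def_def)
  interpret \<mu>: prob_space \<mu> by fact
  interpret S: prob_space "sphere_uniform p" by (rule prob_space_sphere_uniform)
  interpret pair_prob_space \<mu> "sphere_uniform p" ..
  show ?thesis unfolding D by (rule prob_space_distr[OF elliptical_map_measurable[OF R \<mu>(2)]])
qed

text \<open>An integrand that ignores the radial factor integrates as on the sphere, so the unknown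
  law \<open>\<mu>\<close> disappears from all estimates. The identification of \<open>H\<close>
  with \<open>F\<close> is asked only where \<open>u \<noteq> 0\<close> and \<open>v\<close> is a
  unit vector, which holds almost everywhere.\<close>

lemma elliptical_nn_integral:
  assumes E: "elliptical p \<Sigma> D" and p: "1 \<le> p" and H: "H \<in> borel_measurable (vec_borel p)"
    and F: "F \<in> borel_measurable (vec_borel p)"
    and HF: "\<And>u v. u \<noteq> 0 \<Longrightarrow> v \<in> carrier_vec p \<Longrightarrow> v \<bullet> v = 1 \<Longrightarrow> H (u \<cdot>\<^sub>v (mat_sqrt \<Sigma> *\<^sub>v v)) = F v"
  shows "(\<integral>\<^sup>+x. H x \<partial>D) = (\<integral>\<^sup>+v. F v \<partial>sphere_uniform p)"
proof -
  obtain \<mu> :: "real measure" where \<mu>: "prob_space \<mu>" "sets \<mu> = sets borel" "AE u in \<mu>. u \<noteq> 0"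
    and D: "D = distr (\<mu> \<Otimes>\<^sub>M sphere_uniform p) (vec_borel p) (\<lambda>(u, v). u \<cdot>\<^sub>v (mat_sqrt \<Sigma> *\<^sub>v v))"
    using E by (auto simp: elliptical_def)
  have R: "mat_sqrt \<Sigma> \<in> carrier_mat p p"
    using mat_sqrt_pos_def(1)[OF elliptical_pos_def[OF E]] by (simp add: pos_def_def)
  note m = elliptical_map_measurable[OF R \<mu>(2)]
  interpret \<mu>: prob_space \<mu> by fact
  interpret S: prob_space "sphere_uniform p" by (rule prob_space_sphere_uniform)
  have "(\<integral>\<^sup>+x. H x \<partial>D) = (\<integral>\<^sup>+z. H (case z of (u, v) \<Rightarrow> u \<cdot>\<^sub>v (mat_sqrt \<Sigma> *\<^sub>v v)) \<partial>(\<mu> \<Otimes>\<^sub>M sphere_uniform p))"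
    unfolding D by (rule nn_integral_distr[OF m]) (use H in simp)
  also have "\<dots> = (\<integral>\<^sup>+u. \<integral>\<^sup>+v. H (u \<cdot>\<^sub>v (mat_sqrt \<Sigma> *\<^sub>v v)) \<partial>sphere_uniform p \<partial>\<mu>)"
    by (subst S.nn_integral_fst[symmetric]) (use measurable_compose[OF m H] in auto)
  also have "\<dots> = (\<integral>\<^sup>+u. \<integral>\<^sup>+v. F v \<partial>sphere_uniform p \<partial>\<mu>)"
  proof (rule nn_integral_cong_AE)
    show "AE u in \<mu>. (\<integral>\<^sup>+v. H (u \<cdot>\<^sub>v (mat_sqrt \<Sigma> *\<^sub>v v)) \<partial>sphere_uniform p) = (\<integral>\<^sup>+v. F v \<partial>sphere_uniform p)"
      using \<mu>(3)
    proof eventually_elim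
      case (elim u)
      show ?case
      proof (rule nn_integral_cong_AE)
        show "AE v in sphere_uniform p. H (u \<cdot>\<^sub>v (mat_sqrt \<Sigma> *\<^sub>v v)) = F v"
          using AE_sphere_uniform_unit[OF p] AE_space by eventually_elim (use HF elim in simp)
      qed
    qed
  qed
  also have "\<dots> = (\<integral>\<^sup>+v. F v \<partial>sphere_uniform p)" using \<mu>.emeasure_space_1 by simp
  finally show ?thesis .
qed

lemma elliptical_cosine2_mgf:
  assumes E: "elliptical p \<Sigma> D" and p: "1 \<le> p" and e: "e \<in> carrier_vec p" "e \<bullet> e = 1" and l: "l < 1 / 2"
  shows "(\<integral>\<^sup>+x. ennreal (exp (l * (real p * cosine2 (mat_sqrt \<Sigma>) e x))) \<partial>D) \<le> ennreal (1 / sqrt (1 - 2 * l))"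
proof -
  note R = mat_sqrt_pos_def(1)[OF elliptical_pos_def[OF E]]
  note [measurable] = measurable_cosine2[OF R e(1)] measurable_scalar_prod_const[OF e(1)]
  have "(\<integral>\<^sup>+x. ennreal (exp (l * (real p * cosine2 (mat_sqrt \<Sigma>) e x))) \<partial>D) =
      (\<integral>\<^sup>+v. ennreal (exp (l * real p * (e \<bullet> v)\<^sup>2)) \<partial>sphere_uniform p)"
    by (rule elliptical_nn_integral[OF E p]) (use cosine2_sample[OF R _ _ _ e(1)] in \<open>auto simp: mult.assoc\<close>)
  also have "\<dots> \<le> ennreal (1 / sqrt (1 - 2 * l))" by (rule sphere_uniform_mgf[OF e l])
  finally show ?thesis .
qed

lemma elliptical_AE_nonzero:
  assumes E: "elliptical p \<Sigma> D" and p: "1 \<le> p"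
  shows "AE x in D. x \<noteq> 0\<^sub>v p"
proof -
  note R = mat_sqrt_pos_def(1)[OF elliptical_pos_def[OF E]]
  have Rc: "mat_sqrt \<Sigma> \<in> carrier_mat p p" using R by (simp add: pos_def_def)
  have m: "(\<lambda>v. v \<bullet> v) \<in> borel_measurable (vec_borel p)" by (rule measurable_scalar_prod[where p = p]) auto
  have "{0\<^sub>v p} = (\<lambda>v. v \<bullet> v) -` {0 :: real} \<inter> space (vec_borel p)"
    using vec_eq_zeroI by auto
  then have Z: "{0\<^sub>v p :: rvec} \<in> sets (vec_borel p)" using measurable_sets[OF m, of "{0}"] by simp
  have "(\<integral>\<^sup>+x. indicator {0\<^sub>v p} x \<partial>D) = (\<integral>\<^sup>+v. 0 \<partial>sphere_uniform p)"
  proof (rule elliptical_nn_integral[OF E p])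
    fix u :: real and v :: rvec assume u: "u \<noteq> 0" and v: "v \<in> carrier_vec p" "v \<bullet> v = 1"
    have "v \<noteq> 0\<^sub>v p" using v by auto
    then have "0 < v \<bullet> (mat_sqrt \<Sigma> *\<^sub>v v)" by (rule pos_def_gt[OF R v(1)])
    then have "v \<bullet> (u \<cdot>\<^sub>v (mat_sqrt \<Sigma> *\<^sub>v v)) \<noteq> 0" using u v Rc by simp
    then have "u \<cdot>\<^sub>v (mat_sqrt \<Sigma> *\<^sub>v v) \<noteq> 0\<^sub>v p" using v by auto
    then show "indicator {0\<^sub>v p} (u \<cdot>\<^sub>v (mat_sqrt \<Sigma> *\<^sub>v v)) = (0 :: ennreal)" by simp
  qed (use Z in auto)
  then have "emeasure D {0\<^sub>v p} = 0" using Z elliptical_sets[OF E] by simp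
  then show ?thesis using Z elliptical_sets[OF E] by (intro AE_I[where N = "{0\<^sub>v p}"]) auto
qed

text \<open>Markov's inequality for the product of the exponentials, with the tilting parameter
  absorbed into \<open>g\<close>, so that the same statement gives upper tails, lower tails and
  counts.\<close>

lemma chernoff_PiM:
  assumes D: "prob_space D" and g: "g \<in> borel_measurable D"
    and mgf: "(\<integral>\<^sup>+x. ennreal (exp (g x)) \<partial>D) \<le> ennreal b" and b: "0 \<le> b"
  shows "measure (\<Pi>\<^sub>M i\<in>{..<n}. D) {x \<in> space (\<Pi>\<^sub>M i\<in>{..<n}. D). a \<le> (\<Sum>i<n. g (x i))} \<le> b ^ n * exp (- a)"
    and "{x \<in> space (\<Pi>\<^sub>M i\<in>{..<n}. D). a \<le> (\<Sum>i<n. g (x i))} \<in> sets (\<Pi>\<^sub>M i\<in>{..<n}. D)"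
proof -
  let ?P = "\<Pi>\<^sub>M i\<in>{..<n :: nat}. D"
  let ?A = "{x \<in> space ?P. a \<le> (\<Sum>i<n. g (x i))}"
  interpret D: prob_space D by fact
  interpret P: product_prob_space "\<lambda>_ :: nat. D" "{..<n}" ..
  have fin: "finite_measure ?P" by (rule prob_space.finite_measure, rule prob_space_PiM, rule D)
  have gi: "(\<lambda>x. g (x i)) \<in> borel_measurable ?P" if "i < n" for i
  proof -
    have "(\<lambda>x. x i) \<in> measurable ?P D" using that by simp
    then show ?thesis using g by (rule measurable_compose)
  qed
  have sm: "(\<lambda>x. \<Sum>i<n. g (x i)) \<in> borel_measurable ?P"
    using gi by (intro borel_measurable_sum) auto
  then show "?A \<in> sets ?P" by measurable
  have "emeasure ?P ?A \<le> emeasure ?P {x \<in> space ?P. 1 \<le> ennreal (exp (- a)) * (\<Prod>i<n. ennreal (exp (g (x i))))}"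
  proof (rule emeasure_mono)
    have eq: "ennreal (exp (- a)) * (\<Prod>i<n. ennreal (exp (g (x i)))) = ennreal (exp ((\<Sum>i<n. g (x i)) - a))" for x
      by (simp add: prod_ennreal exp_sum[symmetric] ennreal_mult[symmetric] exp_add[symmetric] algebra_simps)
    show "?A \<subseteq> {x \<in> space ?P. 1 \<le> ennreal (exp (- a)) * (\<Prod>i<n. ennreal (exp (g (x i))))}"
      unfolding eq by (auto simp: ennreal_ge_1)
    have "(\<lambda>x. ennreal (exp ((\<Sum>i<n. g (x i)) - a))) \<in> borel_measurable ?P" using sm by measurable
    then show "{x \<in> space ?P. 1 \<le> ennreal (exp (- a)) * (\<Prod>i<n. ennreal (exp (g (x i))))} \<in> sets ?P"
      unfolding eq by measurable
  qed
  also have "\<dots> \<le> ennreal (exp (- a)) * (\<integral>\<^sup>+x. (\<Prod>i<n. ennreal (exp (g (x i)))) \<partial>?P)"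
  proof -
    let ?u = "\<lambda>x. \<Prod>i<n. ennreal (exp (g (x i)))"
    have "?u \<in> borel_measurable ?P"
      using gi by (intro borel_measurable_prod_ennreal) auto
    then have "emeasure ?P {x \<in> space ?P. 1 \<le> ennreal (exp (- a)) * ?u x} \<le>
        ennreal (exp (- a)) * (\<integral>\<^sup>+x. ?u x * indicator (space ?P) x \<partial>?P)"
      by (intro nn_integral_Markov_inequality) auto
    also have "(\<integral>\<^sup>+x. ?u x * indicator (space ?P) x \<partial>?P) = (\<integral>\<^sup>+x. ?u x \<partial>?P)"
      by (intro nn_integral_cong) simp
    finally show ?thesis .
  qed
  also have "(\<integral>\<^sup>+x. (\<Prod>i<n. ennreal (exp (g (x i)))) \<partial>?P) = (\<Prod>i<n. \<integral>\<^sup>+x. ennreal (exp (g x)) \<partial>D)"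
    using g by (intro P.product_nn_integral_prod) auto
  also have "ennreal (exp (- a)) * \<dots> \<le> ennreal (exp (- a)) * (\<Prod>i<n. ennreal b)"
  proof (rule mult_left_mono)
    show "(\<Prod>i<n. \<integral>\<^sup>+x. ennreal (exp (g x)) \<partial>D) \<le> (\<Prod>i<n. ennreal b)"
      using mgf by (induction n) (auto intro!: mult_mono)
  qed simp
  also have "\<dots> = ennreal (b ^ n * exp (- a))"
    using b by (simp add: ennreal_power ennreal_mult mult.commute)
  finally show "measure ?P ?A \<le> b ^ n * exp (- a)"
    using b by (simp add: finite_measure.emeasure_eq_measure[OF fin])
qed

text \<open>Minus half of \<open>ln (1 - 2 * l)\<close> is \<open>l\<close> up to a quadratic
  remainder; the bound \<open>2 * x\<^sup>2\<close> for the logarithm at \<open>x = - 2 * l\<close>,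
  halved, gives \<open>4 * l\<^sup>2\<close>.\<close>

lemma mgf_exponent_bound:
  fixes l :: real
  assumes "\<bar>l\<bar> \<le> 1 / 4"
  shows "1 / sqrt (1 - 2 * l) \<le> exp (l + 4 * l\<^sup>2)"
proof -
  have pos: "0 < 1 - 2 * l" using assms by linarith
  have "\<bar>ln (1 + (- 2 * l)) - (- 2 * l)\<bar> \<le> 2 * (- 2 * l)\<^sup>2"
    using assms by (intro abs_ln_one_plus_x_minus_x_bound) auto
  then have "- 2 * (l + 4 * l\<^sup>2) \<le> ln (1 - 2 * l)" by (simp add: abs_le_iff power2_eq_square algebra_simps)
  then have "exp (- 2 * (l + 4 * l\<^sup>2)) \<le> 1 - 2 * l" using pos by (metis exp_le_cancel_iff exp_ln)
  then have le: "sqrt (exp (- 2 * (l + 4 * l\<^sup>2))) \<le> sqrt (1 - 2 * l)" by simp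
  have eq: "sqrt (exp (- 2 * (l + 4 * l\<^sup>2))) = exp (- (l + 4 * l\<^sup>2))"
  proof (rule real_sqrt_unique)
    show "(exp (- (l + 4 * l\<^sup>2)))\<^sup>2 = exp (- 2 * (l + 4 * l\<^sup>2))"
      by (simp add: exp_double[symmetric] algebra_simps)
  qed simp
  from le have "exp (- (l + 4 * l\<^sup>2)) \<le> sqrt (1 - 2 * l)" unfolding eq .
  then have le': "1 / sqrt (1 - 2 * l) \<le> 1 / exp (- (l + 4 * l\<^sup>2))"
    using pos by (intro divide_left_mono) auto
  have eq': "1 / exp (- (l + 4 * l\<^sup>2)) = exp (l + 4 * l\<^sup>2)"
    by (subst exp_minus) (simp add: inverse_eq_divide)
  from le' show ?thesis unfolding eq' .
qed

abbreviation (input) iid :: "nat \<Rightarrow> 'a measure \<Rightarrow> (nat \<Rightarrow> 'a) measure" where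
  "iid n D \<equiv> \<Pi>\<^sub>M i\<in>{..<n}. D"

context
  fixes p :: nat and \<Sigma> :: rmat and D :: "rvec measure" and n :: nat
  assumes E: "elliptical p \<Sigma> D" and p: "1 \<le> p"
begin

lemma cosine2_measurable_D:
  "e \<in> carrier_vec p \<Longrightarrow> cosine2 (mat_sqrt \<Sigma>) e \<in> borel_measurable D"
  using measurable_cosine2[OF mat_sqrt_pos_def(1)[OF elliptical_pos_def[OF E]]]
    measurable_cong_sets[OF elliptical_sets[OF E] refl] by blast

lemma cosine2_sum_tail:
  fixes \<sigma> :: real
  assumes e: "e \<in> carrier_vec p" "e \<bullet> e = 1" and \<tau>: "0 < \<tau>" "\<tau> \<le> 1" and \<sigma>: "\<sigma> = 1 \<or> \<sigma> = - 1"
  defines "A \<equiv> {x \<in> space (iid n D). real n * \<tau> \<le> \<sigma> * ((\<Sum>i<n. real p * cosine2 (mat_sqrt \<Sigma>) e (x i)) - real n)}"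
  shows "measure (iid n D) A \<le> exp (- real n * \<tau>\<^sup>2 / 16)" and "A \<in> sets (iid n D)"
proof -
  \<comment> \<open>The minimizer of \<open>4 * l\<^sup>2 - \<sigma> * l * \<tau>\<close>, with
    value \<open>- \<tau>\<^sup>2 / 16\<close>; the linear term of the moment bound cancels against
    the mean \<open>real n\<close>.\<close>
  define l where "l = \<sigma> * \<tau> / 8"
  have l: "\<bar>l\<bar> \<le> 1 / 4" "l < 1 / 2" using \<tau> \<sigma> by (auto simp: l_def)
  let ?g = "\<lambda>x. l * (real p * cosine2 (mat_sqrt \<Sigma>) e x)"
  have m: "?g \<in> borel_measurable D" using cosine2_measurable_D[OF e(1)] by measurable
  have mgf: "(\<integral>\<^sup>+x. ennreal (exp (?g x)) \<partial>D) \<le> ennreal (exp (l + 4 * l\<^sup>2))"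
    using elliptical_cosine2_mgf[OF E p e l(2)] mgf_exponent_bound[OF l(1)] order_trans ennreal_leI by blast
  define a where "a = \<tau> / 8 * (real n * \<tau> + \<sigma> * real n)"
  have A: "A = {x \<in> space (iid n D). a \<le> (\<Sum>i<n. ?g (x i))}"
  proof -
    have "real n * \<tau> \<le> \<sigma> * (s - real n) \<longleftrightarrow> a \<le> l * s" for s
    proof -
      have "a \<le> l * s \<longleftrightarrow> \<tau> / 8 * (real n * \<tau> + \<sigma> * real n) \<le> \<tau> / 8 * (\<sigma> * s)" by (simp add: a_def l_def mult_ac)
      also have "\<dots> \<longleftrightarrow> real n * \<tau> + \<sigma> * real n \<le> \<sigma> * s" using \<tau> by (intro mult_le_cancel_left_pos) simp
      finally show ?thesis by (auto simp: algebra_simps)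
    qed
    then show ?thesis unfolding A_def by (simp add: sum_distrib_left)
  qed
  note ch = chernoff_PiM[OF elliptical_prob_space[OF E] m mgf, where n = n and a = a]
  show "A \<in> sets (iid n D)" unfolding A by (rule ch(2)) simp
  have "measure (iid n D) A \<le> exp (l + 4 * l\<^sup>2) ^ n * exp (- a)" unfolding A by (rule ch(1)) simp
  also have "\<dots> = exp (real n * (l + 4 * l\<^sup>2) - a)" by (simp add: exp_of_nat_mult[symmetric] exp_add[symmetric])
  also have "real n * (l + 4 * l\<^sup>2) - a = - real n * \<tau>\<^sup>2 / 16"
    using \<sigma> by (auto simp: a_def l_def power2_eq_square field_simps)
  finally show "measure (iid n D) A \<le> exp (- real n * \<tau>\<^sup>2 / 16)" .
qed

text \<open>Each small cosine is given weight three, so the event is that the weights sum to at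
  least \<open>n\<close>. The exponential of the weight is at most
  \<open>1 + exp (4 - 16384 * Q)\<close> with \<open>Q\<close> the rescaled squared cosine, and the
  moment bound at -16384 makes the mean at most 1 + 60 / 180, below \<open>exp (1 / 2)\<close>. This
  leaves the exponent \<open>n / 2 - n\<close>.\<close>

lemma small_cosine2_count:
  assumes e: "e \<in> carrier_vec p" "e \<bullet> e = 1"
  defines "A \<equiv> {x \<in> space (iid n D). real n \<le> 3 * real (card {i. i < n \<and> real p * cosine2 (mat_sqrt \<Sigma>) e (x i) < 1 / 16384})}"
  shows "measure (iid n D) A \<le> exp (- real n / 2)" and "A \<in> sets (iid n D)"
proof -
  interpret D: prob_space D by (rule elliptical_prob_space[OF E])
  let ?Q = "\<lambda>x. real p * cosine2 (mat_sqrt \<Sigma>) e x"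
  let ?g = "\<lambda>x. if ?Q x < 1 / 16384 then 3 else 0 :: real"
  have mQ: "?Q \<in> borel_measurable D" using cosine2_measurable_D[OF e(1)] by measurable
  then have m: "?g \<in> borel_measurable D" by measurable
  have mgf: "(\<integral>\<^sup>+x. ennreal (exp (?g x)) \<partial>D) \<le> ennreal (exp (1 / 2))"
  proof -
    have "(\<integral>\<^sup>+x. ennreal (exp (?g x)) \<partial>D) \<le> (\<integral>\<^sup>+x. 1 + ennreal (exp 4) * ennreal (exp ((- 16384) * ?Q x)) \<partial>D)"
    proof (rule nn_integral_mono)
      fix x
      have "exp (?g x) \<le> 1 + exp 4 * exp ((- 16384) * ?Q x)"
      proof (cases "?Q x < 1 / 16384")
        case True
        then have "3 \<le> 4 + (- 16384) * ?Q x" by simp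
        then have "exp 3 \<le> exp (4 + (- 16384) * ?Q x)" by simp
        then show ?thesis using True unfolding exp_add by simp
      qed simp
      then show "ennreal (exp (?g x)) \<le> 1 + ennreal (exp 4) * ennreal (exp ((- 16384) * ?Q x))"
        by (simp add: ennreal_mult[symmetric] ennreal_plus[symmetric] ennreal_1[symmetric] del: ennreal_plus ennreal_1)
    qed
    also have "\<dots> = 1 + ennreal (exp 4) * (\<integral>\<^sup>+x. ennreal (exp ((- 16384) * ?Q x)) \<partial>D)"
      using mQ by (subst nn_integral_add, simp_all, subst nn_integral_cmult, simp_all add: D.emeasure_space_1)
    also have "\<dots> \<le> 1 + ennreal (exp 4) * ennreal (1 / sqrt (1 - 2 * (- 16384)))"
      by (intro add_mono mult_left_mono elliptical_cosine2_mgf[OF E p e]) auto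
    also have "\<dots> = ennreal (1 + exp 4 * (1 / sqrt 32769))"
      by (simp add: ennreal_mult[symmetric] ennreal_plus[symmetric] ennreal_1[symmetric] del: ennreal_plus ennreal_1)
    also have "\<dots> \<le> ennreal (exp (1 / 2))"
    proof (rule ennreal_leI)
      have "exp 4 = (exp (1 :: real)) ^ 4" by (simp add: exp_of_nat_mult[symmetric])
      also have "\<dots> \<le> (272 / 100) ^ 4" using e_less_272 by (intro power_mono) auto
      also have "\<dots> \<le> 60" by (simp add: power4_eq_xxxx)
      finally have e4: "exp 4 \<le> (60 :: real)" .
      have "180 \<le> sqrt (32769 :: real)" by (rule real_le_rsqrt) simp
      then have "1 / sqrt 32769 \<le> (1 / 180 :: real)" by (intro divide_left_mono) auto
      with e4 have "exp 4 * (1 / sqrt 32769) \<le> 60 * (1 / 180 :: real)" by (intro mult_mono) auto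
      then show "1 + exp 4 * (1 / sqrt 32769) \<le> exp (1 / 2 :: real)"
        using exp_ge_add_one_self[of "1 / 2 :: real"] by linarith
    qed
    finally show ?thesis .
  qed
  have sum: "(\<Sum>i<n. ?g (x i)) = 3 * real (card {i. i < n \<and> ?Q (x i) < 1 / 16384})" for x
  proof -
    have "(\<Sum>i<n. ?g (x i)) = (\<Sum>i\<in>{i \<in> {..<n}. ?Q (x i) < 1 / 16384}. 3)"
      by (rule sum.inter_filter[symmetric]) simp
    then show ?thesis by simp
  qed
  note ch = chernoff_PiM[OF elliptical_prob_space[OF E] m mgf, where n = n and a = "real n"]
  have A: "A = {x \<in> space (iid n D). real n \<le> (\<Sum>i<n. ?g (x i))}" unfolding A_def sum ..
  show "A \<in> sets (iid n D)" unfolding A by (rule ch(2)) simp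
  have "measure (iid n D) A \<le> exp (1 / 2) ^ n * exp (- real n)" unfolding A by (rule ch(1)) simp
  also have "\<dots> = exp (- real n / 2)" by (simp add: exp_of_nat_mult[symmetric] exp_add[symmetric])
  finally show "measure (iid n D) A \<le> exp (- real n / 2)" .
qed

lemma AE_samples_nonzero: "AE x in iid n D. \<forall>i<n. x i \<noteq> 0\<^sub>v p"
proof -
  have "AE x in iid n D. x i \<noteq> 0\<^sub>v p" if "i < n" for i
  proof -
    have "AE y in distr (iid n D) D (\<lambda>x. x i). y \<noteq> 0\<^sub>v p"
      using that elliptical_AE_nonzero[OF E p] by (subst distr_PiM_component) (auto intro: elliptical_prob_space[OF E])
    then show ?thesis
      by (rule AE_distrD[rotated]) (use that in auto)
  qed
  then have "AE x in iid n D. \<forall>i\<in>{..<n}. x i \<noteq> 0\<^sub>v p" by (intro AE_finite_allI) auto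
  then show ?thesis by (simp add: Ball_def)
qed

end

section \<open>Nets\<close>

text \<open>A self-improving bound: with \<open>h\<close> the least admissible constant, passing
  from a unit vector \<open>e\<close> to its net vector \<open>a\<close> changes the form by the
  bilinear value at \<open>e - a\<close> and \<open>e + a\<close>, at most
  \<open>h * (1 / 4) * 2\<close>. Hence \<open>h \<le> \<tau> + h / 2\<close>. Net vectors need only
  lie in the unit ball.\<close>

lemma form_bound_net:
  assumes H: "symmetric p H" and \<tau>: "0 \<le> \<tau>"
    and net: "\<And>e. e \<in> carrier_vec p \<Longrightarrow> e \<bullet> e = 1 \<Longrightarrow>
      \<exists>a \<in> carrier_vec p. euclid_norm a \<le> 1 \<and> euclid_norm (e - a) \<le> 1 / 4 \<and> \<bar>a \<bullet> (H *\<^sub>v a)\<bar> \<le> \<tau>"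
  shows "form_bound p H (2 * \<tau>)"
proof -
  note Hc = symmetric_carrier[OF H]
  define \<D> where "\<D> = {d. 0 \<le> d \<and> form_bound p H d}"
  obtain d0 where d0: "d0 \<in> \<D>" using form_bound_exists[OF Hc] by (auto simp: \<D>_def intro: less_imp_le)
  define h where "h = Inf \<D>"
  have bdd: "bdd_below \<D>" by (rule bdd_belowI[of _ 0]) (simp add: \<D>_def)
  have h0: "0 \<le> h" unfolding h_def using d0 by (intro cInf_greatest) (auto simp: \<D>_def)
  have unit: "\<bar>e \<bullet> (H *\<^sub>v e)\<bar> \<le> h" if "e \<in> carrier_vec p" "e \<bullet> e = 1" for e
    unfolding h_def using d0 that by (intro cInf_greatest) (auto simp: \<D>_def form_bound_def)
  have scale: "form_bound p H d" if "\<And>e. e \<in> carrier_vec p \<Longrightarrow> e \<bullet> e = 1 \<Longrightarrow> \<bar>e \<bullet> (H *\<^sub>v e)\<bar> \<le> d" for d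
    unfolding form_bound_def
  proof
    fix x :: rvec assume x: "x \<in> carrier_vec p"
    show "\<bar>x \<bullet> (H *\<^sub>v x)\<bar> \<le> d * (x \<bullet> x)"
    proof (cases "x = 0\<^sub>v p")
      case True
      then show ?thesis using Hc by simp
    next
      case False
      let ?n = "euclid_norm x"
      have "x \<bullet> (H *\<^sub>v x) = (?n \<cdot>\<^sub>v normalized x) \<bullet> (H *\<^sub>v (?n \<cdot>\<^sub>v normalized x))"
        using smult_normalized[OF x False] by simp
      also have "\<dots> = ?n\<^sup>2 * (normalized x \<bullet> (H *\<^sub>v normalized x))"
        using x Hc by (simp add: mult_mat_vec[OF Hc] power2_eq_square)
      finally have "\<bar>x \<bullet> (H *\<^sub>v x)\<bar> = ?n\<^sup>2 * \<bar>normalized x \<bullet> (H *\<^sub>v normalized x)\<bar>" by (simp add: abs_mult)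
      also have "\<dots> \<le> ?n\<^sup>2 * d"
        using that[OF _ normalized_unit[OF x False]] x by (intro mult_left_mono) auto
      finally show ?thesis by (simp add: euclid_norm_square mult.commute)
    qed
  qed
  have hb: "form_bound p H h" by (rule scale) (rule unit)
  have "form_bound p H (\<tau> + h / 2)"
  proof (rule scale)
    fix e :: rvec assume e: "e \<in> carrier_vec p" "e \<bullet> e = 1"
    obtain a where a: "a \<in> carrier_vec p" "euclid_norm a \<le> 1" "euclid_norm (e - a) \<le> 1 / 4" "\<bar>a \<bullet> (H *\<^sub>v a)\<bar> \<le> \<tau>"
      using net[OF e] by blast
    have ne: "euclid_norm e = 1" using e by (simp add: euclid_norm_def)
    have c: "e - a \<in> carrier_vec p" "e + a \<in> carrier_vec p" using e a by auto
    have "(e - a) \<bullet> (H *\<^sub>v (e + a)) = e \<bullet> (H *\<^sub>v e) - a \<bullet> (H *\<^sub>v a)"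
      using e a Hc form_commute[OF H e(1) a(1)]
      by (simp add: mat_mult_vec_plus[OF Hc] scalar_prod_add_distrib[where n = p] minus_scalar_prod_distrib[where n = p])
    moreover have "\<bar>(e - a) \<bullet> (H *\<^sub>v (e + a))\<bar> \<le> h * euclid_norm (e - a) * euclid_norm (e + a)"
      by (rule form_bound_bilinear[OF H hb c])
    moreover have "h * euclid_norm (e - a) * euclid_norm (e + a) \<le> h * (1 / 4) * 2"
      using h0 a(2,3) euclid_norm_add[OF e(1) a(1)] ne by (intro mult_mono) auto
    ultimately show "\<bar>e \<bullet> (H *\<^sub>v e)\<bar> \<le> \<tau> + h / 2" using a(4) by linarith
  qed
  then have "\<tau> + h / 2 \<in> \<D>" using \<tau> h0 by (simp add: \<D>_def)
  then have "h \<le> \<tau> + h / 2" unfolding h_def using bdd by (intro cInf_lower)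
  then have "h \<le> 2 * \<tau>" by simp
  then show ?thesis by (rule form_bound_mono[OF hb])
qed

text \<open>Rounding towards zero rather than to the nearest integer keeps the rounded vector no
  longer than the original one, so lattice approximations stay in the unit ball.\<close>

lemma round_towards_zero: "\<exists>z :: int. \<bar>real_of_int z\<bar> \<le> \<bar>y\<bar> \<and> \<bar>y - real_of_int z\<bar> \<le> 1"
proof (cases "y \<ge> 0")
  case True
  then have "0 \<le> real_of_int \<lfloor>y\<rfloor>" by simp
  then show ?thesis using True by (intro exI[of _ "\<lfloor>y\<rfloor>"] conjI) linarith+
next
  case False
  then have "real_of_int \<lceil>y\<rceil> \<le> 0" by simp
  then show ?thesis using False by (intro exI[of _ "\<lceil>y\<rceil>"] conjI) linarith+
qed

abbreviation int_vec :: "nat \<Rightarrow> (nat \<Rightarrow> int) \<Rightarrow> rvec" where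
  "int_vec p z \<equiv> Matrix.vec p (\<lambda>i. real_of_int (z i))"

lemma lattice_approximation:
  assumes e: "e \<in> carrier_vec p" "e \<bullet> e = (1 :: real)" and K: "0 < K"
  obtains z where "z \<in> extensional {..<p}" "\<And>i. i < p \<Longrightarrow> \<bar>real_of_int (z i)\<bar> \<le> K"
    "(\<Sum>i<p. (real_of_int (z i))\<^sup>2) \<le> K\<^sup>2"
    "euclid_norm ((1 / K) \<cdot>\<^sub>v int_vec p z) \<le> 1"
    "euclid_norm (e - (1 / K) \<cdot>\<^sub>v int_vec p z) \<le> sqrt (real p) / K"
proof -
  define z where "z = (\<lambda>i\<in>{..<p}. SOME z :: int. \<bar>real_of_int z\<bar> \<le> \<bar>K * e $ i\<bar> \<and> \<bar>K * e $ i - real_of_int z\<bar> \<le> 1)"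
  have z: "\<bar>real_of_int (z i)\<bar> \<le> \<bar>K * e $ i\<bar>" "\<bar>K * e $ i - real_of_int (z i)\<bar> \<le> 1" if "i < p" for i
    using someI_ex[OF round_towards_zero[of "K * e $ i"]] that by (auto simp: z_def)
  have sum1: "(\<Sum>i<p. (e $ i)\<^sup>2) = 1" using e scalar_prod_self_sum[OF e(1)] by simp
  have zsq: "(real_of_int (z i))\<^sup>2 \<le> K\<^sup>2 * (e $ i)\<^sup>2" if "i < p" for i
  proof -
    have "\<bar>real_of_int (z i)\<bar>\<^sup>2 \<le> \<bar>K * e $ i\<bar>\<^sup>2" by (intro power_mono z that) simp
    then show ?thesis by (simp add: power_mult_distrib)
  qed
  have s: "(\<Sum>i<p. (real_of_int (z i))\<^sup>2) \<le> K\<^sup>2"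
  proof -
    have "(\<Sum>i<p. (real_of_int (z i))\<^sup>2) \<le> (\<Sum>i<p. K\<^sup>2 * (e $ i)\<^sup>2)" by (intro sum_mono zsq) simp
    then show ?thesis by (simp add: sum_distrib_left[symmetric] sum1)
  qed
  show ?thesis
  proof (rule that[of z])
    show "z \<in> extensional {..<p}" by (simp add: z_def)
    show "\<bar>real_of_int (z i)\<bar> \<le> K" if "i < p" for i
    proof -
      have "(real_of_int (z i))\<^sup>2 \<le> (\<Sum>i<p. (real_of_int (z i))\<^sup>2)"
        using that by (intro member_le_sum[where f = "\<lambda>i. (real_of_int (z i))\<^sup>2"]) auto
      with s have "(real_of_int (z i))\<^sup>2 \<le> K\<^sup>2" by linarith
      then show ?thesis using K by (simp add: abs_le_square_iff[symmetric])
    qed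
    show "(\<Sum>i<p. (real_of_int (z i))\<^sup>2) \<le> K\<^sup>2" by (rule s)
    have "euclid_norm (int_vec p z) \<le> K"
      unfolding euclid_norm_def using s K by (intro real_le_lsqrt) (auto simp: scalar_prod_self_sum[where p = p])
    then show "euclid_norm ((1 / K) \<cdot>\<^sub>v int_vec p z) \<le> 1" using K by (simp add: euclid_norm_smult)
    have "(e - (1 / K) \<cdot>\<^sub>v int_vec p z) \<bullet> (e - (1 / K) \<cdot>\<^sub>v int_vec p z) = (\<Sum>i<p. (e $ i - real_of_int (z i) / K)\<^sup>2)"
      using e by (subst scalar_prod_self_sum[where p = p]) auto
    also have "\<dots> \<le> (\<Sum>i<p. (1 / K)\<^sup>2)"
    proof (rule sum_mono)
      fix i assume "i \<in> {..<p}"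
      then have "\<bar>K * e $ i - real_of_int (z i)\<bar> / K \<le> 1 / K" using z(2)[of i] K by (simp add: divide_right_mono)
      moreover have "\<bar>K * e $ i - real_of_int (z i)\<bar> / K = \<bar>e $ i - real_of_int (z i) / K\<bar>"
      proof -
        have "e $ i - real_of_int (z i) / K = (K * e $ i - real_of_int (z i)) / K" using K by (simp add: field_simps)
        then show ?thesis using K by (simp add: abs_divide)
      qed
      ultimately have "\<bar>e $ i - real_of_int (z i) / K\<bar>\<^sup>2 \<le> (1 / K)\<^sup>2" by (intro power_mono) auto
      then show "(e $ i - real_of_int (z i) / K)\<^sup>2 \<le> (1 / K)\<^sup>2" by simp
    qed
    also have "\<dots> = real p * (1 / K)\<^sup>2" by simp
    finally show "euclid_norm (e - (1 / K) \<cdot>\<^sub>v int_vec p z) \<le> sqrt (real p) / K"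
      unfolding euclid_norm_def using K by (intro real_le_lsqrt) (auto simp: power_divide)
  qed
qed

text \<open>Integer vectors for the mesh \<open>1 / (4 * sqrt p)\<close>, which puts a net vector
  within 1/4 of every unit vector; being in the unit ball then reads \<open>16 * real p\<close>. The
  coordinate box makes finiteness evident, and zero is left out because the vectors are used after
  normalization.\<close>

definition coarse_net :: "nat \<Rightarrow> (nat \<Rightarrow> int) set" where
  "coarse_net p = {z \<in> {..<p} \<rightarrow>\<^sub>E {- 4 * int p..4 * int p}. (\<Sum>i<p. (real_of_int (z i))\<^sup>2) \<le> 16 * real p \<and> int_vec p z \<noteq> 0\<^sub>v p}"

text \<open>Mesh \<open>1 / (512 * p)\<close>, so that approximation errors are at most
  \<open>1 / (512 * sqrt p)\<close>, small compared with the cosines of order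
  \<open>1 / sqrt p\<close> that have to be told from zero.\<close>

definition fine_net :: "nat \<Rightarrow> (nat \<Rightarrow> int) set" where
  "fine_net p = {z \<in> {..<p} \<rightarrow>\<^sub>E {- 512 * int p..512 * int p}. int_vec p z \<noteq> 0\<^sub>v p}"

lemma finite_coarse_net: "finite (coarse_net p)" and finite_fine_net: "finite (fine_net p)"
  by (auto simp: coarse_net_def fine_net_def intro: finite_subset[OF _ finite_PiE[of "{..<p}"]])

lemma sum_half_powers: "(\<Sum>j\<in>{- int m..int m}. (1 / 2 :: real) ^ nat \<bar>j\<bar>) = 3 - 2 * (1 / 2) ^ m"
proof (induction m)
  case (Suc m)
  have "{- int (Suc m)..int (Suc m)} = insert (- int (Suc m)) (insert (int (Suc m)) {- int m..int m})" by auto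
  then have "(\<Sum>j\<in>{- int (Suc m)..int (Suc m)}. (1 / 2 :: real) ^ nat \<bar>j\<bar>) =
      (1 / 2) ^ Suc m + ((1 / 2) ^ Suc m + (\<Sum>j\<in>{- int m..int m}. (1 / 2 :: real) ^ nat \<bar>j\<bar>))"
    by (simp add: nat_add_distrib)
  then show ?case using Suc by simp
qed simp

text \<open>Weighting each lattice point by \<open>2 ^ (16 p - \<Sum>\<bar>z i\<bar>) \<ge> 1\<close> turns the count into a product of geometric sums.\<close>

lemma card_coarse_net: "real (card (coarse_net p)) \<le> exp (18 * real p)"
proof -
  let ?Z = "{..<p} \<rightarrow>\<^sub>E {- 4 * int p..4 * int p}"
  have "real (card (coarse_net p)) = (\<Sum>z\<in>coarse_net p. 1)" by simp
  also have "\<dots> \<le> (\<Sum>z\<in>coarse_net p. 2 ^ (16 * p) * (\<Prod>i<p. (1 / 2) ^ nat \<bar>z i\<bar>))"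
  proof (rule sum_mono)
    fix z assume z: "z \<in> coarse_net p"
    have "real (\<Sum>i<p. nat \<bar>z i\<bar>) \<le> (\<Sum>i<p. (real_of_int (z i))\<^sup>2)"
    proof -
      have "real (nat \<bar>k\<bar>) \<le> (real_of_int k)\<^sup>2" for k :: int
      proof -
        have "\<bar>k\<bar> \<le> k\<^sup>2"
        proof (cases "k = 0")
          case False
          then have "\<bar>k\<bar> * 1 \<le> \<bar>k\<bar> * \<bar>k\<bar>" by (intro mult_left_mono) auto
          then show ?thesis by (simp add: power2_eq_square)
        qed simp
        then have "real_of_int \<bar>k\<bar> \<le> real_of_int (k\<^sup>2)" by (rule of_int_le_iff[THEN iffD2])
        then show ?thesis by simp
      qed
      then show ?thesis by (simp add: sum_mono)
    qed
    also have "\<dots> \<le> 16 * real p" using z by (simp add: coarse_net_def)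
    finally have "real (\<Sum>i<p. nat \<bar>z i\<bar>) \<le> real (16 * p)" by simp
    then have "(\<Sum>i<p. nat \<bar>z i\<bar>) \<le> 16 * p" by (rule of_nat_le_iff[THEN iffD1])
    then have "(2 :: real) ^ (\<Sum>i<p. nat \<bar>z i\<bar>) \<le> 2 ^ (16 * p)" by (intro power_increasing) auto
    moreover have "(\<Prod>i<p. (1 / 2 :: real) ^ nat \<bar>z i\<bar>) = 1 / 2 ^ (\<Sum>i<p. nat \<bar>z i\<bar>)"
      by (simp add: power_sum power_one_over prod_dividef)
    ultimately show "1 \<le> (2 :: real) ^ (16 * p) * (\<Prod>i<p. (1 / 2) ^ nat \<bar>z i\<bar>)"
      by simp
  qed
  also have "\<dots> \<le> (\<Sum>z\<in>?Z. 2 ^ (16 * p) * (\<Prod>i<p. (1 / 2) ^ nat \<bar>z i\<bar>))"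
    by (intro sum_mono2 finite_PiE) (auto simp: coarse_net_def prod_nonneg)
  also have "\<dots> = 2 ^ (16 * p) * (\<Prod>i<p. \<Sum>j\<in>{- 4 * int p..4 * int p}. (1 / 2) ^ nat \<bar>j\<bar>)"
    by (subst prod_sum_PiE) (auto simp: sum_distrib_left)
  also have "\<dots> \<le> 2 ^ (16 * p) * (\<Prod>i<p. 4)"
  proof -
    have "(\<Sum>j\<in>{- 4 * int p..4 * int p}. (1 / 2 :: real) ^ nat \<bar>j\<bar>) = 3 - 2 * (1 / 2) ^ (4 * p)"
      using sum_half_powers[of "4 * p"] by simp
    moreover have "0 \<le> (1 / 2 :: real) ^ (4 * p)" by (rule zero_le_power) simp
    ultimately have "(\<Sum>j\<in>{- 4 * int p..4 * int p}. (1 / 2 :: real) ^ nat \<bar>j\<bar>) \<le> 4" by linarith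
    then show ?thesis by (intro mult_left_mono prod_mono) (auto intro: sum_nonneg)
  qed
  also have "\<dots> = 2 ^ (18 * p)"
  proof -
    have "(4 :: real) = 2 ^ 2" by simp
    then have "(\<Prod>i<p. 4 :: real) = 2 ^ (2 * p)" by (simp add: power_mult)
    moreover have "18 * p = 16 * p + 2 * p" by simp
    ultimately show ?thesis by (metis power_add)
  qed
  also have "(2 :: real) ^ (18 * p) \<le> exp 1 ^ (18 * p)"
    using exp_ge_add_one_self[of "1 :: real"] by (intro power_mono) auto
  also have "\<dots> = exp (18 * real p)" by (simp add: exp_of_nat_mult[symmetric])
  finally show ?thesis .
qed

text \<open>The estimate of \<open>1 + y\<close> by the exponential is generous, but an exponent of
  order p^2 is affordable: every point of this net fails with probability at most
  \<open>exp (- real n / 2)\<close>, and \<open>n\<close> is a large multiple of p^2.\<close>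

lemma card_fine_net: "real (card (fine_net p)) \<le> exp (1024 * (real p)\<^sup>2)"
proof -
  have "card (fine_net p) \<le> card ({..<p} \<rightarrow>\<^sub>E {- 512 * int p..512 * int p})"
    by (intro card_mono finite_PiE) (auto simp: fine_net_def)
  also have "\<dots> = (1024 * p + 1) ^ p" by (simp add: card_PiE nat_add_distrib nat_mult_distrib)
  finally have "real (card (fine_net p)) \<le> (1 + 1024 * real p) ^ p"
    by (metis (mono_tags, lifting) add.commute of_nat_1 of_nat_add of_nat_le_iff of_nat_mult of_nat_numeral of_nat_power)
  also have "\<dots> \<le> exp (1024 * real p) ^ p"
    by (intro power_mono exp_ge_add_one_self) auto
  also have "\<dots> = exp (1024 * (real p)\<^sup>2)" by (simp add: exp_of_nat_mult[symmetric] power2_eq_square mult_ac)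
  finally show ?thesis .
qed

text \<open>A sample with cosine at least 1 / (128 sqrt p) to the direction of a fine net vector has
  inner product at least 1 / (256 sqrt p) with that vector, whose length is at least 1/2. Moving to
  the approximated unit vector loses at most 1 / (512 sqrt p) and leaves 1 / (512 sqrt p), whose
  square is 1 / (2^18 p). So the bad samples of any unit vector are among the bad samples of a net
  direction.\<close>

lemma tyler_sample_from_nets:
  assumes p: "1 \<le> p" and n: "0 < n" and R: "pos_def p R"
    and x: "\<And>i. i < n \<Longrightarrow> x i \<in> carrier_vec p" "\<And>i. i < n \<Longrightarrow> x i \<noteq> 0\<^sub>v p"
    and \<tau>: "0 < \<tau>"
    and coarse: "\<And>z. z \<in> coarse_net p \<Longrightarrow>
      \<bar>(\<Sum>i<n. real p * cosine2 R (normalized (int_vec p z)) (x i)) - real n\<bar> \<le> real n * \<tau>"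
    and fine: "\<And>z. z \<in> fine_net p \<Longrightarrow>
      3 * real (card {i. i < n \<and> real p * cosine2 R (normalized (int_vec p z)) (x i) < 1 / 16384}) < real n"
  shows "tyler_sample p n (\<lambda>i. normalized (mat_inv R *\<^sub>v x i)) (1 / 2 ^ 38) (2 * \<tau>)"
proof -
  define v where "v i = normalized (mat_inv R *\<^sub>v x i)" for i
  have Rx: "mat_inv R *\<^sub>v x i \<in> carrier_vec p" "mat_inv R *\<^sub>v x i \<noteq> 0\<^sub>v p" if "i < n" for i
  proof -
    show "mat_inv R *\<^sub>v x i \<in> carrier_vec p" by (rule pos_def_inverse_vec(1)[OF R x(1)[OF that]])
    show "mat_inv R *\<^sub>v x i \<noteq> 0\<^sub>v p"
      using pos_def_gt[OF pos_def_mat_inv[OF R] x(1)[OF that] x(2)[OF that]] x(1)[OF that] by auto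
  qed
  have v: "v i \<in> carrier_vec p" "v i \<bullet> v i = 1" if "i < n" for i
    using Rx[OF that] normalized_unit[OF Rx[OF that]] by (auto simp: v_def)
  have cos: "cosine2 R e (x i) = (v i \<bullet> e)\<^sup>2" if "i < n" "e \<in> carrier_vec p" for i e
    using comm_scalar_prod[OF v(1)[OF that(1)] that(2)] by (simp add: cosine2_def v_def)
  have nv: "euclid_norm (v i) = 1" if "i < n" for i using v[OF that] by (simp add: euclid_norm_def)
  have sp: "0 < sqrt (real p)" "sqrt (real p) * sqrt (real p) = real p" using p by auto
  have split: "(1 / K) \<cdot>\<^sub>v int_vec p z = euclid_norm ((1 / K) \<cdot>\<^sub>v int_vec p z) \<cdot>\<^sub>v normalized (int_vec p z)"
    if "0 < K" "int_vec p z \<noteq> 0\<^sub>v p" for K z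
  proof -
    have "0 < euclid_norm (int_vec p z)" by (rule euclid_norm_pos[OF _ that(2)]) simp
    then show ?thesis using that by (intro eq_vecI) (auto simp: normalized_def euclid_norm_smult)
  qed
  have nonzero: "int_vec p z \<noteq> 0\<^sub>v p"
    if "e \<in> carrier_vec p" "e \<bullet> e = 1" "euclid_norm (e - (1 / K) \<cdot>\<^sub>v int_vec p z) < 1" for e K z
  proof
    assume "int_vec p z = 0\<^sub>v p"
    then have "e - (1 / K) \<cdot>\<^sub>v int_vec p z = e" using that(1) by (intro eq_vecI) auto
    with that show False by (simp add: euclid_norm_def)
  qed
  have second: "form_bound p (scatter p n v (\<lambda>_. 1) - 1\<^sub>m p) (2 * \<tau>)"
  proof (rule form_bound_net)
    let ?H = "scatter p n v (\<lambda>_. 1) - 1\<^sub>m p"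
    show "symmetric p ?H" by (intro symmetric_minus scatter_symmetric symmetric_one)
    show "0 \<le> \<tau>" using \<tau> by simp
    fix e :: rvec assume e: "e \<in> carrier_vec p" "e \<bullet> e = 1"
    let ?K = "4 * sqrt (real p)"
    have K: "0 < ?K" using sp by simp
    obtain z where z: "z \<in> extensional {..<p}" "\<And>i. i < p \<Longrightarrow> \<bar>real_of_int (z i)\<bar> \<le> ?K"
      "(\<Sum>i<p. (real_of_int (z i))\<^sup>2) \<le> ?K\<^sup>2"
      and a1: "euclid_norm ((1 / ?K) \<cdot>\<^sub>v int_vec p z) \<le> 1"
      and a2: "euclid_norm (e - (1 / ?K) \<cdot>\<^sub>v int_vec p z) \<le> sqrt (real p) / ?K"
      using lattice_approximation[OF e K] by blast
    have a2': "euclid_norm (e - (1 / ?K) \<cdot>\<^sub>v int_vec p z) \<le> 1 / 4" using a2 sp(1) by simp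
    then have nz: "int_vec p z \<noteq> 0\<^sub>v p" by (intro nonzero[OF e, where K = ?K]) simp
    have "sqrt (real p) \<le> real p" using p by (simp add: sqrt_le_D real_le_lsqrt power2_eq_square)
    then have zb: "\<bar>real_of_int (z i)\<bar> \<le> 4 * real p" if "i < p" for i using z(2)[OF that] by linarith
    have "z i \<in> {- 4 * int p..4 * int p}" if "i < p" for i
    proof -
      have "real_of_int \<bar>z i\<bar> \<le> real_of_int (4 * int p)" using zb[OF that] by simp
      then have "\<bar>z i\<bar> \<le> 4 * int p" by (rule of_int_le_iff[THEN iffD1])
      then show ?thesis by auto
    qed
    then have zc: "z \<in> coarse_net p"
      using z nz by (auto simp: coarse_net_def PiE_iff power_mult_distrib)
    define \<nu> where "\<nu> = normalized (int_vec p z)"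
    have \<nu>: "\<nu> \<in> carrier_vec p" "\<nu> \<bullet> \<nu> = 1" unfolding \<nu>_def by (auto intro!: normalized_unit[OF _ nz])
    define r where "r = euclid_norm ((1 / ?K) \<cdot>\<^sub>v int_vec p z)"
    have a: "(1 / ?K) \<cdot>\<^sub>v int_vec p z = r \<cdot>\<^sub>v \<nu>" unfolding r_def \<nu>_def by (rule split[OF K nz])
    have Hc: "?H \<in> carrier_mat p p" by simp
    have "\<nu> \<bullet> (?H *\<^sub>v \<nu>) = real p / real n * (\<Sum>i<n. (v i \<bullet> \<nu>)\<^sup>2) - 1"
      using scatter_form[where n = n and v = v and w = "\<lambda>_. 1", OF v(1) \<nu>(1) \<nu>(1)] \<nu>
      by (simp add: form_minus[where p = p] power2_eq_square)
    also have "\<dots> = ((\<Sum>i<n. real p * cosine2 R \<nu> (x i)) - real n) / real n"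
      using n cos \<nu>(1) by (simp add: sum_distrib_left[symmetric] field_simps)
    finally have "\<bar>\<nu> \<bullet> (?H *\<^sub>v \<nu>)\<bar> = \<bar>(\<Sum>i<n. real p * cosine2 R \<nu> (x i)) - real n\<bar> / real n" by simp
    also have "\<dots> \<le> \<tau>"
      using coarse[OF zc] n by (simp add: \<nu>_def[symmetric] field_simps)
    finally have H\<nu>: "\<bar>\<nu> \<bullet> (?H *\<^sub>v \<nu>)\<bar> \<le> \<tau>" .
    \<comment> \<open>The hypothesis concerns the normalized lattice vector; the net vector is
      \<open>r\<close> times it, which multiplies the form by \<open>r * r\<close>.\<close>
    have "r * r \<le> 1 * 1" using a1 by (intro mult_mono) (auto simp: r_def)
    then have "\<bar>r * r\<bar> * \<bar>\<nu> \<bullet> (?H *\<^sub>v \<nu>)\<bar> \<le> 1 * \<tau>" using H\<nu> by (intro mult_mono) auto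
    then have "\<bar>(r \<cdot>\<^sub>v \<nu>) \<bullet> (?H *\<^sub>v (r \<cdot>\<^sub>v \<nu>))\<bar> \<le> \<tau>"
      using \<nu> Hc by (simp add: mult_mat_vec[OF Hc] abs_mult mult.assoc)
    then show "\<exists>a \<in> carrier_vec p. euclid_norm a \<le> 1 \<and> euclid_norm (e - a) \<le> 1 / 4 \<and> \<bar>a \<bullet> (?H *\<^sub>v a)\<bar> \<le> \<tau>"
      using a1 a2' a \<nu> by (intro bexI[of _ "r \<cdot>\<^sub>v \<nu>"]) auto
  qed
  define B where "B e = {i. i < n \<and> (v i \<bullet> e)\<^sup>2 < 1 / (2 ^ 18 * real p)}" for e
  have B: "3 * real (card (B e)) < real n" if e: "e \<in> carrier_vec p" "e \<bullet> e = 1" for e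
  proof -
    let ?K = "512 * real p"
    have K: "0 < ?K" using p by simp
    obtain z where z: "z \<in> extensional {..<p}" "\<And>i. i < p \<Longrightarrow> \<bar>real_of_int (z i)\<bar> \<le> ?K"
      and a2: "euclid_norm (e - (1 / ?K) \<cdot>\<^sub>v int_vec p z) \<le> sqrt (real p) / ?K"
      using lattice_approximation[OF e K] by blast
    define s where "s = sqrt (real p)"
    have s: "0 < s" "s * s = real p" "1 \<le> s" using p by (auto simp: s_def)
    have ssq: "(s * \<bar>y\<bar>)\<^sup>2 = real p * y\<^sup>2" for y
      by (simp add: power_mult_distrib s_def)
    have a2': "s * euclid_norm (e - (1 / ?K) \<cdot>\<^sub>v int_vec p z) \<le> 1 / 512"
    proof -
      have "s * euclid_norm (e - (1 / ?K) \<cdot>\<^sub>v int_vec p z) \<le> s * (s / ?K)"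
        using a2 s by (intro mult_left_mono) (auto simp: s_def)
      also have "\<dots> = 1 / 512" using p s by simp
      finally show ?thesis .
    qed
    have "1 * euclid_norm (e - (1 / ?K) \<cdot>\<^sub>v int_vec p z) \<le> s * euclid_norm (e - (1 / ?K) \<cdot>\<^sub>v int_vec p z)"
      by (rule mult_right_mono) (use s in auto)
    with a2' have a3: "euclid_norm (e - (1 / ?K) \<cdot>\<^sub>v int_vec p z) \<le> 1 / 512" by simp
    then have nz: "int_vec p z \<noteq> 0\<^sub>v p" by (intro nonzero[OF e, where K = ?K]) simp
    have "z i \<in> {- 512 * int p..512 * int p}" if "i < p" for i
    proof -
      have "real_of_int \<bar>z i\<bar> \<le> real_of_int (512 * int p)" using z(2)[OF that] by simp
      then have "\<bar>z i\<bar> \<le> 512 * int p" by (rule of_int_le_iff[THEN iffD1])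
      then show ?thesis by auto
    qed
    then have zf: "z \<in> fine_net p" using z nz by (auto simp: fine_net_def PiE_iff)
    define \<nu> where "\<nu> = normalized (int_vec p z)"
    have \<nu>: "\<nu> \<in> carrier_vec p" by (simp add: \<nu>_def)
    define a where "a = (1 / ?K) \<cdot>\<^sub>v int_vec p z"
    have ac: "a \<in> carrier_vec p" by (simp add: a_def)
    have a: "a = euclid_norm a \<cdot>\<^sub>v \<nu>" unfolding a_def \<nu>_def by (rule split[OF K nz])
    have "euclid_norm e \<le> euclid_norm (e - a) + euclid_norm a"
    proof -
      have "e = (e - a) + a" using e ac by (intro eq_vecI) auto
      then show ?thesis using euclid_norm_add[of "e - a" p a] e ac by simp
    qed
    then have na: "1 / 2 \<le> euclid_norm a" using a3 e by (simp add: a_def euclid_norm_def)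
    have "B e \<subseteq> {i. i < n \<and> real p * cosine2 R \<nu> (x i) < 1 / 16384}"
    proof
      fix i assume "i \<in> B e"
      then have i: "i < n" and sm: "(v i \<bullet> e)\<^sup>2 < 1 / (2 ^ 18 * real p)" by (auto simp: B_def)
      have "real p * cosine2 R \<nu> (x i) < 1 / 16384"
      proof (rule ccontr)
        assume "\<not> real p * cosine2 R \<nu> (x i) < 1 / 16384"
        then have "1 / 16384 \<le> (s * \<bar>v i \<bullet> \<nu>\<bar>)\<^sup>2" unfolding ssq cos[OF i \<nu>] by linarith
        moreover have "(1 / 128)\<^sup>2 = (1 / 16384 :: real)" by (simp add: power_divide)
        ultimately have "(1 / 128)\<^sup>2 \<le> (s * \<bar>v i \<bullet> \<nu>\<bar>)\<^sup>2" by linarith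
        then have "1 / 128 \<le> s * \<bar>v i \<bullet> \<nu>\<bar>"
          by (rule power2_le_imp_le) (use s(1) in simp)
        then have "(1 / 2) * (1 / 128) \<le> euclid_norm a * (s * \<bar>v i \<bullet> \<nu>\<bar>)" using na by (intro mult_mono) auto
        moreover have "\<bar>v i \<bullet> a\<bar> = euclid_norm a * \<bar>v i \<bullet> \<nu>\<bar>"
          by (subst a) (use v(1)[OF i] \<nu> in \<open>simp add: abs_mult\<close>)
        ultimately have va: "1 / 256 \<le> s * \<bar>v i \<bullet> a\<bar>" by (simp add: mult_ac)
        have "v i \<bullet> (e - a) = v i \<bullet> e - v i \<bullet> a"
          using v(1)[OF i] e ac by (simp add: scalar_prod_minus_distrib[where n = p])
        then have "\<bar>v i \<bullet> a\<bar> \<le> \<bar>v i \<bullet> e\<bar> + euclid_norm (e - a)"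
          using abs_scalar_prod_le[OF v(1)[OF i], of "e - a"] nv[OF i] e ac by simp
        then have "s * \<bar>v i \<bullet> a\<bar> \<le> s * (\<bar>v i \<bullet> e\<bar> + euclid_norm (e - a))" using s by (intro mult_left_mono) auto
        also have "\<dots> = s * \<bar>v i \<bullet> e\<bar> + s * euclid_norm (e - a)" by (simp add: distrib_left)
        finally have "1 / 512 \<le> s * \<bar>v i \<bullet> e\<bar>" using va a2'[folded a_def] by linarith
        then have "(1 / 512)\<^sup>2 \<le> (s * \<bar>v i \<bullet> e\<bar>)\<^sup>2" by (intro power_mono) auto
        moreover have "(1 / 512)\<^sup>2 = (1 / 2 ^ 18 :: real)" by (simp add: power_divide)
        ultimately have "1 / 2 ^ 18 \<le> real p * (v i \<bullet> e)\<^sup>2" unfolding ssq by linarith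
        with sm show False using p by (simp add: field_simps)
      qed
      with i show "i \<in> {i. i < n \<and> real p * cosine2 R \<nu> (x i) < 1 / 16384}" by simp
    qed
    then have "card (B e) \<le> card {i. i < n \<and> real p * cosine2 R \<nu> (x i) < 1 / 16384}"
      by (intro card_mono) auto
    with fine[OF zf] show ?thesis by (simp add: \<nu>_def[symmetric])
  qed
  let ?q = "1 / (2 ^ 18 * real p)"
  have cross_unit: "1 / 2 ^ 38 / real p \<le> real p / real n * (\<Sum>i<n. (v i \<bullet> e)\<^sup>2 * (v i \<bullet> f)\<^sup>2)"
    if e: "e \<in> carrier_vec p" "e \<bullet> e = 1" and f: "f \<in> carrier_vec p" "f \<bullet> f = 1" for e f
  proof -
    \<comment> \<open>Either bad set contains less than a third of the samples, so more than a third
      is good for both directions.\<close>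
    let ?G = "{..<n} - (B e \<union> B f)"
    have finB: "finite (B g)" "B g \<subseteq> {..<n}" for g by (auto simp: B_def)
    have "real n - real (card (B e \<union> B f)) = real (card ?G)"
    proof -
      have "card ?G = n - card (B e \<union> B f)" using finB by (subst card_Diff_subset) auto
      moreover have "card (B e \<union> B f) \<le> n" using finB card_mono[of "{..<n}" "B e \<union> B f"] by simp
      ultimately show ?thesis by simp
    qed
    moreover have "real (card (B e \<union> B f)) \<le> real (card (B e)) + real (card (B f))"
      using card_Un_le[of "B e" "B f"] by linarith
    ultimately have G: "real n / 3 \<le> real (card ?G)" using B[OF e] B[OF f] by linarith
    have "real n / 3 * (?q * ?q) \<le> real (card ?G) * (?q * ?q)" using G by (intro mult_right_mono) auto
    also have "\<dots> = (\<Sum>i\<in>?G. ?q * ?q)" by simp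
    also have "\<dots> \<le> (\<Sum>i\<in>?G. (v i \<bullet> e)\<^sup>2 * (v i \<bullet> f)\<^sup>2)"
      by (intro sum_mono mult_mono) (auto simp: B_def)
    also have "\<dots> \<le> (\<Sum>i<n. (v i \<bullet> e)\<^sup>2 * (v i \<bullet> f)\<^sup>2)" by (intro sum_mono2) auto
    finally have "real p / real n * (real n / 3 * (?q * ?q)) \<le> real p / real n * (\<Sum>i<n. (v i \<bullet> e)\<^sup>2 * (v i \<bullet> f)\<^sup>2)"
      by (intro mult_left_mono) auto
    \<comment> \<open>The product is 1 / (3 * 2^36 * p); the factor 3 is rounded up to 4.\<close>
    moreover have "1 / 2 ^ 38 / real p \<le> real p / real n * (real n / 3 * (?q * ?q))"
      using p n by (simp add: field_simps)
    ultimately show ?thesis by linarith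
  qed
  show ?thesis
    unfolding v_def[symmetric]
  proof (unfold_locales)
    show "1 / 2 ^ 38 / real p * (e \<bullet> e) * (f \<bullet> f) \<le> real p / real n * (\<Sum>i<n. (v i \<bullet> e)\<^sup>2 * (v i \<bullet> f)\<^sup>2)"
      if e: "e \<in> carrier_vec p" and f: "f \<in> carrier_vec p" for e f
    proof (cases "e = 0\<^sub>v p \<or> f = 0\<^sub>v p")
      case True
      then have "(e \<bullet> e) * (f \<bullet> f) = 0" by auto
      then show ?thesis by (simp only: mult.assoc) (simp add: sum_nonneg)
    next
      case False
      then have ne: "e \<noteq> 0\<^sub>v p" "f \<noteq> 0\<^sub>v p" by auto
      have vs: "(v i \<bullet> g)\<^sup>2 = (g \<bullet> g) * (v i \<bullet> normalized g)\<^sup>2" if "i < n" "g \<in> carrier_vec p" "g \<noteq> 0\<^sub>v p" for i g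
      proof -
        have "v i \<bullet> g = v i \<bullet> (euclid_norm g \<cdot>\<^sub>v normalized g)" by (simp add: smult_normalized[OF that(2,3)])
        also have "\<dots> = euclid_norm g * (v i \<bullet> normalized g)" using v(1)[OF that(1)] that(2) by simp
        finally show ?thesis by (simp add: power_mult_distrib euclid_norm_square)
      qed
      have "1 / 2 ^ 38 / real p * ((e \<bullet> e) * (f \<bullet> f)) \<le>
          real p / real n * (\<Sum>i<n. (v i \<bullet> normalized e)\<^sup>2 * (v i \<bullet> normalized f)\<^sup>2) * ((e \<bullet> e) * (f \<bullet> f))"
        using e f by (intro mult_right_mono cross_unit normalized_unit[OF e ne(1)] normalized_unit[OF f ne(2)])
          (auto intro: mult_nonneg_nonneg scalar_prod_self_nonneg)
      also have "\<dots> = real p / real n * (\<Sum>i<n. (v i \<bullet> e)\<^sup>2 * (v i \<bullet> f)\<^sup>2)"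
        using vs[OF _ e ne(1)] vs[OF _ f ne(2)] by (simp add: sum_distrib_left sum_distrib_right mult_ac)
      finally show ?thesis by (simp add: mult.assoc)
    qed
  qed (use p n v second in auto)
qed

section \<open>Measurability of the event\<close>

text \<open>On a compact set a nonnegative continuous function has a zero as soon as it takes
  arbitrarily small values, and small values can be looked for on a countable dense subset. An
  uncountable union thus becomes a countable combination of measurable sets.\<close>

lemma measurable_exists_zero:
  fixes K :: "'k :: {metric_space, second_countable_topology} set" and g :: "'x \<Rightarrow> 'k \<Rightarrow> real"
  assumes K: "compact K" and cont: "\<And>x. x \<in> space M \<Longrightarrow> continuous_on K (g x)"
    and meas: "\<And>k. k \<in> K \<Longrightarrow> (\<lambda>x. g x k) \<in> borel_measurable M"
    and nonneg: "\<And>x k. 0 \<le> g x k"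
  shows "{x \<in> space M. \<exists>k\<in>K. g x k = 0} \<in> sets M"
proof -
  obtain C where C: "countable C" "C \<subseteq> K" "K \<subseteq> closure C" using separable[of K] by blast
  have "(\<exists>k\<in>K. g x k = 0) \<longleftrightarrow> (\<forall>j :: nat. \<exists>k\<in>C. g x k < 1 / real (Suc j))" if x: "x \<in> space M" for x
  proof
    assume "\<exists>k\<in>K. g x k = 0"
    then obtain k where k: "k \<in> K" "g x k = 0" by blast
    show "\<forall>j :: nat. \<exists>k\<in>C. g x k < 1 / real (Suc j)"
    proof
      fix j :: nat
      obtain d where d: "d > 0" "\<And>y. y \<in> K \<Longrightarrow> dist y k < d \<Longrightarrow> dist (g x y) (g x k) < 1 / real (Suc j)"
        using cont[OF x, unfolded continuous_on_iff, rule_format, OF k(1), of "1 / real (Suc j)"] by auto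
      obtain y where "y \<in> C" "dist y k < d" using k(1) C(3) d(1) closure_approachable by blast
      with d(2)[of y] k(2) C(2) have "dist (g x y) 0 < 1 / real (Suc j)" by auto
      then show "\<exists>k\<in>C. g x k < 1 / real (Suc j)" using \<open>y \<in> C\<close> by (intro bexI[of _ y]) (simp_all add: dist_real_def)
    qed
  next
    assume *: "\<forall>j :: nat. \<exists>k\<in>C. g x k < 1 / real (Suc j)"
    then have "K \<noteq> {}" using C(2) by blast
    then obtain k where k: "k \<in> K" "\<And>y. y \<in> K \<Longrightarrow> g x k \<le> g x y"
      using continuous_attains_inf[OF K _ cont[OF x]] by blast
    have "g x k < 1 / real (Suc j)" for j
    proof -
      obtain y where "y \<in> C" "g x y < 1 / real (Suc j)" using * by blast
      then show ?thesis using k(2)[of y] C(2) by auto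
    qed
    then have "\<not> 0 < g x k" using nat_approx_posE[of "g x k"] by (metis less_asym)
    then show "\<exists>k\<in>K. g x k = 0" using k(1) nonneg[of x k] by (intro bexI[of _ k]) auto
  qed
  then have "{x \<in> space M. \<exists>k\<in>K. g x k = 0} = (\<Inter>j. \<Union>k\<in>C. {x \<in> space M. g x k < 1 / real (Suc j)})"
    by auto
  also have "\<dots> \<in> sets M"
  proof (rule sets.countable_INT)
    show "range (\<lambda>j. \<Union>k\<in>C. {x \<in> space M. g x k < 1 / real (Suc j)}) \<subseteq> sets M"
    proof (rule image_subsetI, rule sets.countable_UN'[OF C(1)], rule image_subsetI)
      fix j :: nat and k assume "k \<in> C"
      then have "(\<lambda>x. g x k) \<in> borel_measurable M" using meas C(2) by auto
      then show "{x \<in> space M. g x k < 1 / real (Suc j)} \<in> sets M" by measurable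
    qed
  qed simp
  finally show ?thesis .
qed

section \<open>Matrices as points of compact sets of entry functions\<close>

type_synonym entries = "nat \<times> nat \<Rightarrow> real"

text \<open>Entry functions are defined on all index pairs; prescribing the value zero outside the
  \<open>p\<close> by \<open>p\<close> block makes the box a product of compact sets, hence compact
  in the product topology.\<close>

definition entry_box :: "nat \<Rightarrow> nat \<Rightarrow> entries set" where
  "entry_box p m = Pi UNIV (\<lambda>ij. if ij \<in> {..<p} \<times> {..<p} then {- real m..real m} else {0})"

lemma compact_entry_box: "compact (entry_box p m)"
proof -
  let ?X = "\<lambda>ij. if ij \<in> {..<p} \<times> {..<p} then {- real m..real m} else {0}"
  have "compactin (product_topology (\<lambda>_ :: nat \<times> nat. euclidean :: real topology) UNIV) (Pi\<^sub>E UNIV ?X)"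
    by (subst compactin_PiE) auto
  then show ?thesis
    unfolding euclidean_product_topology compactin_euclidean_iff by (simp add: entry_box_def PiE_UNIV_domain)
qed

definition entries_of :: "nat \<Rightarrow> rmat \<Rightarrow> entries" where
  "entries_of p A = (\<lambda>ij. if ij \<in> {..<p} \<times> {..<p} then A $$ ij else 0)"

lemma mat_entries_of: "A \<in> carrier_mat p p \<Longrightarrow> Matrix.mat p p (entries_of p A) = A"
  by (intro eq_matI) (auto simp: entries_of_def)

lemma entries_of_entry_box:
  assumes "\<And>i j. i < p \<Longrightarrow> j < p \<Longrightarrow> \<bar>A $$ (i, j)\<bar> \<le> real m"
  shows "entries_of p A \<in> entry_box p m"
  using assms by (auto simp: entries_of_def entry_box_def abs_le_iff minus_le_iff)

lemma continuous_on_fst_coord [continuous_intros]: "continuous_on A (\<lambda>k :: entries \<times> 'b :: topological_space. fst k ij)"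
  and continuous_on_snd_coord [continuous_intros]: "continuous_on B (\<lambda>k :: 'c :: topological_space \<times> entries. snd k ij)"
proof -
  have c: "continuous_on UNIV (\<lambda>f :: entries. f ij)" by (rule continuous_on_product_coordinates)
  show "continuous_on A (\<lambda>k :: entries \<times> 'b. fst k ij)"
    by (rule continuous_on_compose2[OF c]) (auto intro: continuous_intros)
  show "continuous_on B (\<lambda>k :: 'c \<times> entries. snd k ij)"
    by (rule continuous_on_compose2[OF c]) (auto intro: continuous_intros)
qed

text \<open>Positive definiteness is encoded by the closed condition of being positive semidefinite and invertible.\<close>

definition inverse_pairs :: "nat \<Rightarrow> nat \<Rightarrow> (entries \<times> entries) set" where
  "inverse_pairs p m = {k \<in> entry_box p m \<times> entry_box p m.
     (\<forall>a\<in>{..<p}. \<forall>b\<in>{..<p}. fst k (a, b) = fst k (b, a)) \<and>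
     (\<forall>a\<in>{..<p}. \<forall>b\<in>{..<p}. (\<Sum>c<p. fst k (a, c) * snd k (c, b)) = (if a = b then 1 else 0)) \<and>
     (\<forall>y. 0 \<le> (\<Sum>a<p. \<Sum>b<p. y a * fst k (a, b) * y b))}"

lemma compact_inverse_pairs: "compact (inverse_pairs p m)"
proof -
  have "closed {k :: entries \<times> entries. (\<forall>a\<in>{..<p}. \<forall>b\<in>{..<p}. fst k (a, b) = fst k (b, a)) \<and>
     (\<forall>a\<in>{..<p}. \<forall>b\<in>{..<p}. (\<Sum>c<p. fst k (a, c) * snd k (c, b)) = (if a = b then 1 else 0)) \<and>
     (\<forall>y. 0 \<le> (\<Sum>a<p. \<Sum>b<p. y a * fst k (a, b) * y b))}"
    by (intro closed_Collect_conj closed_Collect_all closed_Collect_imp closed_Collect_eq closed_Collect_le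
        continuous_intros open_Collect_const | simp only: Ball_def)+
  then have "compact (entry_box p m \<times> entry_box p m \<inter> {k :: entries \<times> entries. (\<forall>a\<in>{..<p}. \<forall>b\<in>{..<p}. fst k (a, b) = fst k (b, a)) \<and>
     (\<forall>a\<in>{..<p}. \<forall>b\<in>{..<p}. (\<Sum>c<p. fst k (a, c) * snd k (c, b)) = (if a = b then 1 else 0)) \<and>
     (\<forall>y. 0 \<le> (\<Sum>a<p. \<Sum>b<p. y a * fst k (a, b) * y b))})"
    by (intro compact_Int_closed compact_Times compact_entry_box)
  moreover have "{k \<in> A. Q k} = A \<inter> {k. Q k}" for A :: "(entries \<times> entries) set" and Q by blast
  ultimately show ?thesis unfolding inverse_pairs_def by (simp only:)
qed

lemma inverse_pairs_pos_def:
  assumes k: "k \<in> inverse_pairs p m"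
  shows "pos_def p (Matrix.mat p p (fst k))" "mat_inv (Matrix.mat p p (fst k)) = Matrix.mat p p (snd k)"
proof -
  let ?S = "Matrix.mat p p (fst k)" and ?W = "Matrix.mat p p (snd k)"
  have c: "?S \<in> carrier_mat p p" "?W \<in> carrier_mat p p" by auto
  have s: "symmetric p ?S" using k by (intro symmetricI) (auto simp: inverse_pairs_def)
  have SW: "?S * ?W = 1\<^sub>m p"
    using k by (intro eq_matI) (auto simp: inverse_pairs_def scalar_prod_def atLeast0LessThan)
  then show "mat_inv ?S = ?W" by (rule mat_inv_eqI[OF c])
  have WS: "?W * ?S = 1\<^sub>m p" by (rule mat_mult_left_right_inverse[OF c SW])
  have psd: "psd p ?S"
    unfolding psd_def
  proof (intro conjI s ballI)
    fix x :: rvec assume x: "x \<in> carrier_vec p"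
    have "x \<bullet> (?S *\<^sub>v x) = (\<Sum>a<p. \<Sum>b<p. x $ a * fst k (a, b) * x $ b)"
      unfolding form_entries[OF c(1) x x] by (intro sum.cong refl) auto
    then show "0 \<le> x \<bullet> (?S *\<^sub>v x)" using k by (auto simp: inverse_pairs_def)
  qed
  show "pos_def p ?S"
    unfolding pos_def_def
  proof (intro conjI ballI impI)
    fix x :: rvec assume x: "x \<in> carrier_vec p" "x \<noteq> 0\<^sub>v p"
    show "0 < x \<bullet> (?S *\<^sub>v x)"
    proof (rule ccontr)
      assume "\<not> 0 < x \<bullet> (?S *\<^sub>v x)"
      then have "x \<bullet> (?S *\<^sub>v x) = 0" using psd x by (auto simp: psd_def intro: antisym)
      then have "?S *\<^sub>v x = 0\<^sub>v p" by (rule psd_kernel[OF psd x(1)])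
      then have "(?W * ?S) *\<^sub>v x = 0\<^sub>v p"
        using assoc_mult_mat_vec[OF c(2) c(1) x(1)] mat_mult_zero_vec[OF c(2)] by simp
      with WS x show False by simp
    qed
  qed (use s in \<open>auto simp: symmetric_def\<close>)
qed

text \<open>Stated for all large \<open>m\<close>, so that two different solutions can be placed in
  the same compact set.\<close>

lemma pos_def_inverse_pairs:
  assumes S: "pos_def p S"
  shows "\<exists>m0. \<forall>m\<ge>m0. (entries_of p S, entries_of p (mat_inv S)) \<in> inverse_pairs p m"
proof -
  note s = pos_def_symmetric[OF S]
  note Sc = symmetric_carrier[OF s] and W = pos_def_inverse[OF S]
  obtain d where d: "form_bound p S d" using form_bound_exists[OF Sc] by blast
  obtain d' where d': "form_bound p (mat_inv S) d'" using form_bound_exists[OF W(1)] by blast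
  obtain m0 :: nat where m0: "max d d' \<le> real m0" using real_arch_simple by blast
  have "(entries_of p S, entries_of p (mat_inv S)) \<in> inverse_pairs p m" if "m \<ge> m0" for m
    unfolding inverse_pairs_def
  proof (intro CollectI conjI ballI allI SigmaI)
    have m: "d \<le> real m" "d' \<le> real m" using m0 that by auto
    show "entries_of p S \<in> entry_box p m"
      using form_bound_entry[OF s d] m by (intro entries_of_entry_box) force
    show "entries_of p (mat_inv S) \<in> entry_box p m"
      using form_bound_entry[OF pos_def_symmetric[OF pos_def_mat_inv[OF S]] d'] m by (intro entries_of_entry_box) force
    fix a b assume ab: "a \<in> {..<p}" "b \<in> {..<p}"
    then show "fst (entries_of p S, entries_of p (mat_inv S)) (a, b) = fst (entries_of p S, entries_of p (mat_inv S)) (b, a)"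
      using symmetric_index[OF s, of a b] by (simp add: entries_of_def)
    have "(\<Sum>c<p. S $$ (a, c) * mat_inv S $$ (c, b)) = (S * mat_inv S) $$ (a, b)"
      using ab Sc W(1) by (auto simp: scalar_prod_def atLeast0LessThan)
    then show "(\<Sum>c<p. fst (entries_of p S, entries_of p (mat_inv S)) (a, c) * snd (entries_of p S, entries_of p (mat_inv S)) (c, b)) = (if a = b then 1 else 0)"
      using ab unfolding W(2) by (simp add: entries_of_def)
  next
    fix y :: "nat \<Rightarrow> real"
    let ?y = "Matrix.vec p y"
    have "0 \<le> ?y \<bullet> (S *\<^sub>v ?y)" using pos_def_psd[OF S] by (auto simp: psd_def)
    also have "\<dots> = (\<Sum>a<p. \<Sum>b<p. y a * fst (entries_of p S, entries_of p (mat_inv S)) (a, b) * y b)"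
      by (subst form_entries[OF Sc]) (auto simp: entries_of_def intro!: sum.cong)
    finally show "0 \<le> (\<Sum>a<p. \<Sum>b<p. y a * fst (entries_of p S, entries_of p (mat_inv S)) (a, b) * y b)" .
  qed
  then show ?thesis by blast
qed

text \<open>Total defect in Tyler's equation and in the trace condition. The inverse is read from
  the second component, so that on \<open>inverse_pairs\<close> the defect is an explicit function
  of the entries, without \<open>mat_inv\<close>.\<close>

definition tyler_residual :: "nat \<Rightarrow> nat \<Rightarrow> (nat \<Rightarrow> rvec) \<Rightarrow> entries \<times> entries \<Rightarrow> real" where
  "tyler_residual p n x k = (\<Sum>a<p. \<Sum>b<p. \<bar>real p / real n *
     (\<Sum>i<n. x i $ a * x i $ b / (\<Sum>c<p. \<Sum>d<p. x i $ c * snd k (c, d) * x i $ d)) - fst k (a, b)\<bar>) +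
     \<bar>(\<Sum>a<p. fst k (a, a)) - real p\<bar>"

lemma tyler_residual_nonneg: "0 \<le> tyler_residual p n x k"
  by (simp add: tyler_residual_def sum_nonneg)

lemma tyler_residual_zero:
  assumes k: "k \<in> inverse_pairs p m" and x: "\<And>i. i < n \<Longrightarrow> x i \<in> carrier_vec p"
  shows "tyler_residual p n x k = 0 \<longleftrightarrow> tyler_solution p n x (Matrix.mat p p (fst k))"
proof -
  let ?S = "Matrix.mat p p (fst k)"
  note pd = inverse_pairs_pos_def[OF k]
  have q: "x i \<bullet> (mat_inv ?S *\<^sub>v x i) = (\<Sum>c<p. \<Sum>d<p. x i $ c * snd k (c, d) * x i $ d)" if "i < n" for i
    unfolding pd(2) using x[OF that] by (subst form_entries[where p = p]) (auto intro!: sum.cong)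
  have zero: "(A :: real) + B = 0 \<longleftrightarrow> A = 0 \<and> B = 0" if "0 \<le> A" "0 \<le> B" for A B using that by linarith
  have "tyler_residual p n x k = 0 \<longleftrightarrow> (\<forall>a<p. \<forall>b<p. real p / real n *
      (\<Sum>i<n. x i $ a * x i $ b / (\<Sum>c<p. \<Sum>d<p. x i $ c * snd k (c, d) * x i $ d)) = fst k (a, b)) \<and>
      (\<Sum>a<p. fst k (a, a)) = real p"
    unfolding tyler_residual_def by (subst zero) (auto simp: sum_nonneg sum_nonneg_eq_0_iff)
  also have "\<dots> \<longleftrightarrow> (\<forall>a<p. \<forall>b<p. real p / real n *
      (\<Sum>i<n. x i $ a * x i $ b / (x i \<bullet> (mat_inv ?S *\<^sub>v x i))) = fst k (a, b)) \<and> mat_trace ?S = real p"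
    using q by (simp add: mat_trace_def)
  also have "\<dots> \<longleftrightarrow> tyler_solution p n x ?S"
    unfolding tyler_solution_def using pd(1) by (auto simp: mat_eq_iff)
  finally show ?thesis .
qed

text \<open>The second component is the inverse of a positive definite matrix, so the denominators
  do not vanish at nonzero samples; at a zero sample the whole quotient is constantly zero.\<close>

lemma continuous_on_tyler_residual:
  assumes x: "\<And>i. i < n \<Longrightarrow> x i \<in> carrier_vec p"
  shows "continuous_on (inverse_pairs p m) (tyler_residual p n x)"
proof -
  have c: "continuous_on (inverse_pairs p m) (\<lambda>k. x i $ a * x i $ b / (\<Sum>c<p. \<Sum>d<p. x i $ c * snd k (c, d) * x i $ d))"
    if i: "i < n" and ab: "a < p" "b < p" for i a b
  proof (cases "x i = 0\<^sub>v p")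
    case True
    then show ?thesis using ab by simp
  next
    case False
    have "(\<Sum>c<p. \<Sum>d<p. x i $ c * snd k (c, d) * x i $ d) \<noteq> 0" if k: "k \<in> inverse_pairs p m" for k
    proof -
      note pd = inverse_pairs_pos_def[OF k]
      have "0 < x i \<bullet> (mat_inv (Matrix.mat p p (fst k)) *\<^sub>v x i)"
        by (rule pos_def_gt[OF pos_def_mat_inv[OF pd(1)] x[OF i] False])
      also have "\<dots> = (\<Sum>c<p. \<Sum>d<p. x i $ c * snd k (c, d) * x i $ d)"
        unfolding pd(2) using x[OF i] by (subst form_entries[where p = p]) (auto intro!: sum.cong)
      finally show ?thesis by simp
    qed
    then show ?thesis by (intro continuous_intros) auto
  qed
  show ?thesis
    unfolding tyler_residual_def by (intro continuous_intros c) auto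
qed

lemma measurable_tyler_residual:
  assumes "\<And>i a. i < n \<Longrightarrow> a < p \<Longrightarrow> (\<lambda>x. x i $ a) \<in> borel_measurable M"
  shows "(\<lambda>x. tyler_residual p n x k) \<in> borel_measurable M"
  unfolding tyler_residual_def
  by (intro borel_measurable_add borel_measurable_sum borel_measurable_abs borel_measurable_diff
      borel_measurable_times borel_measurable_divide borel_measurable_const assms) auto

lemma frobenius_norm_conjugate:
  assumes R: "R \<in> carrier_mat p p"
  shows "frobenius_norm (1\<^sub>m p - R * Matrix.mat p p g * R) =
    sqrt (\<Sum>a<p. \<Sum>b<p. ((if a = b then 1 else 0) - (\<Sum>d<p. (\<Sum>c<p. R $$ (a, c) * g (c, d)) * R $$ (d, b)))\<^sup>2)"
  unfolding frobenius_norm_def using R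
  by (auto simp: scalar_prod_def atLeast0LessThan intro!: arg_cong[where f = sqrt] sum.cong)

text \<open>The event is the set where some solution meets the bound, minus the set where two
  distinct solutions exist. Both are countable unions of events with a compact parameter.
  Distinctness is an open condition and is therefore exhausted by the closed conditions that the
  entries differ by at least \<open>1 / real (Suc m)\<close> in total.\<close>

lemma tyler_event_measurable:
  fixes R :: rmat and M :: "(nat \<Rightarrow> rvec) measure"
  assumes R: "R \<in> carrier_mat p p"
    and x: "\<And>x i. x \<in> space M \<Longrightarrow> i < n \<Longrightarrow> x i \<in> carrier_vec p"
    and meas: "\<And>i a. i < n \<Longrightarrow> a < p \<Longrightarrow> (\<lambda>x. x i $ a) \<in> borel_measurable M"
  shows "{x \<in> space M. tyler_exists p n x \<and> frobenius_norm (1\<^sub>m p - R * mat_inv (tyler p n x) * R) \<le> \<epsilon>} \<in> sets M"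
proof -
  let ?fr = "\<lambda>W. frobenius_norm (1\<^sub>m p - R * W * R)"
  let ?m = "Matrix.mat p p"
  have frc: "closed {k :: entries \<times> entries. ?fr (?m (snd k)) \<le> \<epsilon>}"
    unfolding frobenius_norm_conjugate[OF R] by (intro closed_Collect_le continuous_intros)
  define K1 where "K1 m = inverse_pairs p m \<inter> {k. ?fr (?m (snd k)) \<le> \<epsilon>}" for m
  define dis :: "(entries \<times> entries) \<times> (entries \<times> entries) \<Rightarrow> real"
    where "dis kk = (\<Sum>a<p. \<Sum>b<p. \<bar>fst (fst kk) (a, b) - fst (snd kk) (a, b)\<bar>)" for kk
  \<comment> \<open>One index controls the size of the entries and the gap between the solutions; a
    maximum of thresholds serves both.\<close>
  define K2 where "K2 m = (inverse_pairs p m \<times> inverse_pairs p m) \<inter> {kk. 1 / real (Suc m) \<le> dis kk}" for m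
  have coord: "continuous_on A (\<lambda>kk :: (entries \<times> entries) \<times> (entries \<times> entries). fst (fst kk) ij)"
    "continuous_on A (\<lambda>kk :: (entries \<times> entries) \<times> (entries \<times> entries). fst (snd kk) ij)" for A ij
    by (rule continuous_on_compose2[OF continuous_on_fst_coord[of UNIV]]; auto intro: continuous_intros)+
  have "continuous_on UNIV dis" unfolding dis_def by (intro continuous_intros coord)
  then have disc: "closed {kk. 1 / real (Suc m) \<le> dis kk}" for m by (intro closed_Collect_le continuous_intros)
  have cK1: "compact (K1 m)" for m unfolding K1_def by (intro compact_Int_closed compact_inverse_pairs frc)
  have cK2: "compact (K2 m)" for m
    unfolding K2_def by (intro compact_Int_closed compact_Times compact_inverse_pairs disc)
  have E1: "(\<exists>S. tyler_solution p n x S \<and> ?fr (mat_inv S) \<le> \<epsilon>) \<longleftrightarrow> (\<exists>m. \<exists>k\<in>K1 m. tyler_residual p n x k = 0)"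
    if "x \<in> space M" for x
  proof
    assume "\<exists>S. tyler_solution p n x S \<and> ?fr (mat_inv S) \<le> \<epsilon>"
    then obtain S where S: "tyler_solution p n x S" "?fr (mat_inv S) \<le> \<epsilon>" by blast
    then have pd: "pos_def p S" by (simp add: tyler_solution_def)
    obtain m where m: "(entries_of p S, entries_of p (mat_inv S)) \<in> inverse_pairs p m"
      using pos_def_inverse_pairs[OF pd] by blast
    have "?m (entries_of p S) = S" "?m (entries_of p (mat_inv S)) = mat_inv S"
      using pd pos_def_inverse(1)[OF pd] by (auto simp: pos_def_def mat_entries_of)
    then show "\<exists>m. \<exists>k\<in>K1 m. tyler_residual p n x k = 0"
      using S m tyler_residual_zero[OF m x[OF that]]
      by (intro exI[of _ m] bexI[of _ "(entries_of p S, entries_of p (mat_inv S))"]) (auto simp: K1_def)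
  next
    assume "\<exists>m. \<exists>k\<in>K1 m. tyler_residual p n x k = 0"
    then obtain m k where k: "k \<in> inverse_pairs p m" "?fr (?m (snd k)) \<le> \<epsilon>" "tyler_residual p n x k = 0"
      by (auto simp: K1_def)
    then show "\<exists>S. tyler_solution p n x S \<and> ?fr (mat_inv S) \<le> \<epsilon>"
      using tyler_residual_zero[OF k(1) x[OF that]] inverse_pairs_pos_def(2)[OF k(1)] by auto
  qed
  have E2: "(\<exists>S S'. tyler_solution p n x S \<and> tyler_solution p n x S' \<and> S \<noteq> S') \<longleftrightarrow>
      (\<exists>m. \<exists>kk\<in>K2 m. tyler_residual p n x (fst kk) + tyler_residual p n x (snd kk) = 0)"
    if "x \<in> space M" for x
  proof
    assume "\<exists>S S'. tyler_solution p n x S \<and> tyler_solution p n x S' \<and> S \<noteq> S'"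
    then obtain S S' where S: "tyler_solution p n x S" "tyler_solution p n x S'" "S \<noteq> S'" by blast
    then have pd: "pos_def p S" "pos_def p S'" by (auto simp: tyler_solution_def)
    define k where "k = (entries_of p S, entries_of p (mat_inv S))"
    define k' where "k' = (entries_of p S', entries_of p (mat_inv S'))"
    obtain m0 where m0: "\<And>m. m \<ge> m0 \<Longrightarrow> k \<in> inverse_pairs p m"
      using pos_def_inverse_pairs[OF pd(1)] unfolding k_def by blast
    obtain m1 where m1: "\<And>m. m \<ge> m1 \<Longrightarrow> k' \<in> inverse_pairs p m"
      using pos_def_inverse_pairs[OF pd(2)] unfolding k'_def by blast
    have mk: "?m (fst k) = S" "?m (fst k') = S'"
      using pd by (auto simp: pos_def_def mat_entries_of k_def k'_def)
    have "dis (k, k') \<noteq> 0"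
    proof
      assume "dis (k, k') = 0"
      then have "\<forall>a<p. \<forall>b<p. fst k (a, b) = fst k' (a, b)"
        by (simp add: dis_def sum_nonneg sum_nonneg_eq_0_iff)
      then have "?m (fst k) = ?m (fst k')" by (intro eq_matI) auto
      with mk S(3) show False by simp
    qed
    moreover have "0 \<le> dis (k, k')" by (simp add: dis_def sum_nonneg)
    ultimately have "0 < dis (k, k')" by simp
    then obtain m2 where m2: "1 / real (Suc m2) < dis (k, k')" using nat_approx_posE by blast
    define m where "m = max m0 (max m1 m2)"
    have "1 / real (Suc m) \<le> 1 / real (Suc m2)" by (intro divide_left_mono) (auto simp: m_def)
    with m2 have "(k, k') \<in> K2 m" using m0[of m] m1[of m] by (auto simp: K2_def m_def)
    moreover have "tyler_residual p n x k = 0" "tyler_residual p n x k' = 0"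
      using tyler_residual_zero[OF m0[OF order_refl] x[OF that]] tyler_residual_zero[OF m1[OF order_refl] x[OF that]] S mk by auto
    ultimately show "\<exists>m. \<exists>kk\<in>K2 m. tyler_residual p n x (fst kk) + tyler_residual p n x (snd kk) = 0"
      by (intro exI[of _ m] bexI[of _ "(k, k')"]) auto
  next
    assume "\<exists>m. \<exists>kk\<in>K2 m. tyler_residual p n x (fst kk) + tyler_residual p n x (snd kk) = 0"
    then obtain m k k' where k: "k \<in> inverse_pairs p m" "k' \<in> inverse_pairs p m" "1 / real (Suc m) \<le> dis (k, k')"
      and z: "tyler_residual p n x k + tyler_residual p n x k' = 0" by (auto simp: K2_def)
    have "tyler_residual p n x k = 0" "tyler_residual p n x k' = 0"
      using z tyler_residual_nonneg[of p n x k] tyler_residual_nonneg[of p n x k'] by linarith+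
    then have "tyler_solution p n x (?m (fst k))" "tyler_solution p n x (?m (fst k'))"
      using tyler_residual_zero[OF k(1) x[OF that]] tyler_residual_zero[OF k(2) x[OF that]] by auto
    moreover have "?m (fst k) \<noteq> ?m (fst k')"
    proof
      assume eq: "?m (fst k) = ?m (fst k')"
      have "fst k (a, b) = fst k' (a, b)" if "a < p" "b < p" for a b
        using arg_cong[OF eq, of "\<lambda>A. A $$ (a, b)"] that by simp
      then have "dis (k, k') = 0" by (simp add: dis_def)
      moreover have "0 < 1 / real (Suc m)" by simp
      ultimately show False using k(3) by linarith
    qed
    ultimately show "\<exists>S S'. tyler_solution p n x S \<and> tyler_solution p n x S' \<and> S \<noteq> S'" by blast
  qed
  have main: "tyler_exists p n x \<and> ?fr (mat_inv (tyler p n x)) \<le> \<epsilon> \<longleftrightarrow>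
      (\<exists>S. tyler_solution p n x S \<and> ?fr (mat_inv S) \<le> \<epsilon>) \<and>
      \<not> (\<exists>S S'. tyler_solution p n x S \<and> tyler_solution p n x S' \<and> S \<noteq> S')" for x
  proof (cases "tyler_exists p n x")
    case True
    then have ex1: "\<exists>!S. tyler_solution p n x S" by (simp add: tyler_exists_def)
    then have "tyler_solution p n x (tyler p n x)" unfolding tyler_def by (rule theI')
    then show ?thesis using ex1 True by blast
  next
    case False
    then show ?thesis unfolding tyler_exists_def by blast
  qed
  have "{x \<in> space M. tyler_exists p n x \<and> ?fr (mat_inv (tyler p n x)) \<le> \<epsilon>} =
      (\<Union>m. {x \<in> space M. \<exists>k\<in>K1 m. tyler_residual p n x k = 0}) -
      (\<Union>m. {x \<in> space M. \<exists>kk\<in>K2 m. tyler_residual p n x (fst kk) + tyler_residual p n x (snd kk) = 0})"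
  proof (rule Set.set_eqI)
    fix x
    show "x \<in> {x \<in> space M. tyler_exists p n x \<and> ?fr (mat_inv (tyler p n x)) \<le> \<epsilon>} \<longleftrightarrow>
      x \<in> (\<Union>m. {x \<in> space M. \<exists>k\<in>K1 m. tyler_residual p n x k = 0}) -
      (\<Union>m. {x \<in> space M. \<exists>kk\<in>K2 m. tyler_residual p n x (fst kk) + tyler_residual p n x (snd kk) = 0})"
    proof (cases "x \<in> space M")
      case True
      have "x \<in> {x \<in> space M. tyler_exists p n x \<and> ?fr (mat_inv (tyler p n x)) \<le> \<epsilon>} \<longleftrightarrow>
          (\<exists>m. \<exists>k\<in>K1 m. tyler_residual p n x k = 0) \<and>
          \<not> (\<exists>m. \<exists>kk\<in>K2 m. tyler_residual p n x (fst kk) + tyler_residual p n x (snd kk) = 0)"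
        unfolding E1[OF True, symmetric] E2[OF True, symmetric] main[symmetric] using True by simp
      then show ?thesis using True by simp
    qed simp
  qed
  also have "\<dots> \<in> sets M"
  proof (intro sets.Diff sets.countable_UN)
    show "range (\<lambda>m. {x \<in> space M. \<exists>k\<in>K1 m. tyler_residual p n x k = 0}) \<subseteq> sets M"
    proof (clarify, rule measurable_exists_zero[OF cK1])
      fix m x assume "x \<in> space M"
      then have "continuous_on (inverse_pairs p m) (tyler_residual p n x)"
        by (intro continuous_on_tyler_residual x)
      then show "continuous_on (K1 m) (tyler_residual p n x)"
        by (rule continuous_on_subset) (auto simp: K1_def)
    qed (auto intro: measurable_tyler_residual[OF meas] tyler_residual_nonneg)
    show "range (\<lambda>m. {x \<in> space M. \<exists>kk\<in>K2 m. tyler_residual p n x (fst kk) + tyler_residual p n x (snd kk) = 0}) \<subseteq> sets M"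
    proof (clarify, rule measurable_exists_zero[OF cK2])
      fix m x assume "x \<in> space M"
      then have c: "continuous_on (inverse_pairs p m) (tyler_residual p n x)"
        by (intro continuous_on_tyler_residual x)
      show "continuous_on (K2 m) (\<lambda>kk. tyler_residual p n x (fst kk) + tyler_residual p n x (snd kk))"
        by (intro continuous_on_add; rule continuous_on_compose2[OF c]) (auto simp: K2_def intro: continuous_intros)
    qed (auto intro!: borel_measurable_add measurable_tyler_residual[OF meas] add_nonneg_nonneg tyler_residual_nonneg)
  qed
  finally show ?thesis .
qed

section \<open>Failure probability\<close>

text \<open>Here \<open>X\<close> stands for \<open>n * \<epsilon>\<^sup>2 / p\<^sup>2\<close>. Half
  of \<open>k * X * p\<close> is at least \<open>20 * p\<close> and absorbs
  \<open>18 * p + 2\<close>; the other half is at least \<open>k * X / 2\<close>. As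
  \<open>k \<le> 1 / 256\<close> gives \<open>X \<ge> 10240\<close>, a quarter of
  \<open>X * p\<^sup>2\<close> absorbs the entropy of the fine net and 1. The spare terms 2 and 1
  reduce either summand to half of the right-hand side.\<close>

lemma failure_probability_bound:
  fixes X k :: real
  assumes p: "1 \<le> p" and k: "0 < k" "k \<le> 1 / 256" and X: "40 / k \<le> X"
  shows "2 * exp (18 * real p) * exp (- k * X * real p) + exp (1024 * (real p)\<^sup>2) * exp (- X * (real p)\<^sup>2 / 2)
    \<le> exp (- (k / 2) * X)"
proof -
  have kX: "40 \<le> k * X" using k X by (simp add: field_simps)
  have X1: "10240 \<le> X"
  proof -
    have "10240 \<le> 40 / k" using k by (simp add: field_simps)
    then show ?thesis using X by simp
  qed
  have rp: "1 \<le> real p" using p by simp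
  have half: "exp (- 2) \<le> (1 / 4 :: real)" "exp (- 1) \<le> (1 / 2 :: real)"
  proof -
    have "2 \<le> exp (1 :: real)" using exp_ge_add_one_self[of "1 :: real"] by simp
    moreover have "exp (2 :: real) = exp 1 * exp 1" by (simp add: exp_add[symmetric])
    moreover have "(2 :: real) * 2 \<le> exp 1 * exp 1" using calculation(1) by (intro mult_mono) auto
    ultimately show "exp (- 2) \<le> (1 / 4 :: real)" "exp (- 1) \<le> (1 / 2 :: real)"
      by (simp_all add: exp_minus field_simps)
  qed
  have "k * X * 1 \<le> k * X * real p" using kX rp by (intro mult_left_mono) auto
  moreover have "40 * real p \<le> k * X * real p" using kX rp by (intro mult_right_mono) auto
  ultimately have "18 * real p - k * X * real p \<le> - 2 - k / 2 * X" using rp by linarith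
  then have "exp (18 * real p - k * X * real p) \<le> exp (- 2 - k / 2 * X)" by simp
  also have "\<dots> = exp (- 2) * exp (- (k / 2) * X)" by (simp add: exp_add[symmetric])
  also have "\<dots> \<le> 1 / 4 * exp (- (k / 2) * X)" using half by (intro mult_right_mono) auto
  finally have first: "2 * exp (18 * real p) * exp (- k * X * real p) \<le> 1 / 2 * exp (- (k / 2) * X)"
    by (simp add: exp_diff exp_minus field_simps)
  have second: "exp (1024 * (real p)\<^sup>2) * exp (- X * (real p)\<^sup>2 / 2) \<le> 1 / 2 * exp (- (k / 2) * X)"
  proof -
    have p2: "1 \<le> (real p)\<^sup>2" using rp by (simp add: power2_eq_square mult_mono[of 1 "real p" 1 "real p", simplified])
    have "10240 * (real p)\<^sup>2 \<le> X * (real p)\<^sup>2" using X1 by (intro mult_right_mono) auto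
    moreover have "X * 1 \<le> X * (real p)\<^sup>2" using X1 p2 by (intro mult_left_mono) auto
    moreover have "k / 2 * X \<le> 1 / 4 * X" using k X1 by (intro mult_right_mono) auto
    ultimately have "1024 * (real p)\<^sup>2 - X * (real p)\<^sup>2 / 2 \<le> - 1 - k / 2 * X" using p2 by linarith
    then have "exp (1024 * (real p)\<^sup>2 - X * (real p)\<^sup>2 / 2) \<le> exp (- 1 - k / 2 * X)" by simp
    also have "\<dots> = exp (- 1) * exp (- (k / 2) * X)" by (simp add: exp_add[symmetric])
    also have "\<dots> \<le> 1 / 2 * exp (- (k / 2) * X)" using half by (intro mult_right_mono) auto
    finally show ?thesis by (simp add: exp_add[symmetric])
  qed
  from first second show ?thesis by linarith
qed

context
  fixes p n :: nat and \<Sigma> :: rmat and D :: "rvec measure" and \<epsilon> :: real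
  assumes E: "elliptical p \<Sigma> D" and p: "1 \<le> p" and n: "0 < n" and \<epsilon>: "0 < \<epsilon>" "\<epsilon> \<le> 1 / 2 ^ 38 / 20"
begin

text \<open>The scales are chosen backwards: the Frobenius bound \<open>4 * d * sqrt p\<close>
  should be \<open>\<epsilon>\<close>, the fixed point needs \<open>t = c * d / 2\<close>, and the
  net argument doubles the deviation, so a net direction may deviate by
  \<open>\<tau> = c * d / 4\<close>. The bound on \<open>\<epsilon>\<close> is what makes
  \<open>d \<le> c / 80\<close>.\<close>

lemma tyler_failure_probability:
  defines "M \<equiv> \<Pi>\<^sub>M i\<in>{..<n}. D" and "\<tau> \<equiv> 1 / 2 ^ 38 * \<epsilon> / (16 * sqrt (real p))"
  shows "1 - (2 * real (card (coarse_net p)) * exp (- real n * \<tau>\<^sup>2 / 16) + real (card (fine_net p)) * exp (- real n / 2))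
    \<le> measure M {x \<in> space M. tyler_exists p n x \<and>
        frobenius_norm (1\<^sub>m p - mat_sqrt \<Sigma> * mat_inv (tyler p n x) * mat_sqrt \<Sigma>) \<le> \<epsilon>}"
proof -
  define c where "c = (1 / 2 ^ 38 :: real)"
  define s where "s = sqrt (real p)"
  define d where "d = \<epsilon> / (4 * s)"
  have c: "0 < c" "c \<le> 1" by (auto simp: c_def)
  have s: "1 \<le> s" using p by (simp add: s_def)
  have \<tau>_eq: "\<tau> = c * \<epsilon> / (16 * s)" by (simp add: \<tau>_def c_def s_def)
  have \<epsilon>c: "\<epsilon> \<le> c / 20" using \<epsilon>(2) by (simp add: c_def)
  have d: "0 < d" "d \<le> c / 80" "2 * \<tau> = c * d / 2"
  proof -
    show "0 < d" using \<epsilon> s by (simp add: d_def)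
    have "d \<le> \<epsilon> / 4" unfolding d_def using s \<epsilon>(1) by (intro divide_left_mono) auto
    then show "d \<le> c / 80" using \<epsilon>c by linarith
    show "2 * \<tau> = c * d / 2" using s by (simp add: \<tau>_eq d_def field_simps)
  qed
  have \<tau>: "0 < \<tau>" "\<tau> \<le> 1"
  proof -
    show "0 < \<tau>" using c \<epsilon> s by (simp add: \<tau>_eq)
    have "c * d \<le> 1 * d" using c d by (intro mult_right_mono) auto
    then show "\<tau> \<le> 1" using d c by linarith
  qed
  have R: "pos_def p (mat_sqrt \<Sigma>)" by (rule mat_sqrt_pos_def(1)[OF elliptical_pos_def[OF E]])
  have Rc: "mat_sqrt \<Sigma> \<in> carrier_mat p p" using R by (simp add: pos_def_def)
  interpret M: prob_space M unfolding M_def by (rule prob_space_PiM) (rule elliptical_prob_space[OF E])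
  have xc: "x i \<in> carrier_vec p" if "x \<in> space M" "i < n" for x i
    using that elliptical_space[OF E] by (auto simp: M_def space_PiM)
  let ?good = "{x \<in> space M. tyler_exists p n x \<and>
      frobenius_norm (1\<^sub>m p - mat_sqrt \<Sigma> * mat_inv (tyler p n x) * mat_sqrt \<Sigma>) \<le> \<epsilon>}"
  have good: "?good \<in> sets M"
  proof (rule tyler_event_measurable[OF Rc])
    show "x i \<in> carrier_vec p" if "x \<in> space M" "i < n" for x i by (rule xc[OF that])
    fix i a assume ia: "i < n" "a < p"
    have "(\<lambda>x. x i) \<in> measurable M D" unfolding M_def using ia by simp
    then have "(\<lambda>x. x i) \<in> measurable M (vec_borel p)"
      using measurable_cong_sets[OF refl elliptical_sets[OF E]] by blast
    then show "(\<lambda>x. x i $ a) \<in> borel_measurable M"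
      by (rule measurable_compose[OF _ measurable_vec_borel_index[OF ia(2)]])
  qed
  define dir where "dir z = normalized (int_vec p z)" for z
  have dir: "dir z \<in> carrier_vec p" "dir z \<bullet> dir z = 1" if "int_vec p z \<noteq> 0\<^sub>v p" for z
    using normalized_unit[OF _ that] by (auto simp: dir_def)
  define A where "A \<sigma> z = {x \<in> space M. real n * \<tau> \<le> \<sigma> * ((\<Sum>i<n. real p * cosine2 (mat_sqrt \<Sigma>) (dir z) (x i)) - real n)}"
    for \<sigma> :: real and z
  define F where "F z = {x \<in> space M. real n \<le> 3 * real (card {i. i < n \<and> real p * cosine2 (mat_sqrt \<Sigma>) (dir z) (x i) < 1 / 16384})}" for z
  have A: "measure M (A \<sigma> z) \<le> exp (- real n * \<tau>\<^sup>2 / 16)" "A \<sigma> z \<in> sets M"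
    if "z \<in> coarse_net p" "\<sigma> = 1 \<or> \<sigma> = - 1" for \<sigma> z
  proof -
    have "int_vec p z \<noteq> 0\<^sub>v p" using that(1) by (simp add: coarse_net_def)
    note tail = cosine2_sum_tail[OF E p dir[OF this] \<tau> that(2), where n = n]
    show "measure M (A \<sigma> z) \<le> exp (- real n * \<tau>\<^sup>2 / 16)" unfolding A_def M_def by (rule tail(1))
    show "A \<sigma> z \<in> sets M" unfolding A_def M_def by (rule tail(2))
  qed
  have F: "measure M (F z) \<le> exp (- real n / 2)" "F z \<in> sets M" if "z \<in> fine_net p" for z
  proof -
    have "int_vec p z \<noteq> 0\<^sub>v p" using that by (simp add: fine_net_def)
    note small = small_cosine2_count[OF E p dir[OF this], where n = n]
    show "measure M (F z) \<le> exp (- real n / 2)" unfolding F_def M_def by (rule small(1))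
    show "F z \<in> sets M" unfolding F_def M_def by (rule small(2))
  qed
  let ?bad = "((\<Union>z\<in>coarse_net p. A 1 z) \<union> (\<Union>z\<in>coarse_net p. A (- 1) z)) \<union> (\<Union>z\<in>fine_net p. F z)"
  have imp: "x \<in> ?good" if x: "x \<in> space M" "x \<notin> ?bad" and nz: "\<forall>i<n. x i \<noteq> 0\<^sub>v p" for x
  proof -
    \<comment> \<open>The product space consists of samples only; the hidden direction and radial
      factor are recovered from the whitened sample, up to a common sign.\<close>
    define v where "v i = normalized (mat_inv (mat_sqrt \<Sigma>) *\<^sub>v x i)" for i
    define u where "u i = euclid_norm (mat_inv (mat_sqrt \<Sigma>) *\<^sub>v x i)" for i
    have sample: "tyler_sample p n v c (2 * \<tau>)"
      unfolding v_def c_def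
    proof (rule tyler_sample_from_nets[OF p n R _ _ \<tau>(1)])
      show "\<bar>(\<Sum>i<n. real p * cosine2 (mat_sqrt \<Sigma>) (normalized (int_vec p z)) (x i)) - real n\<bar> \<le> real n * \<tau>"
        if "z \<in> coarse_net p" for z
      proof -
        have "x \<notin> A 1 z" "x \<notin> A (- 1) z" using x(2) that by auto
        then show ?thesis using x(1) by (auto simp: A_def dir_def)
      qed
      show "3 * real (card {i. i < n \<and> real p * cosine2 (mat_sqrt \<Sigma>) (normalized (int_vec p z)) (x i) < 1 / 16384}) < real n"
        if "z \<in> fine_net p" for z
      proof -
        have "x \<notin> F z" using x(2) that by auto
        then show ?thesis using x(1) by (simp add: F_def dir_def)
      qed
    qed (use xc[OF x(1)] nz in auto)
    have inv: "mat_inv (mat_sqrt \<Sigma>) *\<^sub>v x i \<in> carrier_vec p" "mat_inv (mat_sqrt \<Sigma>) *\<^sub>v x i \<noteq> 0\<^sub>v p" if "i < n" for i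
    proof -
      note xi = xc[OF x(1) that]
      show "mat_inv (mat_sqrt \<Sigma>) *\<^sub>v x i \<in> carrier_vec p" by (rule pos_def_inverse_vec(1)[OF R xi])
      show "mat_inv (mat_sqrt \<Sigma>) *\<^sub>v x i \<noteq> 0\<^sub>v p"
        using pos_def_gt[OF pos_def_mat_inv[OF R] xi] nz that xi by auto
    qed
    have u: "u i \<noteq> 0" if "i < n" for i using euclid_norm_pos[OF inv[OF that]] by (simp add: u_def)
    have xi: "x i = u i \<cdot>\<^sub>v (mat_sqrt \<Sigma> *\<^sub>v v i)" if "i < n" for i
    proof -
      have "u i \<cdot>\<^sub>v (mat_sqrt \<Sigma> *\<^sub>v v i) = mat_sqrt \<Sigma> *\<^sub>v (u i \<cdot>\<^sub>v v i)"
        using mult_mat_vec[OF Rc, of "v i" "u i"] inv[OF that] by (simp add: v_def)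
      also have "u i \<cdot>\<^sub>v v i = mat_inv (mat_sqrt \<Sigma>) *\<^sub>v x i"
        unfolding u_def v_def by (rule smult_normalized[OF inv[OF that]])
      finally show ?thesis using pos_def_inverse_vec(2)[OF R xc[OF x(1) that]] by simp
    qed
    note est = tyler_estimate[OF elliptical_pos_def[OF E] elliptical_trace[OF E] sample d u xi]
    have "4 * d * sqrt (real p) = \<epsilon>" using s by (simp add: d_def s_def[symmetric])
    with est x(1) show ?thesis by simp
  qed
  have bad: "?bad \<in> sets M"
    using A(2) F(2) finite_coarse_net finite_fine_net by (intro sets.Un sets.finite_UN) auto
  have "measure M (space M - ?good) \<le> measure M ?bad"
  proof (rule M.finite_measure_mono_AE[OF _ bad])
    \<comment> \<open>Zero samples are not part of the bad event, so the inclusion holds only up to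
      a null set.\<close>
    show "AE x in M. x \<in> space M - ?good \<longrightarrow> x \<in> ?bad"
      using AE_samples_nonzero[OF E p, of n, folded M_def] by eventually_elim (use imp in blast)
  qed
  also have "\<dots> \<le> (measure M (\<Union>z\<in>coarse_net p. A 1 z) + measure M (\<Union>z\<in>coarse_net p. A (- 1) z)) + measure M (\<Union>z\<in>fine_net p. F z)"
    using A(2) F(2) finite_coarse_net finite_fine_net
    by (intro order_trans[OF measure_Un_le] add_right_mono measure_Un_le sets.Un sets.finite_UN) auto
  also have "\<dots> \<le> (\<Sum>z\<in>coarse_net p. exp (- real n * \<tau>\<^sup>2 / 16)) + (\<Sum>z\<in>coarse_net p. exp (- real n * \<tau>\<^sup>2 / 16)) +
      (\<Sum>z\<in>fine_net p. exp (- real n / 2))"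
    using A F finite_coarse_net finite_fine_net
    by (intro add_mono order_trans[OF measure_UNION_le] sum_mono) auto
  also have "\<dots> = 2 * real (card (coarse_net p)) * exp (- real n * \<tau>\<^sup>2 / 16) + real (card (fine_net p)) * exp (- real n / 2)"
    by simp
  finally show ?thesis using M.prob_compl[OF good] by linarith
qed

end

theorem theorem1p2:
  shows "\<exists>C c \<epsilon>0 :: real. C > 0 \<and> c > 0 \<and> \<epsilon>0 > 0 \<and>
    (\<forall>(\<epsilon> :: real) (p :: nat) (n :: nat) (\<Sigma> :: rmat) (D :: rvec measure).
       0 < \<epsilon> \<longrightarrow> \<epsilon> \<le> \<epsilon>0 \<longrightarrow> p \<ge> 1 \<longrightarrow> elliptical p \<Sigma> D \<longrightarrow>
       real n \<ge> C * (real p)\<^sup>2 / \<epsilon>\<^sup>2 \<longrightarrow>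
       \<P>(x in \<Pi>\<^sub>M i\<in>{..<n}. D.
           tyler_exists p n x \<and>
           frobenius_norm (1\<^sub>m p - mat_sqrt \<Sigma> * mat_inv (tyler p n x) * mat_sqrt \<Sigma>) \<le> \<epsilon>)
         \<ge> 1 - exp (- c * real n * \<epsilon>\<^sup>2 / (real p)\<^sup>2))"
proof -
  define c0 where "c0 = (1 / 2 ^ 38 :: real)"
  \<comment> \<open>With \<open>\<tau> = c0 * \<epsilon> / (16 * sqrt p)\<close>, the exponent
    \<open>n * \<tau>\<^sup>2 / 16\<close> equals \<open>c0\<^sup>2 / 4096\<close> times
    \<open>n * \<epsilon>\<^sup>2 / p\<close>.\<close>
  define k where "k = c0\<^sup>2 / 4096"
  have c0: "0 < c0" "c0 \<le> 1" by (auto simp: c0_def)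
  have k: "0 < k" "k \<le> 1 / 256"
  proof -
    show "0 < k" using c0 by (simp add: k_def)
    have "c0\<^sup>2 \<le> 1" using c0 by (simp add: power_le_one)
    then show "k \<le> 1 / 256" by (simp add: k_def)
  qed
  show ?thesis
  \<comment> \<open>The first two witnesses are the threshold and the rate of
    \<open>failure_probability_bound\<close>; the third is the largest \<open>\<epsilon>\<close> for
    which \<open>d \<le> c0 / 80\<close> is guaranteed by
    \<open>d \<le> \<epsilon> / 4\<close>.\<close>
  proof (rule exI[of _ "40 / k"], rule exI[of _ "k / 2"], rule exI[of _ "c0 / 20"], intro conjI allI impI)
    fix \<epsilon> :: real and p n :: nat and \<Sigma> :: rmat and D :: "rvec measure"
    assume \<epsilon>: "0 < \<epsilon>" "\<epsilon> \<le> c0 / 20" and p: "1 \<le> p" and E: "elliptical p \<Sigma> D"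
      and n: "40 / k * (real p)\<^sup>2 / \<epsilon>\<^sup>2 \<le> real n"
    define X where "X = real n * \<epsilon>\<^sup>2 / (real p)\<^sup>2"
    have pp: "0 < (real p)\<^sup>2" using p by simp
    have \<epsilon>\<epsilon>: "0 < \<epsilon>\<^sup>2" "\<epsilon>\<^sup>2 \<le> 1" using \<epsilon> c0 by (auto simp: power_le_one)
    have X: "40 / k \<le> X"
    proof -
      have "40 / k * (real p)\<^sup>2 \<le> real n * \<epsilon>\<^sup>2" using n \<epsilon>\<epsilon>(1) by (simp only: pos_divide_le_eq)
      then show ?thesis unfolding X_def using pp by (simp only: pos_le_divide_eq)
    qed
    have X0: "0 < X" using X k by (meson divide_pos_pos less_le_trans zero_less_numeral)
    \<comment> \<open>The lower bound on the sample size excludes the empty sample.\<close>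
    then have n0: "0 < n" by (cases "n = 0") (auto simp: X_def)
    define \<tau> where "\<tau> = 1 / 2 ^ 38 * \<epsilon> / (16 * sqrt (real p))"
    have "real n * \<tau>\<^sup>2 / 16 = k * X * real p"
    proof -
      have "\<tau>\<^sup>2 = c0\<^sup>2 * \<epsilon>\<^sup>2 / (256 * real p)"
        unfolding \<tau>_def c0_def[symmetric] using p by (simp add: power_divide power_mult_distrib)
      then show ?thesis using p by (simp add: k_def X_def power2_eq_square[of "real p"])
    qed
    then have e1: "exp (- real n * \<tau>\<^sup>2 / 16) = exp (- k * X * real p)" by simp
    have "X * (real p)\<^sup>2 \<le> real n"
    proof -
      have "X * (real p)\<^sup>2 = real n * \<epsilon>\<^sup>2" using pp by (simp add: X_def)
      also have "\<dots> \<le> real n * 1" using \<epsilon>\<epsilon> by (intro mult_left_mono) auto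
      finally show ?thesis by simp
    qed
    then have e2: "exp (- real n / 2) \<le> exp (- X * (real p)\<^sup>2 / 2)" by simp
    have "2 * real (card (coarse_net p)) * exp (- real n * \<tau>\<^sup>2 / 16) + real (card (fine_net p)) * exp (- real n / 2) \<le>
        2 * exp (18 * real p) * exp (- k * X * real p) + exp (1024 * (real p)\<^sup>2) * exp (- X * (real p)\<^sup>2 / 2)"
      unfolding e1 by (intro add_mono mult_mono card_coarse_net card_fine_net e2) auto
    also have "\<dots> \<le> exp (- (k / 2) * X)" by (rule failure_probability_bound[OF p k X])
    also have "- (k / 2) * X = - (k / 2) * real n * \<epsilon>\<^sup>2 / (real p)\<^sup>2" by (simp add: X_def)
    finally show "1 - exp (- (k / 2) * real n * \<epsilon>\<^sup>2 / (real p)\<^sup>2) \<le>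
        \<P>(x in \<Pi>\<^sub>M i\<in>{..<n}. D. tyler_exists p n x \<and>
          frobenius_norm (1\<^sub>m p - mat_sqrt \<Sigma> * mat_inv (tyler p n x) * mat_sqrt \<Sigma>) \<le> \<epsilon>)"
      using tyler_failure_probability[OF E p n0 \<epsilon>(1)] \<epsilon>(2) unfolding \<tau>_def c0_def by linarith
  qed (use k c0 in auto)
qed

end
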